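(* Let $(A,\alpha_A)$ and $(B,\alpha_B)$ be Hom-Hopf algebras with bijective structure maps and bijective antipodes, and let $(A,B)$ be a dual pair with respect to $(-,-):A\otimes B\to k$. Let $A\bowtie B$ be the vector space $A\otimes B$ (with elements written $a\bowtie b$), with structure map $\alpha_A\otimes\alpha_B$, unit $1_A\bowtie1_B$ and multiplication $$(a\bowtie b)(a'\bowtie b')=(S_A^{-1}\alpha_A(a'_1),b_2)\,(a'_{22},\alpha_B^{-1}(b_{11}))\ a\,\alpha_A^{-2}(a'_{21})\bowtie\alpha_B^{-2}(b_{12})\,b'.$$ Define $\Delta:A\bowtie B\to(A\bowtie B)\otimes(A\bowtie B)$ by $$\Delta(a\bowtie b)=a_1\bowtie b_2\otimes a_2\bowtie b_1$$ (with counit $\varepsilon_A\otimes\varepsilon_B$), and define $S=T\circ\tau\circ(S_A\otimes S_B^{-1})$. Then $A\bowtie B$ is a Hom-Hopf algebra with comultiplication $\Delta$ and antipode $S$ (the Drinfel'd double of $A$ and $B$).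
   Context: Everything is over a fixed field $k$. Sweedler notation $\Delta(c)=c_1\otimes c_2$, $\Delta(c_2)=c_{21}\otimes c_{22}$ etc. (summation omitted). A (unital) Hom-associative algebra is $(A,\mu,\alpha)$ with $\mu(a\otimes b)=ab$, $1_A\in A$, such that $\alpha(ab)=\alpha(a)\alpha(b)$, $\alpha(1_A)=1_A$, $1_Aa=\alpha(a)=a1_A$, $\alpha(a)(bc)=(ab)\alpha(c)$. A (counital) Hom-coassociative coalgebra is $(C,\Delta,\varepsilon,\alpha)$ with $\varepsilon\circ\alpha=\varepsilon$, $(\alpha\otimes\alpha)\Delta=\Delta\alpha$, $(\varepsilon\otimes id)\Delta=\alpha=(id\otimes\varepsilon)\Delta$, $(\Delta\otimes\alpha)\Delta=(\alpha\otimes\Delta)\Delta$. A Hom-bialgebra is both, with the same $\alpha$, such that $\Delta$ and $\varepsilon$ are unital and multiplicative. A Hom-Hopf algebra is a Hom-bialgebra with a linear map $S$ such that $S\alpha=\alpha S$ and $S(h_1)h_2=h_1S(h_2)=\varepsilon(h)1$. No finite-dimensionality is assumed. $(A,B)$ is a dual pair if $(-,-):A\otimes B\to k$ is a non-degenerate bilinear form such that for all $a,a'\in A$, $b,b'\in B$: $(a,1)=\varepsilon(a)$, $(1,b)=\varepsilon(b)$; $(\alpha_A(a),\alpha_B(b))=(a,b)$; $(aa',b)=(\alpha_A^2(a),b_1)(\alpha_A^2(a'),b_2)$; $(a,bb')=(a_1,\alpha_B^2(b))(a_2,\alpha_B^2(b'))$; $(S_A(a),b)=(a,S_B^{-1}(b))$.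 $\tau$ denotes the flip map $x\otimes y\mapsto y\otimes x$, and $T=R_1\circ R_2^{-1}\circ\tau:B\otimes A\to A\otimes B$, where $R_1,R_2:A\otimes B\to A\otimes B$ are the invertible maps $$R_1(a\otimes b)=(\alpha_A(a_2),b_1)\,\alpha_A^{-1}(a_1)\otimes\alpha_B^{-1}(b_2),\qquad R_2(a\otimes b)=(\alpha_A(a_1),b_2)\,\alpha_A^{-1}(a_2)\otimes\alpha_B^{-1}(b_1),$$ with $R_2^{-1}(a\otimes b)=(S_A^{-1}\alpha_A(a_1),b_2)\,\alpha_A^{-1}(a_2)\otimes\alpha_B^{-1}(b_1)$. The multiplication of $A\bowtie B$ is $(\mu_A\otimes\mu_B)\circ(id\otimes T\otimes id)$. *)

theory Defs
  imports Complex_Main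
begin

section \<open>Vector spaces on a carrier, linear and bilinear maps\<close>

text \<open>
  A vector space over the field \<open>'k\<close> is a subspace of a vector space whose underlying set is a
  whole type. Carriers are needed because a tensor product depends on the scalar
  multiplications, hence cannot be a type of its own. Maps are total functions of which only the
  values on the carrier matter.
\<close>

record ('k, 'v) vspace =
  vcarrier :: "'v set"
  vscale :: "'k \<Rightarrow> 'v \<Rightarrow> 'v"

definition vector_space_on :: "('k::field, 'v::ab_group_add, 'm) vspace_scheme \<Rightarrow> bool" where
  "vector_space_on V \<longleftrightarrow> vector_space (vscale V) \<and> module.subspace (vscale V) (vcarrier V)"

definition linear_on ::
  "('k::field, 'v::ab_group_add, 'm) vspace_scheme \<Rightarrow> ('k, 'w::ab_group_add, 'n) vspace_scheme \<Rightarrow>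
   ('v \<Rightarrow> 'w) \<Rightarrow> bool" where
  "linear_on V W f \<longleftrightarrow>
     (\<forall>x\<in>vcarrier V. f x \<in> vcarrier W) \<and>
     (\<forall>x\<in>vcarrier V. \<forall>y\<in>vcarrier V. f (x + y) = f x + f y) \<and>
     (\<forall>c. \<forall>x\<in>vcarrier V. f (vscale V c x) = vscale W c (f x))"

definition bilinear_on ::
  "('k::field, 'v::ab_group_add, 'm) vspace_scheme \<Rightarrow> ('k, 'w::ab_group_add, 'n) vspace_scheme \<Rightarrow>
   ('k, 'u::ab_group_add, 'l) vspace_scheme \<Rightarrow> ('v \<Rightarrow> 'w \<Rightarrow> 'u) \<Rightarrow> bool" where
  "bilinear_on V W U f \<longleftrightarrow>
     (\<forall>w\<in>vcarrier W. linear_on V U (\<lambda>v. f v w)) \<and> (\<forall>v\<in>vcarrier V. linear_on W U (f v))"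

definition scalars :: "('k::field, 'k) vspace" where
  "scalars = \<lparr>vcarrier = UNIV, vscale = (*)\<rparr>"

section \<open>Tensor products\<close>

text \<open>
  The type \<open>tensor\<close> is the space of all functionals on functions \<open>'v \<Rightarrow> 'w \<Rightarrow> 'k\<close>, an ambient
  vector space in which \<open>V \<otimes> W\<close> is realised as a subspace: the pure tensor \<open>v \<otimes> w\<close> is evaluation
  of bilinear forms at \<open>(v, w)\<close> (the value 0 at functions that are not bilinear forms is a
  dummy), and \<open>V \<otimes> W\<close> is the span of the pure tensors. That this is a tensor product is shown
  below: \<open>bilinear_on_pure\<close>, \<open>tensor_universal\<close>, \<open>tensor_linear_eqI\<close>.
\<close>

typedef ('v, 'w, 'k) tensor = "UNIV :: (('v \<Rightarrow> 'w \<Rightarrow> 'k) \<Rightarrow> 'k) set"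
  morphisms teval Tensor by simp

lemmas teval_Tensor [simp] = Tensor_inverse[OF UNIV_I]

lemma tensor_eqI: "(\<And>\<beta>. teval s \<beta> = teval t \<beta>) \<Longrightarrow> s = t"
  by (metis ext teval_inject)

instantiation tensor :: (type, type, ab_group_add) ab_group_add
begin

definition "0 = Tensor (\<lambda>\<beta>. 0)"
definition "s + t = Tensor (\<lambda>\<beta>. teval s \<beta> + teval t \<beta>)"
definition "s - t = Tensor (\<lambda>\<beta>. teval s \<beta> - teval t \<beta>)"
definition "- t = Tensor (\<lambda>\<beta>. - teval t \<beta>)"

instance
  by standard
    (auto intro!: tensor_eqI
      simp: zero_tensor_def plus_tensor_def minus_tensor_def uminus_tensor_def algebra_simps)

end

definition tscale :: "'k::field \<Rightarrow> ('v, 'w, 'k) tensor \<Rightarrow> ('v, 'w, 'k) tensor" where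
  "tscale c t = Tensor (\<lambda>\<beta>. c * teval t \<beta>)"

definition pure ::
  "('k::field, 'v::ab_group_add, 'm) vspace_scheme \<Rightarrow> ('k, 'w::ab_group_add, 'n) vspace_scheme \<Rightarrow>
   'v \<Rightarrow> 'w \<Rightarrow> ('v, 'w, 'k) tensor" where
  "pure V W v w = Tensor (\<lambda>\<beta>. if bilinear_on V W scalars \<beta> then \<beta> v w else 0)"

lemma teval_simps [simp]:
  "teval 0 \<beta> = 0"
  "teval (s + t) \<beta> = teval s \<beta> + teval t \<beta>"
  "teval (s - t) \<beta> = teval s \<beta> - teval t \<beta>"
  "teval (- t) \<beta> = - teval t \<beta>"
  "teval (tscale c t) \<beta> = c * teval t \<beta>"
  by (simp_all add: zero_tensor_def plus_tensor_def minus_tensor_def uminus_tensor_def tscale_def)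

lemma teval_pure [simp]:
  "teval (pure V W v w) \<beta> = (if bilinear_on V W scalars \<beta> then \<beta> v w else 0)"
  by (simp add: pure_def)

abbreviation pure_syntax ::
  "'v \<Rightarrow> ('k::field, 'v::ab_group_add, 'm) vspace_scheme \<Rightarrow>
   ('k, 'w::ab_group_add, 'n) vspace_scheme \<Rightarrow> 'w \<Rightarrow> ('v, 'w, 'k) tensor"
  ("(_/ \<otimes>\<^bsub>_,_\<^esub> _)" [71, 0, 0, 71] 70) where
  "v \<otimes>\<^bsub>V,W\<^esub> w \<equiv> pure V W v w"

definition tensor ::
  "('k::field, 'v::ab_group_add, 'm) vspace_scheme \<Rightarrow> ('k, 'w::ab_group_add, 'n) vspace_scheme \<Rightarrow>
   ('k, ('v, 'w, 'k) tensor) vspace" where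
  "tensor V W =
     \<lparr>vcarrier = module.span tscale {v \<otimes>\<^bsub>V,W\<^esub> w |v w. v \<in> vcarrier V \<and> w \<in> vcarrier W},
      vscale = tscale\<rparr>"

text \<open>The linear map \<open>V \<otimes> W \<rightarrow> U\<close> induced by a bilinear map \<open>f\<close>.\<close>

definition tlift ::
  "('k::field, 'v::ab_group_add, 'm) vspace_scheme \<Rightarrow> ('k, 'w::ab_group_add, 'n) vspace_scheme \<Rightarrow>
   ('k, 'u::ab_group_add, 'l) vspace_scheme \<Rightarrow> ('v \<Rightarrow> 'w \<Rightarrow> 'u) \<Rightarrow> ('v, 'w, 'k) tensor \<Rightarrow> 'u" where
  "tlift V W U f =
     (SOME h. linear_on (tensor V W) U h \<and>
              (\<forall>v\<in>vcarrier V. \<forall>w\<in>vcarrier W. h (v \<otimes>\<^bsub>V,W\<^esub> w) = f v w))"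

interpretation tensor_space: vector_space "tscale :: 'k::field \<Rightarrow> ('v, 'w, 'k) tensor \<Rightarrow> _"
  by unfold_locales (auto intro!: tensor_eqI simp: algebra_simps)

lemma vector_space_on_scalars: "vector_space_on (scalars :: ('k::field, 'k) vspace)"
proof -
  interpret vector_space "(*) :: 'k \<Rightarrow> 'k \<Rightarrow> 'k"
    by unfold_locales (auto simp: algebra_simps)
  show ?thesis
    by (auto simp: vector_space_on_def scalars_def vector_space_axioms)
qed

lemma vector_space_on_tensor: "vector_space_on (tensor V W)"
  by (auto simp: vector_space_on_def tensor_def tensor_space.vector_space_axioms)

lemma pure_in_tensor:
  "v \<in> vcarrier V \<Longrightarrow> w \<in> vcarrier W \<Longrightarrow> v \<otimes>\<^bsub>V,W\<^esub> w \<in> vcarrier (tensor V W)"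
  by (auto simp: tensor_def intro!: tensor_space.span_base)

lemma bilinear_on_pure: "bilinear_on V W (tensor V W) (pure V W)"
proof -
  have 1: "(v + v') \<otimes>\<^bsub>V,W\<^esub> w = v \<otimes>\<^bsub>V,W\<^esub> w + v' \<otimes>\<^bsub>V,W\<^esub> w"
    if "v \<in> vcarrier V" "v' \<in> vcarrier V" "w \<in> vcarrier W" for v v' w
    using that by (intro tensor_eqI) (auto simp: bilinear_on_def linear_on_def)
  have 2: "v \<otimes>\<^bsub>V,W\<^esub> (w + w') = v \<otimes>\<^bsub>V,W\<^esub> w + v \<otimes>\<^bsub>V,W\<^esub> w'"
    if "v \<in> vcarrier V" "w \<in> vcarrier W" "w' \<in> vcarrier W" for v w w'
    using that by (intro tensor_eqI) (auto simp: bilinear_on_def linear_on_def)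
  have 3: "vscale V c v \<otimes>\<^bsub>V,W\<^esub> w = tscale c (v \<otimes>\<^bsub>V,W\<^esub> w)"
       "v \<otimes>\<^bsub>V,W\<^esub> vscale W c w = tscale c (v \<otimes>\<^bsub>V,W\<^esub> w)"
    if "v \<in> vcarrier V" "w \<in> vcarrier W" for v w c
    using that by (auto intro!: tensor_eqI simp: bilinear_on_def linear_on_def scalars_def)
  have 4: "vscale (tensor V W) = tscale"
    by (simp add: tensor_def)
  show ?thesis
    unfolding bilinear_on_def linear_on_def 4
    by (intro conjI ballI allI) (simp_all only: 1 2 3 pure_in_tensor)
qed

lemma tensor_induct [consumes 1, case_names zero pure add scale]:
  assumes t: "t \<in> vcarrier (tensor V W)"
    and zero: "P 0"
    and pure: "\<And>v w. v \<in> vcarrier V \<Longrightarrow> w \<in> vcarrier W \<Longrightarrow> P (v \<otimes>\<^bsub>V,W\<^esub> w)"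
    and add: "\<And>s t. s \<in> vcarrier (tensor V W) \<Longrightarrow> t \<in> vcarrier (tensor V W) \<Longrightarrow>
               P s \<Longrightarrow> P t \<Longrightarrow> P (s + t)"
    and scale: "\<And>c t. t \<in> vcarrier (tensor V W) \<Longrightarrow> P t \<Longrightarrow> P (vscale (tensor V W) c t)"
  shows "P t"
proof -
  let ?G = "{v \<otimes>\<^bsub>V,W\<^esub> w |v w. v \<in> vcarrier V \<and> w \<in> vcarrier W}"
  have eq: "vcarrier (tensor V W) = tensor_space.span ?G" "vscale (tensor V W) = tscale"
    by (auto simp: tensor_def)
  have "t \<in> tensor_space.span ?G" using t eq by simp
  then have "t \<in> tensor_space.span ?G \<and> P t"
  proof (induction rule: tensor_space.span_induct_alt)
    case base
    then show ?case using zero tensor_space.span_zero by blast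
  next
    case (step c x y)
    then obtain v w where x: "x = v \<otimes>\<^bsub>V,W\<^esub> w" "v \<in> vcarrier V" "w \<in> vcarrier W"
      by blast
    have "x \<in> tensor_space.span ?G"
      by (rule tensor_space.span_base) (fact step)
    then have cx: "tscale c x \<in> tensor_space.span ?G" "P (tscale c x)"
      using scale[of x c] pure[OF x(2,3)] unfolding eq x(1)
      by (auto intro: tensor_space.span_scale)
    show ?case
      using add[of "tscale c x" y] cx step(2) unfolding eq
      by (auto intro: tensor_space.span_add)
  qed
  then show ?thesis by simp
qed

lemma tensor_linear_eqI:
  assumes "linear_on (tensor V W) U g" "linear_on (tensor V W) U h"
    and "\<And>v w. v \<in> vcarrier V \<Longrightarrow> w \<in> vcarrier W \<Longrightarrow> g (v \<otimes>\<^bsub>V,W\<^esub> w) = h (v \<otimes>\<^bsub>V,W\<^esub> w)"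
    and t: "t \<in> vcarrier (tensor V W)"
  shows "g t = h t"
proof -
  have 0: "f 0 = 0" if "linear_on (tensor V W) U f" for f
  proof -
    have "0 \<in> vcarrier (tensor V W)" by (simp add: tensor_def tensor_space.span_zero)
    with that have "f (0 + 0) = f 0 + f 0" unfolding linear_on_def by blast
    then show ?thesis by simp
  qed
  show ?thesis
    using t
  proof (induction rule: tensor_induct)
    case zero
    then show ?case using 0 assms by metis
  next
    case (pure v w)
    then show ?case using assms by blast
  next
    case (add s t)
    then show ?case using assms(1,2) by (simp add: linear_on_def)
  next
    case (scale c t)
    then show ?case using assms(1,2) by (simp add: linear_on_def)
  qed
qed

lemma functionals_separate:
  assumes U: "vector_space_on U" and u: "u \<in> vcarrier U" "u' \<in> vcarrier U"
    and eq: "\<And>\<phi>. linear_on U scalars \<phi> \<Longrightarrow> \<phi> u = \<phi> u'"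
  shows "u = u'"
proof (rule ccontr)
  assume "u \<noteq> u'"
  interpret U: vector_space "vscale U" using U by (simp add: vector_space_on_def)
  interpret K: vector_space "(*) :: 'a \<Rightarrow> 'a \<Rightarrow> 'a"
    by unfold_locales (auto simp: algebra_simps)
  interpret P: vector_space_pair "vscale U" "(*) :: 'a \<Rightarrow> 'a \<Rightarrow> 'a" ..
  have "U.independent {u - u'}" using \<open>u \<noteq> u'\<close> by simp
  then obtain g where g: "Vector_Spaces.linear (vscale U) (*) g" "g (u - u') = 1"
    using P.linear_independent_extend[of "{u - u'}" "\<lambda>_. 1"] by auto
  then have "linear_on U scalars g"
    by (auto simp: linear_on_def scalars_def P.linear_add P.linear_scale)
  moreover have "g (u - u') = g u - g u'" using g(1) by (rule P.linear_diff)
  ultimately show False using eq[of g] g(2) by simp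
qed

lemma tensor_universal:
  assumes U: "vector_space_on U" and f: "bilinear_on V W U f"
  shows "\<exists>h. linear_on (tensor V W) U h \<and>
             (\<forall>v\<in>vcarrier V. \<forall>w\<in>vcarrier W. h (v \<otimes>\<^bsub>V,W\<^esub> w) = f v w)"
proof -
  interpret U: vector_space "vscale U" using U by (simp add: vector_space_on_def)
  have sub: "U.subspace (vcarrier U)" using U by (simp add: vector_space_on_def)
  define R where "R t u \<longleftrightarrow> u \<in> vcarrier U \<and>
      (\<forall>\<phi>. linear_on U scalars \<phi> \<longrightarrow> \<phi> u = teval t (\<lambda>x y. \<phi> (f x y)))" for t u
  have uniq: "u = u'" if "R t u" "R t u'" for t u u'
    using that functionals_separate[OF U, of u u'] unfolding R_def by metis
  have R_pure: "R (v \<otimes>\<^bsub>V,W\<^esub> w) (f v w)" if "v \<in> vcarrier V" "w \<in> vcarrier W" for v w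
  proof -
    have "bilinear_on V W scalars (\<lambda>x y. \<phi> (f x y))" if "linear_on U scalars \<phi>" for \<phi>
      using that f by (auto simp: bilinear_on_def linear_on_def)
    then show ?thesis
      using that f by (auto simp: R_def bilinear_on_def linear_on_def)
  qed
  have R_add: "R (s + t) (x + y)" if "R s x" "R t y" for s t x y
    using that sub unfolding R_def
    by (auto simp: linear_on_def intro: U.subspace_add)
  have R_scale: "R (tscale c t) (vscale U c x)" if "R t x" for c t x
    using that sub unfolding R_def
    by (auto simp: linear_on_def scalars_def intro: U.subspace_scale)
  have R_0: "R 0 0"
    unfolding R_def
  proof (intro conjI allI impI)
    show "0 \<in> vcarrier U" using sub by (rule U.subspace_0)
    fix \<phi> assume "linear_on U scalars \<phi>"
    then have "\<phi> (0 + 0) = \<phi> 0 + \<phi> 0"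
      using \<open>0 \<in> vcarrier U\<close> unfolding linear_on_def by blast
    then show "\<phi> 0 = teval 0 (\<lambda>x y. \<phi> (f x y))"
      by (metis add.right_neutral add_left_cancel teval_simps(1))
  qed
  have sc: "vscale (tensor V W) = tscale" by (simp add: tensor_def)
  have ex: "\<exists>u. R t u" if "t \<in> vcarrier (tensor V W)" for t
    using that
  proof (induction rule: tensor_induct)
    case (scale c t)
    then show ?case unfolding sc using R_scale by blast
  qed (use R_0 R_pure R_add in blast)+
  define h where "h t = (SOME u. R t u)" for t
  have hR: "R t (h t)" if "t \<in> vcarrier (tensor V W)" for t
    unfolding h_def using someI_ex[OF ex[OF that]] .
  have T: "vector_space_on (tensor V W)" by (rule vector_space_on_tensor)
  interpret T: vector_space "vscale (tensor V W)"
    using T by (simp add: vector_space_on_def)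
  have subT: "T.subspace (vcarrier (tensor V W))"
    using T by (simp add: vector_space_on_def)
  have "linear_on (tensor V W) U h"
    unfolding linear_on_def
  proof (intro conjI ballI allI)
    fix s assume s: "s \<in> vcarrier (tensor V W)"
    show "h s \<in> vcarrier U" using hR[OF s] by (simp add: R_def)
    show "h (vscale (tensor V W) c s) = vscale U c (h s)" for c
      using uniq[OF hR[OF T.subspace_scale[OF subT s]]] R_scale[OF hR[OF s]] sc by metis
    fix t assume t: "t \<in> vcarrier (tensor V W)"
    show "h (s + t) = h s + h t"
      using uniq[OF hR[OF T.subspace_add[OF subT s t]]] R_add[OF hR[OF s] hR[OF t]] by metis
  qed
  moreover have "h (v \<otimes>\<^bsub>V,W\<^esub> w) = f v w" if "v \<in> vcarrier V" "w \<in> vcarrier W" for v w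
    using uniq[OF hR[OF pure_in_tensor[OF that]] R_pure[OF that]] .
  ultimately show ?thesis by blast
qed

lemma
  assumes "vector_space_on U" "bilinear_on V W U f"
  shows linear_on_tlift: "linear_on (tensor V W) U (tlift V W U f)"
    and tlift_pure: "v \<in> vcarrier V \<Longrightarrow> w \<in> vcarrier W \<Longrightarrow> tlift V W U f (v \<otimes>\<^bsub>V,W\<^esub> w) = f v w"
  using someI_ex[OF tensor_universal[OF assms]] unfolding tlift_def[symmetric] by blast+

definition tmap ::
  "('k::field, 'v::ab_group_add, 'm) vspace_scheme \<Rightarrow> ('k, 'w::ab_group_add, 'n) vspace_scheme \<Rightarrow>
   ('k, 'v'::ab_group_add, 'm2) vspace_scheme \<Rightarrow> ('k, 'w'::ab_group_add, 'n2) vspace_scheme \<Rightarrow>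
   ('v \<Rightarrow> 'v') \<Rightarrow> ('w \<Rightarrow> 'w') \<Rightarrow> ('v, 'w, 'k) tensor \<Rightarrow> ('v', 'w', 'k) tensor" where
  "tmap V W V' W' f g = tlift V W (tensor V' W') (\<lambda>v w. f v \<otimes>\<^bsub>V',W'\<^esub> g w)"

definition tflip ::
  "('k::field, 'v::ab_group_add, 'm) vspace_scheme \<Rightarrow> ('k, 'w::ab_group_add, 'n) vspace_scheme \<Rightarrow>
   ('v, 'w, 'k) tensor \<Rightarrow> ('w, 'v, 'k) tensor" where
  "tflip V W = tlift V W (tensor W V) (\<lambda>v w. w \<otimes>\<^bsub>W,V\<^esub> v)"

text \<open>The associator \<open>(V \<otimes> V) \<otimes> V \<rightarrow> V \<otimes> (V \<otimes> V)\<close>.\<close>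

definition tassoc ::
  "('k::field, 'v::ab_group_add, 'm) vspace_scheme \<Rightarrow>
   (('v, 'v, 'k) tensor, 'v, 'k) tensor \<Rightarrow> ('v, ('v, 'v, 'k) tensor, 'k) tensor" where
  "tassoc V =
     tlift (tensor V V) V (tensor V (tensor V V))
       (\<lambda>t z. tlift V V (tensor V (tensor V V)) (\<lambda>x y. x \<otimes>\<^bsub>V,tensor V V\<^esub> (y \<otimes>\<^bsub>V,V\<^esub> z)) t)"

section \<open>Hom-Hopf algebras\<close>

record ('k, 'a) hom_hopf = "('k, 'a) vspace" +
  alpha :: "'a \<Rightarrow> 'a"
  mult :: "'a \<Rightarrow> 'a \<Rightarrow> 'a"
  unit :: 'a
  comult :: "'a \<Rightarrow> ('a, 'a, 'k) tensor"
  counit :: "'a \<Rightarrow> 'k"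
  antipode :: "'a \<Rightarrow> 'a"

text \<open>
  Sweedler notation: for a bilinear \<open>f\<close> with values in \<open>U\<close>, \<open>sweedler C U c (\<lambda>c1 c2. f c1 c2)\<close> is
  the element \<open>f(c\<^sub>1, c\<^sub>2)\<close> of \<open>U\<close>, summation over \<open>\<Delta>(c) = c\<^sub>1 \<otimes> c\<^sub>2\<close> understood.
\<close>

definition sweedler ::
  "('k::field, 'a::ab_group_add, 'm) hom_hopf_scheme \<Rightarrow> ('k, 'u::ab_group_add, 'l) vspace_scheme \<Rightarrow>
   'a \<Rightarrow> ('a \<Rightarrow> 'a \<Rightarrow> 'u) \<Rightarrow> 'u" where
  "sweedler C U c f = tlift C C U f (comult C c)"

definition hom_algebra :: "('k::field, 'a::ab_group_add, 'm) hom_hopf_scheme \<Rightarrow> bool" where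
  "hom_algebra A \<longleftrightarrow>
     vector_space_on A \<and> linear_on A A (alpha A) \<and> bilinear_on A A A (mult A) \<and>
     unit A \<in> vcarrier A \<and>
     (\<forall>a\<in>vcarrier A. \<forall>b\<in>vcarrier A. alpha A (mult A a b) = mult A (alpha A a) (alpha A b)) \<and>
     alpha A (unit A) = unit A \<and>
     (\<forall>a\<in>vcarrier A. mult A (unit A) a = alpha A a \<and> mult A a (unit A) = alpha A a) \<and>
     (\<forall>a\<in>vcarrier A. \<forall>b\<in>vcarrier A. \<forall>c\<in>vcarrier A.
        mult A (alpha A a) (mult A b c) = mult A (mult A a b) (alpha A c))"

definition hom_coalgebra :: "('k::field, 'a::ab_group_add, 'm) hom_hopf_scheme \<Rightarrow> bool" where
  "hom_coalgebra C \<longleftrightarrow>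
     vector_space_on C \<and> linear_on C C (alpha C) \<and>
     linear_on C (tensor C C) (comult C) \<and> linear_on C scalars (counit C) \<and>
     (\<forall>c\<in>vcarrier C.
        counit C (alpha C c) = counit C c \<and>
        tmap C C C C (alpha C) (alpha C) (comult C c) = comult C (alpha C c) \<and>
        sweedler C C c (\<lambda>c1 c2. vscale C (counit C c1) c2) = alpha C c \<and>
        sweedler C C c (\<lambda>c1 c2. vscale C (counit C c2) c1) = alpha C c \<and>
        tassoc C (tmap C C (tensor C C) C (comult C) (alpha C) (comult C c)) =
          tmap C C C (tensor C C) (alpha C) (comult C) (comult C c))"

text \<open>The product \<open>(x \<otimes> y)(x' \<otimes> y') = xx' \<otimes> yy'\<close> on \<open>A \<otimes> A\<close>.\<close>

definition tensor_mult ::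
  "('k::field, 'a::ab_group_add, 'm) hom_hopf_scheme \<Rightarrow>
   ('a, 'a, 'k) tensor \<Rightarrow> ('a, 'a, 'k) tensor \<Rightarrow> ('a, 'a, 'k) tensor" where
  "tensor_mult A s t =
     tlift A A (tensor A A) (\<lambda>x y.
       tlift A A (tensor A A) (\<lambda>x' y'. mult A x x' \<otimes>\<^bsub>A,A\<^esub> mult A y y') t) s"

definition hom_bialgebra :: "('k::field, 'a::ab_group_add, 'm) hom_hopf_scheme \<Rightarrow> bool" where
  "hom_bialgebra H \<longleftrightarrow>
     hom_algebra H \<and> hom_coalgebra H \<and>
     comult H (unit H) = unit H \<otimes>\<^bsub>H,H\<^esub> unit H \<and>
     (\<forall>g\<in>vcarrier H. \<forall>h\<in>vcarrier H.
        comult H (mult H g h) = tensor_mult H (comult H g) (comult H h)) \<and>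
     counit H (unit H) = 1 \<and>
     (\<forall>g\<in>vcarrier H. \<forall>h\<in>vcarrier H. counit H (mult H g h) = counit H g * counit H h)"

definition hom_hopf_algebra :: "('k::field, 'a::ab_group_add, 'm) hom_hopf_scheme \<Rightarrow> bool" where
  "hom_hopf_algebra H \<longleftrightarrow>
     hom_bialgebra H \<and> linear_on H H (antipode H) \<and>
     (\<forall>h\<in>vcarrier H.
        antipode H (alpha H h) = alpha H (antipode H h) \<and>
        sweedler H H h (\<lambda>h1 h2. mult H (antipode H h1) h2) = vscale H (counit H h) (unit H) \<and>
        sweedler H H h (\<lambda>h1 h2. mult H h1 (antipode H h2)) = vscale H (counit H h) (unit H))"

abbreviation alpha_inv :: "('k, 'a, 'm) hom_hopf_scheme \<Rightarrow> 'a \<Rightarrow> 'a" where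
  "alpha_inv H \<equiv> inv_into (vcarrier H) (alpha H)"

abbreviation antipode_inv :: "('k, 'a, 'm) hom_hopf_scheme \<Rightarrow> 'a \<Rightarrow> 'a" where
  "antipode_inv H \<equiv> inv_into (vcarrier H) (antipode H)"

section \<open>Dual pairs and the Drinfel'd double\<close>

definition nondegenerate_on ::
  "('k::field, 'a::ab_group_add, 'm) vspace_scheme \<Rightarrow> ('k, 'b::ab_group_add, 'n) vspace_scheme \<Rightarrow>
   ('a \<Rightarrow> 'b \<Rightarrow> 'k) \<Rightarrow> bool" where
  "nondegenerate_on A B p \<longleftrightarrow>
     (\<forall>a\<in>vcarrier A. (\<forall>b\<in>vcarrier B. p a b = 0) \<longrightarrow> a = 0) \<and>
     (\<forall>b\<in>vcarrier B. (\<forall>a\<in>vcarrier A. p a b = 0) \<longrightarrow> b = 0)"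

definition dual_pair ::
  "('k::field, 'a::ab_group_add, 'm) hom_hopf_scheme \<Rightarrow>
   ('k, 'b::ab_group_add, 'n) hom_hopf_scheme \<Rightarrow> ('a \<Rightarrow> 'b \<Rightarrow> 'k) \<Rightarrow> bool" where
  "dual_pair A B p \<longleftrightarrow>
     bilinear_on A B scalars p \<and> nondegenerate_on A B p \<and>
     (\<forall>a\<in>vcarrier A. p a (unit B) = counit A a) \<and>
     (\<forall>b\<in>vcarrier B. p (unit A) b = counit B b) \<and>
     (\<forall>a\<in>vcarrier A. \<forall>b\<in>vcarrier B. p (alpha A a) (alpha B b) = p a b) \<and>
     (\<forall>a\<in>vcarrier A. \<forall>a'\<in>vcarrier A. \<forall>b\<in>vcarrier B.
        p (mult A a a') b =
          sweedler B scalars b (\<lambda>b1 b2.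
            p (alpha A (alpha A a)) b1 * p (alpha A (alpha A a')) b2)) \<and>
     (\<forall>a\<in>vcarrier A. \<forall>b\<in>vcarrier B. \<forall>b'\<in>vcarrier B.
        p a (mult B b b') =
          sweedler A scalars a (\<lambda>a1 a2.
            p a1 (alpha B (alpha B b)) * p a2 (alpha B (alpha B b')))) \<and>
     (\<forall>a\<in>vcarrier A. \<forall>b\<in>vcarrier B. p (antipode A a) b = p a (antipode_inv B b))"

definition R1_map ::
  "('k::field, 'a::ab_group_add, 'm) hom_hopf_scheme \<Rightarrow>
   ('k, 'b::ab_group_add, 'n) hom_hopf_scheme \<Rightarrow> ('a \<Rightarrow> 'b \<Rightarrow> 'k) \<Rightarrow>
   ('a, 'b, 'k) tensor \<Rightarrow> ('a, 'b, 'k) tensor" where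
  "R1_map A B p =
     tlift A B (tensor A B) (\<lambda>a b.
       sweedler A (tensor A B) a (\<lambda>a1 a2. sweedler B (tensor A B) b (\<lambda>b1 b2.
         tscale (p (alpha A a2) b1) (alpha_inv A a1 \<otimes>\<^bsub>A,B\<^esub> alpha_inv B b2))))"

definition R2_map ::
  "('k::field, 'a::ab_group_add, 'm) hom_hopf_scheme \<Rightarrow>
   ('k, 'b::ab_group_add, 'n) hom_hopf_scheme \<Rightarrow> ('a \<Rightarrow> 'b \<Rightarrow> 'k) \<Rightarrow>
   ('a, 'b, 'k) tensor \<Rightarrow> ('a, 'b, 'k) tensor" where
  "R2_map A B p =
     tlift A B (tensor A B) (\<lambda>a b.
       sweedler A (tensor A B) a (\<lambda>a1 a2. sweedler B (tensor A B) b (\<lambda>b1 b2.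
         tscale (p (alpha A a1) b2) (alpha_inv A a2 \<otimes>\<^bsub>A,B\<^esub> alpha_inv B b1))))"

definition T_map ::
  "('k::field, 'a::ab_group_add, 'm) hom_hopf_scheme \<Rightarrow>
   ('k, 'b::ab_group_add, 'n) hom_hopf_scheme \<Rightarrow> ('a \<Rightarrow> 'b \<Rightarrow> 'k) \<Rightarrow>
   ('b, 'a, 'k) tensor \<Rightarrow> ('a, 'b, 'k) tensor" where
  "T_map A B p = R1_map A B p \<circ> inv_into (vcarrier (tensor A B)) (R2_map A B p) \<circ> tflip B A"

text \<open>
  In the next definition the variables \<open>x\<close>, \<open>y\<close> stand for \<open>a'\<close>, \<open>b\<close> in the product
  \<open>(a \<bowtie> b)(a' \<bowtie> b')\<close>: \<open>x21\<close> is \<open>a'\<^sub>2\<^sub>1\<close>, \<open>y12\<close> is \<open>b\<^sub>1\<^sub>2\<close>, and so on.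
\<close>

definition double_mult ::
  "('k::field, 'a::ab_group_add, 'm) hom_hopf_scheme \<Rightarrow>
   ('k, 'b::ab_group_add, 'n) hom_hopf_scheme \<Rightarrow> ('a \<Rightarrow> 'b \<Rightarrow> 'k) \<Rightarrow>
   ('a, 'b, 'k) tensor \<Rightarrow> ('a, 'b, 'k) tensor \<Rightarrow> ('a, 'b, 'k) tensor" where
  "double_mult A B p s t =
     tlift A B (tensor A B) (\<lambda>a y. tlift A B (tensor A B) (\<lambda>x b'.
       sweedler A (tensor A B) x (\<lambda>x1 x2. sweedler A (tensor A B) x2 (\<lambda>x21 x22.
       sweedler B (tensor A B) y (\<lambda>y1 y2. sweedler B (tensor A B) y1 (\<lambda>y11 y12.
         tscale (p (antipode_inv A (alpha A x1)) y2 * p x22 (alpha_inv B y11))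
           (mult A a (alpha_inv A (alpha_inv A x21)) \<otimes>\<^bsub>A,B\<^esub>
            mult B (alpha_inv B (alpha_inv B y12)) b')))))) t) s"

definition drinfeld_double ::
  "('k::field, 'a::ab_group_add, 'm) hom_hopf_scheme \<Rightarrow>
   ('k, 'b::ab_group_add, 'n) hom_hopf_scheme \<Rightarrow> ('a \<Rightarrow> 'b \<Rightarrow> 'k) \<Rightarrow>
   ('k, ('a, 'b, 'k) tensor) hom_hopf" where
  "drinfeld_double A B p =
     \<lparr>vcarrier = vcarrier (tensor A B),
      vscale = vscale (tensor A B),
      alpha = tmap A B A B (alpha A) (alpha B),
      mult = double_mult A B p,
      unit = unit A \<otimes>\<^bsub>A,B\<^esub> unit B,
      comult =
        (let D = tensor A B in
         tlift A B (tensor D D) (\<lambda>a b.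
           sweedler A (tensor D D) a (\<lambda>a1 a2. sweedler B (tensor D D) b (\<lambda>b1 b2.
             (a1 \<otimes>\<^bsub>A,B\<^esub> b2) \<otimes>\<^bsub>D,D\<^esub> (a2 \<otimes>\<^bsub>A,B\<^esub> b1))))),
      counit = tlift A B scalars (\<lambda>a b. counit A a * counit B b),
      antipode = T_map A B p \<circ> tflip A B \<circ> tmap A B A B (antipode A) (antipode_inv B)\<rparr>"

end

theory Submission
  imports Defs
begin

text \<open>
  If the structure map is invertible, \<open>(\<alpha>\<^sup>-\<^sup>1 \<circ> \<mu>, \<Delta> \<circ> \<alpha>\<^sup>-\<^sup>1)\<close> is an ordinary Hopf algebra on which \<open>\<alpha>\<close>
  acts by automorphisms, and the given algebra is its Yau twist by \<open>\<alpha>\<close>. Under this correspondence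
  \<open>(\<alpha> a, b)\<close> is an ordinary Hopf pairing, and \<open>A \<bowtie> B\<close> is the Yau twist by \<open>\<alpha>\<^sub>A \<otimes> \<alpha>\<^sub>B\<close> of the ordinary
  Drinfel'd double for that pairing.

  In the ordinary double put \<open>L\<^sub>a b = (a, b\<^sub>1) b\<^sub>2\<close>, \<open>R\<^sub>a b = (a, b\<^sub>2) b\<^sub>1\<close> and \<open>Q\<^sub>x\<^sub>,\<^sub>z = L\<^sub>z R\<^sub>S\<^sub>'\<^sub>x\<close>, where \<open>S'\<close> is
  the inverse antipode. The product is \<open>(a \<bowtie> b)(a' \<bowtie> b') = a a'\<^sub>2 \<bowtie> Q(a'\<^sub>1, a'\<^sub>3, b) b'\<close>. The actions
  \<open>L\<close> and \<open>R\<close> commute, are an anti-representation and a representation of \<open>A\<close>, and satisfy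
  \<open>b\<^sub>1 \<otimes> L\<^sub>a b\<^sub>2 = R\<^sub>a b\<^sub>1 \<otimes> b\<^sub>2\<close>; associativity and multiplicativity of \<open>\<Delta>\<close> follow from these rules by
  coassociativity of \<open>A\<close>. Since the antipode of \<open>a \<bowtie> b\<close> is \<open>(1 \<bowtie> S' b)(S a \<bowtie> 1)\<close>, its axiom reduces to
  those of \<open>A\<close> and of \<open>B\<close> with the opposite comultiplication.
\<close>

section \<open>Linear maps on carriers\<close>

text \<open>The \<alpha> in the pairing is dictated by the double and not by the axioms of a dual
  pair: by invariance under \<alpha>, \<open>(a, b)\<close> itself is multiplicative for the
  untwisted structures as well. Since \<open>\<Delta>\<close> is the untwisted coproduct after
  \<alpha>, the coefficient \<open>(\<alpha> a2, b1)\<close> of \<open>R1_map\<close> becomes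
  \<open>(\<alpha> (\<alpha> a2), \<alpha> b1) = (\<alpha> a2, b1)\<close> in untwisted legs. Hence
  \<open>(\<alpha> a, b)\<close> is the pairing for which the two doubles correspond.

  In infinite dimension there are no dual bases. An element of B is instead determined by its
  pairings with A, and L and R are the transposes of left and right multiplication in A, so that
  their composition rules are associativity in A.

  The formal obstacle is Sweedler notation. A map out of a tensor product is an opaque choice, of
  which nothing is known before bilinearity is shown. The proof therefore calculates with finite
  sums over one chosen representation of each tensor. Such sums can be interchanged and rewritten
  freely, and bilinearity is needed only where a coproduct is rearranged.\<close>

named_theorems lin

lemma vector_space_onD:
  assumes "vector_space_on V"
  shows "vector_space (vscale V)" "module.subspace (vscale V) (vcarrier V)"
  using assms by (auto simp: vector_space_on_def)

lemma
  assumes V: "vector_space_on V"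
  shows vs_zero: "0 \<in> vcarrier V"
    and vs_add: "x \<in> vcarrier V \<Longrightarrow> y \<in> vcarrier V \<Longrightarrow> x + y \<in> vcarrier V"
    and vs_scale: "x \<in> vcarrier V \<Longrightarrow> vscale V c x \<in> vcarrier V"
    and vs_diff: "x \<in> vcarrier V \<Longrightarrow> y \<in> vcarrier V \<Longrightarrow> x - y \<in> vcarrier V"
    and vs_scale_add_right: "vscale V c (x + y) = vscale V c x + vscale V c y"
    and vs_scale_add_left: "vscale V (c + d) x = vscale V c x + vscale V d x"
    and vs_scale_scale: "vscale V c (vscale V d x) = vscale V (c * d) x"
    and vs_scale_one: "vscale V 1 x = x"
proof -
  interpret V: vector_space "vscale V" using V by (rule vector_space_onD)
  note sub = vector_space_onD(2)[OF V]
  show "0 \<in> vcarrier V" using V.subspace_0[OF sub] .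
  show "x \<in> vcarrier V \<Longrightarrow> y \<in> vcarrier V \<Longrightarrow> x + y \<in> vcarrier V" using V.subspace_add[OF sub] .
  show "x \<in> vcarrier V \<Longrightarrow> vscale V c x \<in> vcarrier V" using V.subspace_scale[OF sub] .
  show "x \<in> vcarrier V \<Longrightarrow> y \<in> vcarrier V \<Longrightarrow> x - y \<in> vcarrier V" using V.subspace_diff[OF sub] .
  show "vscale V c (x + y) = vscale V c x + vscale V c y" by (rule V.scale_right_distrib)
  show "vscale V (c + d) x = vscale V c x + vscale V d x" by (rule V.scale_left_distrib)
  show "vscale V c (vscale V d x) = vscale V (c * d) x" by simp
  show "vscale V 1 x = x" by simp
qed

lemma vs_sum_list:
  "vector_space_on V \<Longrightarrow> (\<And>x. x \<in> set xs \<Longrightarrow> f x \<in> vcarrier V) \<Longrightarrow> (\<Sum>x\<leftarrow>xs. f x) \<in> vcarrier V"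
  by (induction xs) (auto intro: vs_zero vs_add)

lemma scalars_simps [simp]: "vcarrier scalars = UNIV" "vscale scalars = (*)"
  by (simp_all add: scalars_def)

lemma vscale_tensor [simp]: "vscale (tensor V W) = tscale"
  by (simp add: tensor_def)

lemma linear_onI:
  assumes "\<And>x. x \<in> vcarrier V \<Longrightarrow> f x \<in> vcarrier W"
    and "\<And>x y. x \<in> vcarrier V \<Longrightarrow> y \<in> vcarrier V \<Longrightarrow> f (x + y) = f x + f y"
    and "\<And>c x. x \<in> vcarrier V \<Longrightarrow> f (vscale V c x) = vscale W c (f x)"
  shows "linear_on V W f"
  using assms by (auto simp: linear_on_def)

lemma
  assumes "linear_on V W f"
  shows linear_on_mem: "x \<in> vcarrier V \<Longrightarrow> f x \<in> vcarrier W"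
    and linear_on_add: "x \<in> vcarrier V \<Longrightarrow> y \<in> vcarrier V \<Longrightarrow> f (x + y) = f x + f y"
    and linear_on_scale: "x \<in> vcarrier V \<Longrightarrow> f (vscale V c x) = vscale W c (f x)"
  using assms by (auto simp: linear_on_def)

lemma linear_on_zero:
  assumes "vector_space_on V" "linear_on V W f"
  shows "f 0 = 0"
proof -
  have "f (0 + 0) = f 0 + f 0"
    using linear_on_add[OF assms(2)] vs_zero[OF assms(1)] by blast
  then show ?thesis by simp
qed

lemma linear_on_diff:
  assumes "vector_space_on V" "linear_on V W f" "x \<in> vcarrier V" "y \<in> vcarrier V"
  shows "f (x - y) = f x - f y"
  using linear_on_add[OF assms(2), of "x - y" y] vs_diff[OF assms(1,3,4)] assms(4) by simp

lemma linear_on_sum_list: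
  assumes "vector_space_on V" "linear_on V W f" "\<And>x. x \<in> set xs \<Longrightarrow> g x \<in> vcarrier V"
  shows "f (\<Sum>x\<leftarrow>xs. g x) = (\<Sum>x\<leftarrow>xs. f (g x))"
  using assms(3)
proof (induction xs)
  case Nil
  then show ?case using linear_on_zero[OF assms(1,2)] by simp
next
  case (Cons a xs)
  then show ?case
    using linear_on_add[OF assms(2), of "g a" "\<Sum>x\<leftarrow>xs. g x"] vs_sum_list[OF assms(1), of xs g]
    by simp
qed

lemma linear_on_cong:
  assumes "vector_space_on V" "linear_on V W f" "\<And>x. x \<in> vcarrier V \<Longrightarrow> f x = g x"
  shows "linear_on V W g"
  using linear_on_mem[OF assms(2)] linear_on_add[OF assms(2)] linear_on_scale[OF assms(2)]
    vs_add[OF assms(1)] vs_scale[OF assms(1)]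
  by (intro linear_onI) (simp_all flip: assms(3))

lemma linear_on_id [lin]: "linear_on V V (\<lambda>x. x)"
  by (auto simp: linear_on_def)

lemma linear_on_compose: "linear_on V U f \<Longrightarrow> linear_on X V g \<Longrightarrow> linear_on X U (\<lambda>x. f (g x))"
  by (auto simp: linear_on_def)

lemma bilinear_onI:
  assumes "\<And>w. w \<in> vcarrier W \<Longrightarrow> linear_on V U (\<lambda>v. f v w)"
    and "\<And>v. v \<in> vcarrier V \<Longrightarrow> linear_on W U (\<lambda>w. f v w)"
  shows "bilinear_on V W U f"
  using assms by (auto simp: bilinear_on_def)

text \<open>The composed form, with \<open>g x\<close> in the slot, makes this usable as an
  introduction rule: each application peels one operation off a term, and
  \<open>linear_on_id\<close> ends the descent at the variable. The rules collected in
  \<open>lin\<close> all have this form.\<close>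

lemma bilinear_on_left:
  "bilinear_on V W U f \<Longrightarrow> linear_on X V g \<Longrightarrow> w \<in> vcarrier W \<Longrightarrow> linear_on X U (\<lambda>x. f (g x) w)"
  by (auto simp: bilinear_on_def linear_on_def)

lemma bilinear_on_right:
  "bilinear_on V W U f \<Longrightarrow> linear_on X W g \<Longrightarrow> v \<in> vcarrier V \<Longrightarrow> linear_on X U (\<lambda>x. f v (g x))"
  by (auto simp: bilinear_on_def linear_on_def)

lemma bilinear_on_mem:
  "bilinear_on V W U f \<Longrightarrow> v \<in> vcarrier V \<Longrightarrow> w \<in> vcarrier W \<Longrightarrow> f v w \<in> vcarrier U"
  by (auto simp: bilinear_on_def linear_on_def)

lemma bilinear_on_scale:
  assumes "bilinear_on V W U f" "v \<in> vcarrier V" "w \<in> vcarrier W"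
  shows "f (vscale V c v) w = vscale U c (f v w)" "f v (vscale W c w) = vscale U c (f v w)"
  using assms by (auto simp: bilinear_on_def linear_on_def)

lemma bilinear_on_scaling: "vector_space_on V \<Longrightarrow> bilinear_on scalars V V (vscale V)"
  by (intro bilinear_onI linear_onI)
    (simp_all add: vs_scale vs_scale_add_left vs_scale_add_right vs_scale_scale mult.commute)

lemmas linear_on_pure_left [lin] = bilinear_on_left[OF bilinear_on_pure]
  and linear_on_pure_right [lin] = bilinear_on_right[OF bilinear_on_pure]

lemma linear_on_vscale_left [lin]:
  "vector_space_on V \<Longrightarrow> linear_on X scalars g \<Longrightarrow> v \<in> vcarrier V \<Longrightarrow>
   linear_on X V (\<lambda>x. vscale V (g x) v)"
  by (rule bilinear_on_left[OF bilinear_on_scaling])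

lemma linear_on_vscale_right [lin]:
  "vector_space_on V \<Longrightarrow> linear_on X V g \<Longrightarrow> linear_on X V (\<lambda>x. vscale V c (g x))"
  by (rule bilinear_on_right[OF bilinear_on_scaling]) auto

lemma linear_on_times [lin]:
  fixes f :: "'a::ab_group_add \<Rightarrow> 'k::field"
  assumes "linear_on X scalars f"
  shows "linear_on X scalars (\<lambda>x. f x * c)" "linear_on X scalars (\<lambda>x. c * f x)"
  using assms by (auto simp: linear_on_def algebra_simps)


section \<open>Tensors as finite sums\<close>

text \<open>The list is not canonical. Independence of the choice holds only for sums of bilinear
  expressions and is expressed by \<open>tlift_eq_tsum\<close>.\<close>

definition trep ::
  "('k::field, 'v::ab_group_add, 'm) vspace_scheme \<Rightarrow> ('k, 'w::ab_group_add, 'n) vspace_scheme \<Rightarrow>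
   ('v, 'w, 'k) tensor \<Rightarrow> ('v \<times> 'w) list" where
  "trep V W t =
     (SOME xs. set xs \<subseteq> vcarrier V \<times> vcarrier W \<and> t = (\<Sum>(v, w)\<leftarrow>xs. v \<otimes>\<^bsub>V,W\<^esub> w))"

text \<open>Defined for arbitrary \<open>f\<close>, so that congruence, interchange of sums and
  passage of linear maps are facts about finite sums. Bilinearity enters only when the sum is
  compared with \<open>tlift\<close> or evaluated at a pure tensor.\<close>

definition tsum ::
  "('k::field, 'v::ab_group_add, 'm) vspace_scheme \<Rightarrow> ('k, 'w::ab_group_add, 'n) vspace_scheme \<Rightarrow>
   ('v, 'w, 'k) tensor \<Rightarrow> ('v \<Rightarrow> 'w \<Rightarrow> 'u::ab_group_add) \<Rightarrow> 'u" where
  "tsum V W t f = (\<Sum>(v, w)\<leftarrow>trep V W t. f v w)"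

lemma trep:
  assumes V: "vector_space_on V" and t: "t \<in> vcarrier (tensor V W)"
  shows "set (trep V W t) \<subseteq> vcarrier V \<times> vcarrier W"
    and "t = (\<Sum>(v, w)\<leftarrow>trep V W t. v \<otimes>\<^bsub>V,W\<^esub> w)"
proof -
  have "\<exists>xs. set xs \<subseteq> vcarrier V \<times> vcarrier W \<and> t = (\<Sum>(v, w)\<leftarrow>xs. v \<otimes>\<^bsub>V,W\<^esub> w)"
    using t
  proof (induction rule: tensor_induct)
    case zero
    show ?case by (rule exI[of _ "[]"]) auto
  next
    case (pure v w)
    then show ?case by (intro exI[of _ "[(v, w)]"]) auto
  next
    case (add s t)
    then obtain xs ys where
      "set xs \<subseteq> vcarrier V \<times> vcarrier W" "s = (\<Sum>(v, w)\<leftarrow>xs. v \<otimes>\<^bsub>V,W\<^esub> w)"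
      "set ys \<subseteq> vcarrier V \<times> vcarrier W" "t = (\<Sum>(v, w)\<leftarrow>ys. v \<otimes>\<^bsub>V,W\<^esub> w)" by blast
    then show ?case by (intro exI[of _ "xs @ ys"]) auto
  next
    case (scale c t)
    then obtain xs where xs:
      "set xs \<subseteq> vcarrier V \<times> vcarrier W" "t = (\<Sum>(v, w)\<leftarrow>xs. v \<otimes>\<^bsub>V,W\<^esub> w)" by blast
    \<comment> \<open>The scalar is absorbed by the first factors, which is why lists of pairs
      suffice and no coefficients are stored.\<close>
    have "tscale c (\<Sum>(v, w)\<leftarrow>xs. v \<otimes>\<^bsub>V,W\<^esub> w) = (\<Sum>(v, w)\<leftarrow>xs. vscale V c v \<otimes>\<^bsub>V,W\<^esub> w)"
      using xs(1)
      by (induction xs)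
        (auto simp: bilinear_on_scale[OF bilinear_on_pure] tensor_space.scale_right_distrib)
    then show ?case using xs V
      by (intro exI[of _ "map (\<lambda>(v, w). (vscale V c v, w)) xs"])
        (fastforce simp: o_def case_prod_unfold intro: vs_scale)
  qed
  from someI_ex[OF this]
  show "set (trep V W t) \<subseteq> vcarrier V \<times> vcarrier W"
    "t = (\<Sum>(v, w)\<leftarrow>trep V W t. v \<otimes>\<^bsub>V,W\<^esub> w)"
    unfolding trep_def[symmetric] by blast+
qed

lemma tsum_cong:
  assumes "vector_space_on V" "t \<in> vcarrier (tensor V W)"
    and "\<And>v w. v \<in> vcarrier V \<Longrightarrow> w \<in> vcarrier W \<Longrightarrow> f v w = g v w"
  shows "tsum V W t f = tsum V W t g"
  unfolding tsum_def using trep(1)[OF assms(1,2)] assms(3)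
  by (intro arg_cong[where f = sum_list] map_cong) auto

lemma tsum_mem:
  assumes "vector_space_on V" "t \<in> vcarrier (tensor V W)" "vector_space_on U"
    and "\<And>v w. v \<in> vcarrier V \<Longrightarrow> w \<in> vcarrier W \<Longrightarrow> f v w \<in> vcarrier U"
  shows "tsum V W t f \<in> vcarrier U"
  unfolding tsum_def using trep(1)[OF assms(1,2)] assms(3,4)
  by (intro vs_sum_list) auto

lemma linear_on_tsum:
  assumes "vector_space_on V" "t \<in> vcarrier (tensor V W)" "vector_space_on U" "linear_on U X g"
    and "\<And>v w. v \<in> vcarrier V \<Longrightarrow> w \<in> vcarrier W \<Longrightarrow> f v w \<in> vcarrier U"
  shows "g (tsum V W t f) = tsum V W t (\<lambda>v w. g (f v w))"
  unfolding tsum_def case_prod_unfold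
  using trep(1)[OF assms(1,2)] assms(5) by (intro linear_on_sum_list[OF assms(3,4)]) auto

lemma tsum_add: "tsum V W t (\<lambda>v w. f v w + g v w) = tsum V W t f + tsum V W t g"
  by (simp add: tsum_def sum_list_addf case_prod_unfold)

lemma sum_list_swap:
  fixes f :: "'a \<Rightarrow> 'b \<Rightarrow> 'c::ab_group_add"
  shows "(\<Sum>x\<leftarrow>xs. \<Sum>y\<leftarrow>ys. f x y) = (\<Sum>y\<leftarrow>ys. \<Sum>x\<leftarrow>xs. f x y)"
  by (induction xs) (auto simp: sum_list_addf)

lemma tsum_swap:
  "tsum V W t (\<lambda>v w. tsum V' W' t' (\<lambda>v' w'. f v w v' w')) =
   tsum V' W' t' (\<lambda>v' w'. tsum V W t (\<lambda>v w. f v w v' w'))"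
  unfolding tsum_def case_prod_unfold by (rule sum_list_swap)

text \<open>The bridge between the chosen map and the finite sum: \<open>tlift\<close> is linear, so
  it can be evaluated term by term on the chosen representation.\<close>

lemma tlift_eq_tsum:
  assumes "vector_space_on V" "vector_space_on U" "bilinear_on V W U f"
    and t: "t \<in> vcarrier (tensor V W)"
  shows "tlift V W U f t = tsum V W t f"
proof -
  note r = trep[OF assms(1) t]
  have "tlift V W U f t = tlift V W U f (\<Sum>(v, w)\<leftarrow>trep V W t. v \<otimes>\<^bsub>V,W\<^esub> w)"
    using r(2) by simp
  also have "\<dots> = (\<Sum>(v, w)\<leftarrow>trep V W t. tlift V W U f (v \<otimes>\<^bsub>V,W\<^esub> w))"
    unfolding case_prod_unfold using r(1)
    by (intro linear_on_sum_list[OF vector_space_on_tensor linear_on_tlift[OF assms(2,3)]])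
      (auto intro!: pure_in_tensor)
  also have "\<dots> = tsum V W t f"
    unfolding tsum_def using r(1) tlift_pure[OF assms(2,3)]
    by (intro arg_cong[where f = sum_list] map_cong) auto
  finally show ?thesis .
qed

lemma tsum_pure_self:
  "vector_space_on V \<Longrightarrow> t \<in> vcarrier (tensor V W) \<Longrightarrow> tsum V W t (pure V W) = t"
  unfolding tsum_def using trep(2)[of V t W] by simp

lemma linear_on_tsum_tensor:
  assumes "vector_space_on V" "vector_space_on U" "bilinear_on V W U f"
  shows "linear_on (tensor V W) U (\<lambda>t. tsum V W t f)"
  by (rule linear_on_cong[OF vector_space_on_tensor linear_on_tlift[OF assms(2,3)]])
    (rule tlift_eq_tsum[OF assms])

lemma tsum_pure:
  assumes "vector_space_on V" "vector_space_on U" "bilinear_on V W U f"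
    "v \<in> vcarrier V" "w \<in> vcarrier W"
  shows "tsum V W (v \<otimes>\<^bsub>V,W\<^esub> w) f = f v w"
  using tlift_eq_tsum[OF assms(1-3) pure_in_tensor[OF assms(4,5)]] tlift_pure[OF assms(2-5)]
  by simp

lemma linear_on_tsum_param:
  assumes "vector_space_on V" "t \<in> vcarrier (tensor V W)" "vector_space_on U"
    and f: "\<And>v w. v \<in> vcarrier V \<Longrightarrow> w \<in> vcarrier W \<Longrightarrow> linear_on X U (\<lambda>x. f x v w)"
  shows "linear_on X U (\<lambda>x. tsum V W t (f x))"
proof (rule linear_onI)
  show "tsum V W t (f x) \<in> vcarrier U" if "x \<in> vcarrier X" for x
    using that linear_on_mem[OF f] by (intro tsum_mem assms) auto
  show "tsum V W t (f (x + y)) = tsum V W t (f x) + tsum V W t (f y)"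
    if "x \<in> vcarrier X" "y \<in> vcarrier X" for x y
    unfolding tsum_add[symmetric] using that linear_on_add[OF f] by (intro tsum_cong assms) auto
  show "tsum V W t (f (vscale X c x)) = vscale U c (tsum V W t (f x))"
    if "x \<in> vcarrier X" for x c
  proof -
    have "linear_on U U (vscale U c)"
      using linear_on_vscale_right[OF assms(3) linear_on_id] .
    then have "vscale U c (tsum V W t (f x)) = tsum V W t (\<lambda>v w. vscale U c (f x v w))"
      using linear_on_mem[OF f] that by (intro linear_on_tsum[OF assms(1-3)])
    also have "\<dots> = tsum V W t (f (vscale X c x))"
      using linear_on_scale[OF f] that by (intro tsum_cong[OF assms(1,2)]) simp
    finally show ?thesis by simp
  qed
qed

lemma tensor_bilinear_eqI:
  assumes "linear_on (tensor V W) U (\<lambda>s. f s t)" "linear_on (tensor V W) U (\<lambda>s. g s t)"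
    and "\<And>v w. v \<in> vcarrier V \<Longrightarrow> w \<in> vcarrier W \<Longrightarrow>
      linear_on (tensor V' W') U (f (v \<otimes>\<^bsub>V,W\<^esub> w)) \<and> linear_on (tensor V' W') U (g (v \<otimes>\<^bsub>V,W\<^esub> w))"
    and "\<And>v w v' w'. v \<in> vcarrier V \<Longrightarrow> w \<in> vcarrier W \<Longrightarrow> v' \<in> vcarrier V' \<Longrightarrow> w' \<in> vcarrier W' \<Longrightarrow>
      f (v \<otimes>\<^bsub>V,W\<^esub> w) (v' \<otimes>\<^bsub>V',W'\<^esub> w') = g (v \<otimes>\<^bsub>V,W\<^esub> w) (v' \<otimes>\<^bsub>V',W'\<^esub> w')"
    and "s \<in> vcarrier (tensor V W)" "t \<in> vcarrier (tensor V' W')"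
  shows "f s t = g s t"
proof (rule tensor_linear_eqI[OF assms(1,2) _ assms(5)])
  show "f (v \<otimes>\<^bsub>V,W\<^esub> w) t = g (v \<otimes>\<^bsub>V,W\<^esub> w) t" if "v \<in> vcarrier V" "w \<in> vcarrier W" for v w
    using tensor_linear_eqI[OF _ _ _ assms(6)] assms(3,4)[OF that] by blast
qed

section \<open>Dependence on the underlying vector spaces only\<close>

context
  fixes V :: "('k::field, 'v::ab_group_add, 'm) vspace_scheme"
    and V' :: "('k, 'v, 'm2) vspace_scheme"
    and W :: "('k, 'w::ab_group_add, 'n) vspace_scheme"
    and W' :: "('k, 'w, 'n2) vspace_scheme"
    and U :: "('k, 'u::ab_group_add, 'l) vspace_scheme"
    and U' :: "('k, 'u, 'l2) vspace_scheme"
  assumes V: "vcarrier V' = vcarrier V" "vscale V' = vscale V"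
    and W: "vcarrier W' = vcarrier W" "vscale W' = vscale W"
begin

lemma linear_on_base_cong: "linear_on V' W' = linear_on V W"
  by (auto simp: linear_on_def V W fun_eq_iff)

lemma bilinear_on_dom_cong: "bilinear_on V' W' U = bilinear_on V W U"
  by (auto simp: bilinear_on_def linear_on_def V W fun_eq_iff)

text \<open>Formally \<open>pure\<close> receives whole records, but it reads them only through
  \<open>bilinear_on\<close>, which sees carrier and scaling. This is what lets an algebra and its
  twist share the same tensor products.\<close>

lemma pure_base_cong: "pure V' W' = pure V W"
  unfolding pure_def
  by (intro ext) (simp add: bilinear_on_def linear_on_def V W)

lemma tensor_base_cong: "tensor V' W' = tensor V W"
  by (simp add: tensor_def V W pure_base_cong)

lemma trep_base_cong: "trep V' W' = trep V W"
  unfolding trep_def by (intro ext) (simp add: V W pure_base_cong)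

lemma tsum_base_cong: "tsum V' W' = tsum V W"
  unfolding tsum_def by (intro ext) (simp add: trep_base_cong)

text \<open>The two choices agree because the predicates under \<open>SOME\<close> are equivalent.
  Hence \<open>f\<close> and \<open>f'\<close> may differ off the carriers, and the rewriting can be
  done before bilinearity is known.\<close>

lemma tlift_base_cong:
  assumes "vcarrier U' = vcarrier U" "vscale U' = vscale U"
    and "\<And>v w. v \<in> vcarrier V \<Longrightarrow> w \<in> vcarrier W \<Longrightarrow> f' v w = f v w"
  shows "tlift V' W' U' f' = tlift V W U f"
proof -
  have "(linear_on (tensor V' W') U' h \<and>
          (\<forall>v\<in>vcarrier V'. \<forall>w\<in>vcarrier W'. h (v \<otimes>\<^bsub>V',W'\<^esub> w) = f' v w)) \<longleftrightarrow>
        (linear_on (tensor V W) U h \<and>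
          (\<forall>v\<in>vcarrier V. \<forall>w\<in>vcarrier W. h (v \<otimes>\<^bsub>V,W\<^esub> w) = f v w))" for h
    by (simp add: linear_on_def tensor_base_cong pure_base_cong assms V W)
  then show ?thesis unfolding tlift_def by simp
qed

end

lemmas tlift_cong = tlift_base_cong[OF refl refl refl refl refl refl]

section \<open>Sweedler sums\<close>

declare vector_space_on_scalars [simp] vector_space_on_tensor [simp] pure_in_tensor [simp]

text \<open>Based on \<open>tsum\<close> instead of \<open>tlift\<close>, so that rewriting under a
  Sweedler sum has no bilinearity obligations.\<close>

definition sw ::
  "('k::field, 'a::ab_group_add, 'm) hom_hopf_scheme \<Rightarrow> 'a \<Rightarrow> ('a \<Rightarrow> 'a \<Rightarrow> 'u::ab_group_add) \<Rightarrow> 'u"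
  where "sw H c f = tsum H H (comult H c) f"

lemma sw_swap: "sw H c (\<lambda>x y. sw G d (\<lambda>u v. f x y u v)) = sw G d (\<lambda>u v. sw H c (\<lambda>x y. f x y u v))"
  unfolding sw_def by (rule tsum_swap)

text \<open>Collects membership and linearity only. The Sweedler calculus is thus available for the
  double while its Hopf axioms are still being proved.\<close>

locale hom_hopf_data =
  fixes H :: "('k::field, 'a::ab_group_add, 'm) hom_hopf_scheme"
  assumes vs [simp]: "vector_space_on H"
    and alpha_lin: "linear_on H H (alpha H)"
    and mult_bilin: "bilinear_on H H H (mult H)"
    and unit_mem [simp]: "unit H \<in> vcarrier H"
    and comult_lin: "linear_on H (tensor H H) (comult H)"
    and counit_lin: "linear_on H scalars (counit H)"
    and antipode_lin: "linear_on H H (antipode H)"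
begin

lemmas alpha_mem [simp] = linear_on_mem[OF alpha_lin]
  and comult_mem [simp] = linear_on_mem[OF comult_lin]
  and antipode_mem [simp] = linear_on_mem[OF antipode_lin]
  and mult_mem [simp] = bilinear_on_mem[OF mult_bilin]
  and scale_mem [simp] = vs_scale[OF vs]

lemmas alpha_linear [lin] = linear_on_compose[OF alpha_lin]
  and counit_linear [lin] = linear_on_compose[OF counit_lin]
  and antipode_linear [lin] = linear_on_compose[OF antipode_lin]
  and mult_linear [lin] = bilinear_on_left[OF mult_bilin] bilinear_on_right[OF mult_bilin]

lemma sw_cong:
  assumes "c \<in> vcarrier H" "\<And>x y. x \<in> vcarrier H \<Longrightarrow> y \<in> vcarrier H \<Longrightarrow> f x y = g x y"
  shows "sw H c f = sw H c g"
  unfolding sw_def using assms by (intro tsum_cong) simp_all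

lemma sw_mem [simp]:
  assumes "c \<in> vcarrier H" "vector_space_on U"
    and "\<And>x y. x \<in> vcarrier H \<Longrightarrow> y \<in> vcarrier H \<Longrightarrow> f x y \<in> vcarrier U"
  shows "sw H c f \<in> vcarrier U"
  unfolding sw_def using assms by (intro tsum_mem) simp_all

lemma linear_sw:
  assumes "linear_on U X g" "c \<in> vcarrier H" "vector_space_on U"
    and "\<And>x y. x \<in> vcarrier H \<Longrightarrow> y \<in> vcarrier H \<Longrightarrow> f x y \<in> vcarrier U"
  shows "g (sw H c f) = sw H c (\<lambda>x y. g (f x y))"
  unfolding sw_def using assms by (intro linear_on_tsum) simp_all

lemma sw_linear_param [lin]:
  assumes "vector_space_on U" "c \<in> vcarrier H"
    and "\<And>u v. u \<in> vcarrier H \<Longrightarrow> v \<in> vcarrier H \<Longrightarrow> linear_on X U (\<lambda>x. f x u v)"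
  shows "linear_on X U (\<lambda>x. sw H c (f x))"
  unfolding sw_def using assms by (intro linear_on_tsum_param) simp_all

lemma sw_linear_arg [lin]:
  assumes "vector_space_on U"
    and "\<And>v. v \<in> vcarrier H \<Longrightarrow> linear_on H U (\<lambda>u. f u v)"
    and "\<And>u. u \<in> vcarrier H \<Longrightarrow> linear_on H U (\<lambda>v. f u v)"
    and "linear_on X H g"
  shows "linear_on X U (\<lambda>x. sw H (g x) f)"
proof -
  have "linear_on X (tensor H H) (\<lambda>x. comult H (g x))"
    by (rule linear_on_compose[OF comult_lin assms(4)])
  then show ?thesis
    unfolding sw_def using assms(1-3)
    by (intro linear_on_compose[OF linear_on_tsum_tensor] bilinear_onI) simp_all
qed

lemma sweedler_eq_sw:
  assumes "vector_space_on U" "bilinear_on H H U f" "c \<in> vcarrier H"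
  shows "sweedler H U c f = sw H c f"
  unfolding sweedler_def sw_def using assms by (intro tlift_eq_tsum) simp_all

lemma sw_pure_self: "c \<in> vcarrier H \<Longrightarrow> sw H c (pure H H) = comult H c"
  unfolding sw_def by (rule tsum_pure_self) simp_all

lemma tmap_comult:
  assumes "linear_on H V f" "linear_on H W g" "c \<in> vcarrier H"
  shows "tmap H H V W f g (comult H c) = sw H c (\<lambda>x y. f x \<otimes>\<^bsub>V,W\<^esub> g y)"
  unfolding tmap_def sw_def using assms
  by (intro tlift_eq_tsum bilinear_onI)
    (auto intro: bilinear_on_left[OF bilinear_on_pure] bilinear_on_right[OF bilinear_on_pure]
      linear_on_mem)

lemma tassoc_pure:
  assumes "x \<in> vcarrier H" "y \<in> vcarrier H" "z \<in> vcarrier H"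
  shows "tassoc H ((x \<otimes>\<^bsub>H,H\<^esub> y) \<otimes>\<^bsub>tensor H H,H\<^esub> z) = x \<otimes>\<^bsub>H,tensor H H\<^esub> (y \<otimes>\<^bsub>H,H\<^esub> z)"
    and "linear_on (tensor (tensor H H) H) (tensor H (tensor H H)) (tassoc H)"
proof -
  have 1: "bilinear_on H H (tensor H (tensor H H)) (\<lambda>x y. x \<otimes>\<^bsub>H,tensor H H\<^esub> (y \<otimes>\<^bsub>H,H\<^esub> z))"
    if "z \<in> vcarrier H" for z
    using that by (intro bilinear_onI lin) simp_all
  have 2: "bilinear_on (tensor H H) H (tensor H (tensor H H))
     (\<lambda>t z. tlift H H (tensor H (tensor H H)) (\<lambda>x y. x \<otimes>\<^bsub>H,tensor H H\<^esub> (y \<otimes>\<^bsub>H,H\<^esub> z)) t)"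
  proof (rule bilinear_onI)
    fix z assume "z \<in> vcarrier H"
    then show "linear_on (tensor H H) (tensor H (tensor H H))
      (tlift H H (tensor H (tensor H H)) (\<lambda>x y. x \<otimes>\<^bsub>H,tensor H H\<^esub> (y \<otimes>\<^bsub>H,H\<^esub> z)))"
      by (intro linear_on_tlift 1) simp_all
  next
    fix t assume t: "t \<in> vcarrier (tensor H H)"
    \<comment> \<open>Linearity of a \<open>tlift\<close> in a parameter of its integrand is not
      visible from the choice. It is read off the finite sum and then transported.\<close>
    have "linear_on H (tensor H (tensor H H))
      (\<lambda>z. tsum H H t (\<lambda>x y. x \<otimes>\<^bsub>H,tensor H H\<^esub> (y \<otimes>\<^bsub>H,H\<^esub> z)))"
      using t by (intro linear_on_tsum_param lin) simp_all
    then show "linear_on H (tensor H (tensor H H))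
      (\<lambda>z. tlift H H (tensor H (tensor H H)) (\<lambda>x y. x \<otimes>\<^bsub>H,tensor H H\<^esub> (y \<otimes>\<^bsub>H,H\<^esub> z)) t)"
      by (rule linear_on_cong[OF vs]) (use t 1 in \<open>simp add: tlift_eq_tsum\<close>)
  qed
  show "linear_on (tensor (tensor H H) H) (tensor H (tensor H H)) (tassoc H)"
    unfolding tassoc_def by (rule linear_on_tlift[OF _ 2]) simp
  show "tassoc H ((x \<otimes>\<^bsub>H,H\<^esub> y) \<otimes>\<^bsub>tensor H H,H\<^esub> z) = x \<otimes>\<^bsub>H,tensor H H\<^esub> (y \<otimes>\<^bsub>H,H\<^esub> z)"
    unfolding tassoc_def using assms by (simp add: tlift_pure[OF _ 2] tlift_pure[OF _ 1])
qed

lemma tassoc_comult: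
  assumes "c \<in> vcarrier H"
  shows "tassoc H (tmap H H (tensor H H) H (comult H) (alpha H) (comult H c)) =
    sw H c (\<lambda>x y. sw H x (\<lambda>u v. u \<otimes>\<^bsub>H,tensor H H\<^esub> (v \<otimes>\<^bsub>H,H\<^esub> alpha H y)))"
proof -
  have "tmap H H (tensor H H) H (comult H) (alpha H) (comult H c) =
    sw H c (\<lambda>x y. sw H x (\<lambda>u v. (u \<otimes>\<^bsub>H,H\<^esub> v) \<otimes>\<^bsub>tensor H H,H\<^esub> alpha H y))"
    unfolding tmap_comult[OF comult_lin alpha_lin assms]
  proof (rule sw_cong[OF assms])
    fix x y assume xy: "x \<in> vcarrier H" "y \<in> vcarrier H"
    have "linear_on (tensor H H) (tensor (tensor H H) H) (\<lambda>t. t \<otimes>\<^bsub>tensor H H,H\<^esub> alpha H y)"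
      using xy by (intro lin) simp
    from linear_sw[OF this xy(1), of "pure H H"] xy
    show "comult H x \<otimes>\<^bsub>tensor H H,H\<^esub> alpha H y =
      sw H x (\<lambda>u v. (u \<otimes>\<^bsub>H,H\<^esub> v) \<otimes>\<^bsub>tensor H H,H\<^esub> alpha H y)"
      by (simp add: sw_pure_self)
  qed
  also have "tassoc H \<dots> =
    sw H c (\<lambda>x y. tassoc H (sw H x (\<lambda>u v. (u \<otimes>\<^bsub>H,H\<^esub> v) \<otimes>\<^bsub>tensor H H,H\<^esub> alpha H y)))"
    using assms by (intro linear_sw[OF tassoc_pure(2)]) simp_all
  also have "\<dots> = sw H c (\<lambda>x y. sw H x (\<lambda>u v. u \<otimes>\<^bsub>H,tensor H H\<^esub> (v \<otimes>\<^bsub>H,H\<^esub> alpha H y)))"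
    using assms
    by (intro sw_cong linear_sw[OF tassoc_pure(2), THEN trans]) (simp_all add: tassoc_pure)
  finally show ?thesis .
qed

lemma tmap_alpha_comult:
  assumes "c \<in> vcarrier H"
  shows "tmap H H H (tensor H H) (alpha H) (comult H) (comult H c) =
    sw H c (\<lambda>x y. sw H y (\<lambda>u v. alpha H x \<otimes>\<^bsub>H,tensor H H\<^esub> (u \<otimes>\<^bsub>H,H\<^esub> v)))"
  unfolding tmap_comult[OF alpha_lin comult_lin assms]
proof (rule sw_cong[OF assms])
  fix x y assume xy: "x \<in> vcarrier H" "y \<in> vcarrier H"
  have "linear_on (tensor H H) (tensor H (tensor H H)) (\<lambda>t. alpha H x \<otimes>\<^bsub>H,tensor H H\<^esub> t)"
    using xy by (intro lin) simp
  from linear_sw[OF this xy(2), of "pure H H"] xy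
  show "alpha H x \<otimes>\<^bsub>H,tensor H H\<^esub> comult H y =
    sw H y (\<lambda>u v. alpha H x \<otimes>\<^bsub>H,tensor H H\<^esub> (u \<otimes>\<^bsub>H,H\<^esub> v))"
    by (simp add: sw_pure_self)
qed

lemma tensor_mult_comult:
  assumes "g \<in> vcarrier H" "h \<in> vcarrier H"
  shows "tensor_mult H (comult H g) (comult H h) =
    sw H g (\<lambda>x y. sw H h (\<lambda>x' y'. mult H x x' \<otimes>\<^bsub>H,H\<^esub> mult H y y'))"
proof -
  have 1: "bilinear_on H H (tensor H H) (\<lambda>x' y'. mult H x x' \<otimes>\<^bsub>H,H\<^esub> mult H y y')"
    if "x \<in> vcarrier H" "y \<in> vcarrier H" for x y
    using that by (intro bilinear_onI lin) simp_all
  have 2: "tlift H H (tensor H H) (\<lambda>x' y'. mult H x x' \<otimes>\<^bsub>H,H\<^esub> mult H y y') (comult H h) =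
     sw H h (\<lambda>x' y'. mult H x x' \<otimes>\<^bsub>H,H\<^esub> mult H y y')"
    if "x \<in> vcarrier H" "y \<in> vcarrier H" for x y
    unfolding sw_def using assms that by (intro tlift_eq_tsum 1) simp_all
  have 3: "bilinear_on H H (tensor H H) (\<lambda>x y. sw H h (\<lambda>x' y'. mult H x x' \<otimes>\<^bsub>H,H\<^esub> mult H y y'))"
    using assms by (intro bilinear_onI lin) simp_all
  have "tensor_mult H (comult H g) (comult H h) =
    tlift H H (tensor H H) (\<lambda>x y. sw H h (\<lambda>x' y'. mult H x x' \<otimes>\<^bsub>H,H\<^esub> mult H y y')) (comult H g)"
    unfolding tensor_mult_def by (rule fun_cong, rule tlift_cong) (simp_all add: 2)
  also have "\<dots> = sw H g (\<lambda>x y. sw H h (\<lambda>x' y'. mult H x x' \<otimes>\<^bsub>H,H\<^esub> mult H y y'))"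
    unfolding sw_def[of H g] using assms by (intro tlift_eq_tsum 3) simp_all
  finally show ?thesis .
qed

end

locale bij_antipode_data = hom_hopf_data H
  for H :: "('k::field, 'a::ab_group_add, 'm) hom_hopf_scheme" +
  assumes bij_antipode: "bij_betw (antipode H) (vcarrier H) (vcarrier H)"
begin

lemma antipode_inv_mem [simp]: "x \<in> vcarrier H \<Longrightarrow> antipode_inv H x \<in> vcarrier H"
  using bij_antipode by (metis bij_betw_def inv_into_into)

lemma antipode_inv [simp]:
  "x \<in> vcarrier H \<Longrightarrow> antipode H (antipode_inv H x) = x"
  "x \<in> vcarrier H \<Longrightarrow> antipode_inv H (antipode H x) = x"
  using bij_antipode by (simp_all add: bij_betw_inv_into_left bij_betw_inv_into_right)

lemma antipode_inv_eqI:
  "x \<in> vcarrier H \<Longrightarrow> antipode H x = y \<Longrightarrow> antipode_inv H y = x"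
  by auto

lemma antipode_inv_lin: "linear_on H H (antipode_inv H)"
  by (rule linear_onI)
    (auto intro!: antipode_inv_eqI
      simp: vs_add[OF vs] linear_on_add[OF antipode_lin] linear_on_scale[OF antipode_lin])

lemmas antipode_inv_linear [lin] = linear_on_compose[OF antipode_inv_lin]

end

text \<open>
  The same axioms as \<^const>\<open>hom_hopf_algebra\<close>, with every map out of a tensor product expressed as a
  Sweedler sum.
\<close>

locale hom_hopf = hom_hopf_data H for H :: "('k::field, 'a::ab_group_add, 'm) hom_hopf_scheme" +
  assumes alpha_mult: "a \<in> vcarrier H \<Longrightarrow> b \<in> vcarrier H \<Longrightarrow>
      alpha H (mult H a b) = mult H (alpha H a) (alpha H b)"
    and alpha_unit [simp]: "alpha H (unit H) = unit H"
    and unit_mult: "a \<in> vcarrier H \<Longrightarrow> mult H (unit H) a = alpha H a"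
    and mult_unit: "a \<in> vcarrier H \<Longrightarrow> mult H a (unit H) = alpha H a"
    and hom_assoc: "a \<in> vcarrier H \<Longrightarrow> b \<in> vcarrier H \<Longrightarrow> c \<in> vcarrier H \<Longrightarrow>
      mult H (alpha H a) (mult H b c) = mult H (mult H a b) (alpha H c)"
    and counit_alpha: "c \<in> vcarrier H \<Longrightarrow> counit H (alpha H c) = counit H c"
    and comult_alpha_tensor: "c \<in> vcarrier H \<Longrightarrow>
      sw H c (\<lambda>x y. alpha H x \<otimes>\<^bsub>H,H\<^esub> alpha H y) = comult H (alpha H c)"
    and counit_left_id: "c \<in> vcarrier H \<Longrightarrow>
      sw H c (\<lambda>x y. vscale H (counit H x) y) = alpha H c"
    and counit_right_id: "c \<in> vcarrier H \<Longrightarrow>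
      sw H c (\<lambda>x y. vscale H (counit H y) x) = alpha H c"
    and hom_coassoc_tensor: "c \<in> vcarrier H \<Longrightarrow>
      sw H c (\<lambda>x y. sw H x (\<lambda>u v. u \<otimes>\<^bsub>H,tensor H H\<^esub> (v \<otimes>\<^bsub>H,H\<^esub> alpha H y))) =
      sw H c (\<lambda>x y. sw H y (\<lambda>u v. alpha H x \<otimes>\<^bsub>H,tensor H H\<^esub> (u \<otimes>\<^bsub>H,H\<^esub> v)))"
    and comult_unit: "comult H (unit H) = unit H \<otimes>\<^bsub>H,H\<^esub> unit H"
    and comult_mult: "a \<in> vcarrier H \<Longrightarrow> b \<in> vcarrier H \<Longrightarrow>
      comult H (mult H a b) = sw H a (\<lambda>x y. sw H b (\<lambda>u v. mult H x u \<otimes>\<^bsub>H,H\<^esub> mult H y v))"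
    and counit_unit [simp]: "counit H (unit H) = 1"
    and counit_mult: "a \<in> vcarrier H \<Longrightarrow> b \<in> vcarrier H \<Longrightarrow>
      counit H (mult H a b) = counit H a * counit H b"
    and antipode_alpha: "a \<in> vcarrier H \<Longrightarrow> antipode H (alpha H a) = alpha H (antipode H a)"
    and antipode_left_id: "c \<in> vcarrier H \<Longrightarrow>
      sw H c (\<lambda>x y. mult H (antipode H x) y) = vscale H (counit H c) (unit H)"
    and antipode_right_id: "c \<in> vcarrier H \<Longrightarrow>
      sw H c (\<lambda>x y. mult H x (antipode H y)) = vscale H (counit H c) (unit H)"

text \<open>Translating each axiom into a Sweedler sum requires linearity of the structure maps.
  Both sides entail it, hence the case distinction on \<open>hom_hopf_data\<close>.\<close>

lemma hom_hopf_algebra_iff: "hom_hopf_algebra H \<longleftrightarrow> hom_hopf H"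
proof (cases "hom_hopf_data H")
  case True
  then interpret hom_hopf_data H .
  have 1: "sweedler H H c (\<lambda>x y. vscale H (counit H x) y) = sw H c (\<lambda>x y. vscale H (counit H x) y)"
    "sweedler H H c (\<lambda>x y. vscale H (counit H y) x) = sw H c (\<lambda>x y. vscale H (counit H y) x)"
    "sweedler H H c (\<lambda>x y. mult H (antipode H x) y) = sw H c (\<lambda>x y. mult H (antipode H x) y)"
    "sweedler H H c (\<lambda>x y. mult H x (antipode H y)) = sw H c (\<lambda>x y. mult H x (antipode H y))"
    if "c \<in> vcarrier H" for c
    using that by (auto intro!: sweedler_eq_sw bilinear_onI lin)
  have coalg: "hom_coalgebra H \<longleftrightarrow>
     (\<forall>c\<in>vcarrier H.
        counit H (alpha H c) = counit H c \<and>
        sw H c (\<lambda>x y. alpha H x \<otimes>\<^bsub>H,H\<^esub> alpha H y) = comult H (alpha H c) \<and>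
        sw H c (\<lambda>x y. vscale H (counit H x) y) = alpha H c \<and>
        sw H c (\<lambda>x y. vscale H (counit H y) x) = alpha H c \<and>
        sw H c (\<lambda>x y. sw H x (\<lambda>u v. u \<otimes>\<^bsub>H,tensor H H\<^esub> (v \<otimes>\<^bsub>H,H\<^esub> alpha H y))) =
        sw H c (\<lambda>x y. sw H y (\<lambda>u v. alpha H x \<otimes>\<^bsub>H,tensor H H\<^esub> (u \<otimes>\<^bsub>H,H\<^esub> v))))"
    unfolding hom_coalgebra_def
    by (simp add: alpha_lin comult_lin counit_lin 1 tassoc_comult tmap_alpha_comult
        tmap_comult[OF alpha_lin alpha_lin] cong: ball_cong)
  have bialg: "hom_bialgebra H \<longleftrightarrow> hom_algebra H \<and> hom_coalgebra H \<and>
     comult H (unit H) = unit H \<otimes>\<^bsub>H,H\<^esub> unit H \<and>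
     (\<forall>a\<in>vcarrier H. \<forall>b\<in>vcarrier H.
        comult H (mult H a b) = sw H a (\<lambda>x y. sw H b (\<lambda>u v. mult H x u \<otimes>\<^bsub>H,H\<^esub> mult H y v))) \<and>
     counit H (unit H) = 1 \<and>
     (\<forall>a\<in>vcarrier H. \<forall>b\<in>vcarrier H. counit H (mult H a b) = counit H a * counit H b)"
    unfolding hom_bialgebra_def by (simp add: tensor_mult_comult cong: ball_cong)
  have hopf: "hom_hopf_algebra H \<longleftrightarrow> hom_bialgebra H \<and>
     (\<forall>c\<in>vcarrier H.
        antipode H (alpha H c) = alpha H (antipode H c) \<and>
        sw H c (\<lambda>x y. mult H (antipode H x) y) = vscale H (counit H c) (unit H) \<and>
        sw H c (\<lambda>x y. mult H x (antipode H y)) = vscale H (counit H c) (unit H))"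
    unfolding hom_hopf_algebra_def by (simp add: antipode_lin 1 cong: ball_cong)
  have ball2: "(\<forall>a b. a \<in> S \<longrightarrow> b \<in> S \<longrightarrow> P a b) \<longleftrightarrow> (\<forall>a\<in>S. \<forall>b\<in>S. P a b)"
    and ball3: "(\<forall>a b c. a \<in> S \<longrightarrow> b \<in> S \<longrightarrow> c \<in> S \<longrightarrow> Q a b c) \<longleftrightarrow>
      (\<forall>a\<in>S. \<forall>b\<in>S. \<forall>c\<in>S. Q a b c)" for S :: "'b set" and P Q
    by blast+
  show ?thesis
    unfolding hopf bialg coalg hom_algebra_def hom_hopf_def hom_hopf_axioms_def
      ball_conj_distrib ball3 ball2 Ball_def[symmetric]
    by (rule iffI; (erule conjE)+; intro conjI;
        (assumption | rule True vs alpha_lin mult_bilin unit_mem))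
next
  case False
  then show ?thesis
    by (auto simp: hom_hopf_def hom_hopf_data_def hom_hopf_algebra_def hom_bialgebra_def
        hom_algebra_def hom_coalgebra_def)
qed

section \<open>Rules for Sweedler sums from the Hom-Hopf axioms\<close>

context hom_hopf
begin

text \<open>The coproduct of \<open>\<beta> c\<close> is a sum of pure tensors, on each of which the
  linear map induced by \<open>f\<close> can be evaluated. Compatibility is assumed at the single
  element \<open>c\<close>, so the lemma serves the structure map and every \<open>hopf_endo\<close>
  alike.\<close>

lemma sw_coalgebra_endo:
  assumes \<beta>: "\<And>x. x \<in> vcarrier H \<Longrightarrow> \<beta> x \<in> vcarrier H"
      "sw H c (\<lambda>x y. \<beta> x \<otimes>\<^bsub>H,H\<^esub> \<beta> y) = comult H (\<beta> c)"
    and f: "vector_space_on U" "bilinear_on H H U f" and c: "c \<in> vcarrier H"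
  shows "sw H (\<beta> c) f = sw H c (\<lambda>x y. f (\<beta> x) (\<beta> y))"
proof -
  have "sw H (\<beta> c) f = tsum H H (sw H c (\<lambda>x y. \<beta> x \<otimes>\<^bsub>H,H\<^esub> \<beta> y)) f"
    by (simp add: sw_def[of H "\<beta> c"] \<beta>(2))
  also have "\<dots> = sw H c (\<lambda>x y. tsum H H (\<beta> x \<otimes>\<^bsub>H,H\<^esub> \<beta> y) f)"
    using f c \<beta>(1) by (intro linear_sw[OF linear_on_tsum_tensor]) simp_all
  also have "\<dots> = sw H c (\<lambda>x y. f (\<beta> x) (\<beta> y))"
    using f c \<beta>(1) by (intro sw_cong) (simp_all add: tsum_pure)
  finally show ?thesis .
qed

lemma sw_alpha:
  "vector_space_on U \<Longrightarrow> bilinear_on H H U f \<Longrightarrow> c \<in> vcarrier H \<Longrightarrow>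
   sw H (alpha H c) f = sw H c (\<lambda>x y. f (alpha H x) (alpha H y))"
  by (rule sw_coalgebra_endo) (simp_all add: comult_alpha_tensor)

lemma sw_mult:
  assumes "vector_space_on U" "bilinear_on H H U f" "a \<in> vcarrier H" "b \<in> vcarrier H"
  shows "sw H (mult H a b) f = sw H a (\<lambda>x y. sw H b (\<lambda>u v. f (mult H x u) (mult H y v)))"
proof -
  have "sw H (mult H a b) f =
    tsum H H (sw H a (\<lambda>x y. sw H b (\<lambda>u v. mult H x u \<otimes>\<^bsub>H,H\<^esub> mult H y v))) f"
    using assms(3,4) by (simp add: sw_def[of H "mult H a b"] comult_mult)
  also have "\<dots> = sw H a (\<lambda>x y. tsum H H (sw H b (\<lambda>u v. mult H x u \<otimes>\<^bsub>H,H\<^esub> mult H y v)) f)"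
    using assms by (intro linear_sw[OF linear_on_tsum_tensor]) simp_all
  also have "\<dots> = sw H a (\<lambda>x y. sw H b (\<lambda>u v. f (mult H x u) (mult H y v)))"
    using assms by (intro sw_cong linear_sw[OF linear_on_tsum_tensor, THEN trans])
      (simp_all add: tsum_pure)
  finally show ?thesis .
qed

lemma sw_unit:
  "vector_space_on U \<Longrightarrow> bilinear_on H H U f \<Longrightarrow> sw H (unit H) f = f (unit H) (unit H)"
  by (simp add: sw_def comult_unit tsum_pure)

text \<open>A trilinear \<open>f\<close> factors through a linear map \<open>?g\<close> on
  \<open>H \<otimes> (H \<otimes> H)\<close>. The axiom is an equation in that space, and applying
  \<open>?g\<close> to both sides gives the statement.\<close>

lemma hom_coassoc:
  assumes U: "vector_space_on U"
    and 1: "\<And>y z. y \<in> vcarrier H \<Longrightarrow> z \<in> vcarrier H \<Longrightarrow> linear_on H U (\<lambda>x. f x y z)"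
    and 2: "\<And>x z. x \<in> vcarrier H \<Longrightarrow> z \<in> vcarrier H \<Longrightarrow> linear_on H U (\<lambda>y. f x y z)"
    and 3: "\<And>x y. x \<in> vcarrier H \<Longrightarrow> y \<in> vcarrier H \<Longrightarrow> linear_on H U (\<lambda>z. f x y z)"
    and c: "c \<in> vcarrier H"
  shows "sw H c (\<lambda>x y. sw H x (\<lambda>u v. f u v (alpha H y))) =
    sw H c (\<lambda>x y. sw H y (\<lambda>u v. f (alpha H x) u v))"
proof -
  let ?g = "\<lambda>t. tsum H (tensor H H) t (\<lambda>x s. tsum H H s (f x))"
  have b: "bilinear_on H (tensor H H) U (\<lambda>x s. tsum H H s (f x))"
    using 2 3 U by (intro bilinear_onI linear_on_tsum_param linear_on_tsum_tensor 1) simp_all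
  have g: "linear_on (tensor H (tensor H H)) U ?g"
    by (rule linear_on_tsum_tensor[OF vs U b])
  have gp: "?g (x \<otimes>\<^bsub>H,tensor H H\<^esub> (y \<otimes>\<^bsub>H,H\<^esub> z)) = f x y z"
    if "x \<in> vcarrier H" "y \<in> vcarrier H" "z \<in> vcarrier H" for x y z
    using that 2 3 U by (simp add: tsum_pure[OF vs U b] tsum_pure[OF vs U] bilinear_onI)
  have "sw H c (\<lambda>x y. sw H x (\<lambda>u v. f u v (alpha H y))) =
    sw H c (\<lambda>x y. sw H x (\<lambda>u v. ?g (u \<otimes>\<^bsub>H,tensor H H\<^esub> (v \<otimes>\<^bsub>H,H\<^esub> alpha H y))))"
    using c by (intro sw_cong) (simp_all add: gp)
  also have "\<dots> = sw H c (\<lambda>x y. ?g (sw H x (\<lambda>u v. u \<otimes>\<^bsub>H,tensor H H\<^esub> (v \<otimes>\<^bsub>H,H\<^esub> alpha H y))))"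
    using c by (intro sw_cong linear_sw[OF g, symmetric]) simp_all
  also have "\<dots> = ?g (sw H c (\<lambda>x y. sw H x (\<lambda>u v. u \<otimes>\<^bsub>H,tensor H H\<^esub> (v \<otimes>\<^bsub>H,H\<^esub> alpha H y))))"
    using c by (intro linear_sw[OF g, symmetric]) simp_all
  also have "\<dots> = ?g (sw H c (\<lambda>x y. sw H y (\<lambda>u v. alpha H x \<otimes>\<^bsub>H,tensor H H\<^esub> (u \<otimes>\<^bsub>H,H\<^esub> v))))"
    using c by (simp only: hom_coassoc_tensor)
  also have "\<dots> = sw H c (\<lambda>x y. ?g (sw H y (\<lambda>u v. alpha H x \<otimes>\<^bsub>H,tensor H H\<^esub> (u \<otimes>\<^bsub>H,H\<^esub> v))))"
    using c by (intro linear_sw[OF g]) simp_all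
  also have "\<dots> = sw H c (\<lambda>x y. sw H y (\<lambda>u v. ?g (alpha H x \<otimes>\<^bsub>H,tensor H H\<^esub> (u \<otimes>\<^bsub>H,H\<^esub> v))))"
    using c by (intro sw_cong linear_sw[OF g]) simp_all
  also have "\<dots> = sw H c (\<lambda>x y. sw H y (\<lambda>u v. f (alpha H x) u v))"
    using c by (intro sw_cong) (simp_all add: gp)
  finally show ?thesis .
qed

lemma counit_left:
  assumes "linear_on H U f" "c \<in> vcarrier H"
  shows "sw H c (\<lambda>x y. vscale U (counit H x) (f y)) = f (alpha H c)"
proof -
  have "f (alpha H c) = f (sw H c (\<lambda>x y. vscale H (counit H x) y))"
    using assms by (simp add: counit_left_id)
  also have "\<dots> = sw H c (\<lambda>x y. vscale U (counit H x) (f y))"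
    using assms(2)
    by (subst linear_sw[OF assms(1,2) vs]) (auto intro!: sw_cong simp: linear_on_scale[OF assms(1)])
  finally show ?thesis by simp
qed

lemma counit_right:
  assumes "linear_on H U f" "c \<in> vcarrier H"
  shows "sw H c (\<lambda>x y. vscale U (counit H y) (f x)) = f (alpha H c)"
proof -
  have "f (alpha H c) = f (sw H c (\<lambda>x y. vscale H (counit H y) x))"
    using assms by (simp add: counit_right_id)
  also have "\<dots> = sw H c (\<lambda>x y. vscale U (counit H y) (f x))"
    using assms(2)
    by (subst linear_sw[OF assms(1,2) vs]) (auto intro!: sw_cong simp: linear_on_scale[OF assms(1)])
  finally show ?thesis by simp
qed

lemma antipode_left:
  assumes "linear_on H U f" "c \<in> vcarrier H"
  shows "sw H c (\<lambda>x y. f (mult H (antipode H x) y)) = vscale U (counit H c) (f (unit H))"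
  using linear_sw[OF assms, of "\<lambda>x y. mult H (antipode H x) y"] assms
  by (simp add: antipode_left_id linear_on_scale)

lemma antipode_right:
  assumes "linear_on H U f" "c \<in> vcarrier H"
  shows "sw H c (\<lambda>x y. f (mult H x (antipode H y))) = vscale U (counit H c) (f (unit H))"
  using linear_sw[OF assms, of "\<lambda>x y. mult H x (antipode H y)"] assms
  by (simp add: antipode_right_id linear_on_scale)

end

section \<open>Twisting by an automorphism\<close>

text \<open>The notion is used in both directions: the inverse structure map removes the twist of A
  and of B, and the tensor product of the structure maps puts it back on the double.\<close>

definition hopf_endo :: "('k::field, 'a::ab_group_add, 'm) hom_hopf_scheme \<Rightarrow> ('a \<Rightarrow> 'a) \<Rightarrow> bool"
  where "hopf_endo H \<beta> \<longleftrightarrow>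
    linear_on H H \<beta> \<and>
    (\<forall>a\<in>vcarrier H. \<forall>b\<in>vcarrier H. \<beta> (mult H a b) = mult H (\<beta> a) (\<beta> b)) \<and>
    \<beta> (unit H) = unit H \<and>
    (\<forall>c\<in>vcarrier H.
      sw H c (\<lambda>x y. \<beta> x \<otimes>\<^bsub>H,H\<^esub> \<beta> y) = comult H (\<beta> c) \<and>
      counit H (\<beta> c) = counit H c \<and>
      \<beta> (alpha H c) = alpha H (\<beta> c) \<and>
      \<beta> (antipode H c) = antipode H (\<beta> c))"

lemma hopf_endoD:
  assumes "hopf_endo H \<beta>"
  shows "linear_on H H \<beta>"
    and "\<And>a b. a \<in> vcarrier H \<Longrightarrow> b \<in> vcarrier H \<Longrightarrow> \<beta> (mult H a b) = mult H (\<beta> a) (\<beta> b)"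
    and "\<beta> (unit H) = unit H"
    and "\<And>c. c \<in> vcarrier H \<Longrightarrow> sw H c (\<lambda>x y. \<beta> x \<otimes>\<^bsub>H,H\<^esub> \<beta> y) = comult H (\<beta> c)"
    and "\<And>c. c \<in> vcarrier H \<Longrightarrow> counit H (\<beta> c) = counit H c"
    and "\<And>c. c \<in> vcarrier H \<Longrightarrow> \<beta> (alpha H c) = alpha H (\<beta> c)"
    and "\<And>c. c \<in> vcarrier H \<Longrightarrow> \<beta> (antipode H c) = antipode H (\<beta> c)"
  using assms unfolding hopf_endo_def by blast+

lemma (in hom_hopf) sw_hopf_endo:
  assumes "hopf_endo H \<beta>" "vector_space_on U" "bilinear_on H H U f" "c \<in> vcarrier H"
  shows "sw H (\<beta> c) f = sw H c (\<lambda>x y. f (\<beta> x) (\<beta> y))"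
  using assms hopf_endoD(4)[OF assms(1)] linear_on_mem[OF hopf_endoD(1)[OF assms(1)]]
  by (intro sw_coalgebra_endo) simp_all

text \<open>The product is twisted after multiplying and the coproduct before splitting; since
  \<beta> commutes with everything, its copies on the two sides of each axiom balance. The twisted
  structure \<open>H'\<close> is described by its values on the carrier, so a given record such as
  \<open>drinfeld_double A B p\<close> can be recognised as a twist.\<close>

lemma (in hom_hopf) yau_twist:
  fixes H' :: "('k, 'a, 'n) hom_hopf_scheme"
  assumes endo: "hopf_endo H \<beta>"
    and base: "vcarrier H' = vcarrier H" "vscale H' = vscale H"
    and twist: "\<And>c. c \<in> vcarrier H \<Longrightarrow> alpha H' c = \<beta> (alpha H c)"
      "\<And>a b. a \<in> vcarrier H \<Longrightarrow> b \<in> vcarrier H \<Longrightarrow> mult H' a b = \<beta> (mult H a b)"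
      "unit H' = unit H"
      "\<And>c. c \<in> vcarrier H \<Longrightarrow> comult H' c = comult H (\<beta> c)"
      "\<And>c. c \<in> vcarrier H \<Longrightarrow> counit H' c = counit H c"
      "\<And>c. c \<in> vcarrier H \<Longrightarrow> antipode H' c = antipode H c"
  shows "hom_hopf H'"
proof -
  note \<beta> = hopf_endoD[OF endo]
  note \<beta>mem [simp] = linear_on_mem[OF \<beta>(1)]
  note \<beta>lin = linear_on_compose[OF \<beta>(1)]
  note base_cong = tensor_base_cong[OF base base] pure_base_cong[OF base base]
    pure_base_cong[OF base refl refl, of "tensor H H"] linear_on_base_cong[OF base refl refl]
    linear_on_base_cong[OF refl refl base]
  have sw': "sw H' c f = sw H (\<beta> c) f" if "c \<in> vcarrier H" for c and f :: "'a \<Rightarrow> 'a \<Rightarrow> 'b::ab_group_add"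
    using that by (simp add: sw_def tsum_base_cong[OF base base] twist)
  have sw1: "sw H' x (\<lambda>u v. u \<otimes>\<^bsub>H,tensor H H\<^esub> (v \<otimes>\<^bsub>H,H\<^esub> t)) =
      sw H x (\<lambda>u v. \<beta> u \<otimes>\<^bsub>H,tensor H H\<^esub> (\<beta> v \<otimes>\<^bsub>H,H\<^esub> t))"
    and sw2: "sw H' x (\<lambda>u v. t \<otimes>\<^bsub>H,tensor H H\<^esub> (u \<otimes>\<^bsub>H,H\<^esub> v)) =
      sw H x (\<lambda>u v. t \<otimes>\<^bsub>H,tensor H H\<^esub> (\<beta> u \<otimes>\<^bsub>H,H\<^esub> \<beta> v))"
    if "x \<in> vcarrier H" "t \<in> vcarrier H" for x t
    unfolding sw'[OF that(1)] using that
    by (intro sw_coalgebra_endo[where U = "tensor H (tensor H H)"] bilinear_onI lin;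
        simp add: \<beta>)+
  have data: "hom_hopf_data H'"
  proof
    show "vector_space_on H'" using vs by (simp add: vector_space_on_def base)
    show "linear_on H' H' (alpha H')"
      unfolding base_cong
      by (rule linear_on_cong[OF vs]) (use \<beta>lin[OF alpha_lin] in \<open>simp_all add: twist\<close>)
    show "bilinear_on H' H' H' (mult H')"
      unfolding bilinear_on_def base_cong base
    proof (intro conjI ballI)
      fix w assume w: "w \<in> vcarrier H"
      show "linear_on H H (\<lambda>v. mult H' v w)"
        by (rule linear_on_cong[OF vs]) (use w in \<open>simp_all add: twist \<beta>lin lin\<close>)
      show "linear_on H H (mult H' w)"
        by (rule linear_on_cong[OF vs]) (use w in \<open>simp_all add: twist \<beta>lin lin\<close>)
    qed
    show "unit H' \<in> vcarrier H'" by (simp add: base twist)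
    show "linear_on H' (tensor H' H') (comult H')"
      unfolding base_cong
      by (rule linear_on_cong[OF vs])
        (use linear_on_compose[OF comult_lin \<beta>(1)] in \<open>simp_all add: twist\<close>)
    show "linear_on H' scalars (counit H')"
      unfolding base_cong by (rule linear_on_cong[OF vs counit_lin]) (simp add: twist)
    show "linear_on H' H' (antipode H')"
      unfolding base_cong by (rule linear_on_cong[OF vs antipode_lin]) (simp add: twist)
  qed
  show ?thesis
  proof (intro hom_hopf.intro hom_hopf_axioms.intro data, unfold base base_cong)
    show "alpha H' (unit H') = unit H'" by (simp add: twist \<beta>)
    show "comult H' (unit H') = unit H' \<otimes>\<^bsub>H,H\<^esub> unit H'"
      by (simp add: twist \<beta> comult_unit)
    show "counit H' (unit H') = 1" by (simp add: twist)
  next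
    fix c assume c: "c \<in> vcarrier H"
    show "counit H' (alpha H' c) = counit H' c"
      using c by (simp add: twist \<beta> counit_alpha)
    have "sw H' c (\<lambda>x y. alpha H' x \<otimes>\<^bsub>H,H\<^esub> alpha H' y) =
      sw H (\<beta> c) (\<lambda>x y. \<beta> (alpha H x) \<otimes>\<^bsub>H,H\<^esub> \<beta> (alpha H y))"
      unfolding sw'[OF c] using c by (intro sw_cong) (simp_all add: twist)
    also have "\<dots> = sw H (alpha H (\<beta> c)) (\<lambda>x y. \<beta> x \<otimes>\<^bsub>H,H\<^esub> \<beta> y)"
      using c by (intro sw_alpha[where U = "tensor H H", symmetric] bilinear_onI lin \<beta>lin) simp_all
    also have "\<dots> = comult H' (alpha H' c)"
      using c by (simp add: \<beta> twist)
    finally show "sw H' c (\<lambda>x y. alpha H' x \<otimes>\<^bsub>H,H\<^esub> alpha H' y) = comult H' (alpha H' c)" .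
    show "sw H' c (\<lambda>x y. vscale H (counit H' x) y) = alpha H' c"
      unfolding sw'[OF c] using c
      by (subst sw_cong[where g = "\<lambda>x y. vscale H (counit H x) y"])
        (simp_all add: twist counit_left_id \<beta>)
    show "sw H' c (\<lambda>x y. vscale H (counit H' y) x) = alpha H' c"
      unfolding sw'[OF c] using c
      by (subst sw_cong[where g = "\<lambda>x y. vscale H (counit H y) x"])
        (simp_all add: twist counit_right_id \<beta>)
    \<comment> \<open>The inner coproduct puts one \<beta> on each of its legs and
      \<open>alpha H'\<close> puts one on the remaining leg. All three slots now carry \<beta>, and
      the axiom of H can be used at \<open>\<beta> c\<close>.\<close>
    have "sw H' c (\<lambda>x y. sw H' x (\<lambda>u v. u \<otimes>\<^bsub>H,tensor H H\<^esub> (v \<otimes>\<^bsub>H,H\<^esub> alpha H' y))) =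
      sw H (\<beta> c) (\<lambda>x y. sw H x (\<lambda>u v. \<beta> u \<otimes>\<^bsub>H,tensor H H\<^esub> (\<beta> v \<otimes>\<^bsub>H,H\<^esub> \<beta> (alpha H y))))"
      unfolding sw'[OF c] using c
      by (intro sw_cong) (simp_all add: twist sw1)
    also have "\<dots> =
      sw H (\<beta> c) (\<lambda>x y. sw H y (\<lambda>u v. \<beta> (alpha H x) \<otimes>\<^bsub>H,tensor H H\<^esub> (\<beta> u \<otimes>\<^bsub>H,H\<^esub> \<beta> v)))"
      using c by (intro hom_coassoc[where U = "tensor H (tensor H H)"] lin \<beta>lin) simp_all
    also have "\<dots> =
      sw H' c (\<lambda>x y. sw H' y (\<lambda>u v. alpha H' x \<otimes>\<^bsub>H,tensor H H\<^esub> (u \<otimes>\<^bsub>H,H\<^esub> v)))"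
      unfolding sw'[OF c] using c
      by (intro sw_cong) (simp_all add: twist sw2)
    finally show "sw H' c (\<lambda>x y. sw H' x (\<lambda>u v. u \<otimes>\<^bsub>H,tensor H H\<^esub> (v \<otimes>\<^bsub>H,H\<^esub> alpha H' y))) =
      sw H' c (\<lambda>x y. sw H' y (\<lambda>u v. alpha H' x \<otimes>\<^bsub>H,tensor H H\<^esub> (u \<otimes>\<^bsub>H,H\<^esub> v)))" .
    have "sw H' c (\<lambda>x y. mult H' (antipode H' x) y) =
      sw H (\<beta> c) (\<lambda>x y. \<beta> (mult H (antipode H x) y))"
      unfolding sw'[OF c] using c by (intro sw_cong) (simp_all add: twist)
    also have "\<dots> = vscale H (counit H' c) (unit H')"
      using c by (simp add: antipode_left[OF \<beta>(1)] twist \<beta>)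
    finally show "sw H' c (\<lambda>x y. mult H' (antipode H' x) y) = vscale H (counit H' c) (unit H')" .
    have "sw H' c (\<lambda>x y. mult H' x (antipode H' y)) =
      sw H (\<beta> c) (\<lambda>x y. \<beta> (mult H x (antipode H y)))"
      unfolding sw'[OF c] using c by (intro sw_cong) (simp_all add: twist)
    also have "\<dots> = vscale H (counit H' c) (unit H')"
      using c by (simp add: antipode_right[OF \<beta>(1)] twist \<beta>)
    finally show "sw H' c (\<lambda>x y. mult H' x (antipode H' y)) = vscale H (counit H' c) (unit H')" .
  next
    fix a assume a: "a \<in> vcarrier H"
    show "mult H' (unit H') a = alpha H' a" "mult H' a (unit H') = alpha H' a"
      using a by (simp_all add: twist unit_mult mult_unit)
    show "antipode H' (alpha H' a) = alpha H' (antipode H' a)"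
      using a by (simp add: twist \<beta> antipode_alpha)
  next
    fix a b assume a: "a \<in> vcarrier H" and b: "b \<in> vcarrier H"
    show "alpha H' (mult H' a b) = mult H' (alpha H' a) (alpha H' b)"
      using a b by (simp add: twist \<beta> alpha_mult)
    \<comment> \<open>Two copies of \<beta> occur, one from the product and one from the coproduct.
      The first goes to the factors \<open>a\<close> and \<open>b\<close>, the second to the two
      legs.\<close>
    have "comult H' (mult H' a b) = comult H (\<beta> (mult H (\<beta> a) (\<beta> b)))"
      using a b by (simp add: twist \<beta>(2))
    also have "\<dots> = sw H (mult H (\<beta> a) (\<beta> b)) (\<lambda>x y. \<beta> x \<otimes>\<^bsub>H,H\<^esub> \<beta> y)"
      using a b by (simp add: \<beta>(4))
    also have "\<dots> = sw H (\<beta> a) (\<lambda>x y. sw H (\<beta> b) (\<lambda>u v. \<beta> (mult H x u) \<otimes>\<^bsub>H,H\<^esub> \<beta> (mult H y v)))"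
      using a b by (intro sw_mult[where U = "tensor H H"] bilinear_onI lin \<beta>lin) simp_all
    also have "\<dots> = sw H' a (\<lambda>x y. sw H' b (\<lambda>u v. mult H' x u \<otimes>\<^bsub>H,H\<^esub> mult H' y v))"
      unfolding sw'[OF a] sw'[OF b] using a b by (intro sw_cong) (simp_all add: twist)
    finally show "comult H' (mult H' a b) =
      sw H' a (\<lambda>x y. sw H' b (\<lambda>u v. mult H' x u \<otimes>\<^bsub>H,H\<^esub> mult H' y v))" .
    show "counit H' (mult H' a b) = counit H' a * counit H' b"
      using a b by (simp add: twist \<beta>(5) counit_mult)
  next
    fix a b c assume a: "a \<in> vcarrier H" and b: "b \<in> vcarrier H" and c: "c \<in> vcarrier H"
    show "mult H' (alpha H' a) (mult H' b c) = mult H' (mult H' a b) (alpha H' c)"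
      using a b c by (simp add: twist \<beta>(2,6) hom_assoc)
  qed
qed

section \<open>Hopf algebras with trivial structure map\<close>

locale ordinary_hopf = hom_hopf H for H :: "('k::field, 'a::ab_group_add, 'm) hom_hopf_scheme" +
  assumes alpha_id [simp]: "x \<in> vcarrier H \<Longrightarrow> alpha H x = x"
begin

lemma mult_assoc:
  "a \<in> vcarrier H \<Longrightarrow> b \<in> vcarrier H \<Longrightarrow> c \<in> vcarrier H \<Longrightarrow>
   mult H a (mult H b c) = mult H (mult H a b) c"
  using hom_assoc[of a b c] by simp

lemma mult_units [simp]:
  "a \<in> vcarrier H \<Longrightarrow> mult H (unit H) a = a" "a \<in> vcarrier H \<Longrightarrow> mult H a (unit H) = a"
  by (simp_all add: unit_mult mult_unit)

lemma coassoc: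
  assumes U: "vector_space_on U"
    and lin: "\<And>y z. y \<in> vcarrier H \<Longrightarrow> z \<in> vcarrier H \<Longrightarrow> linear_on H U (\<lambda>x. f x y z)"
      "\<And>x z. x \<in> vcarrier H \<Longrightarrow> z \<in> vcarrier H \<Longrightarrow> linear_on H U (\<lambda>y. f x y z)"
      "\<And>x y. x \<in> vcarrier H \<Longrightarrow> y \<in> vcarrier H \<Longrightarrow> linear_on H U (\<lambda>z. f x y z)"
    and c: "c \<in> vcarrier H"
  shows "sw H c (\<lambda>x y. sw H x (\<lambda>u v. f u v y)) = sw H c (\<lambda>x y. sw H y (\<lambda>u v. f x u v))"
proof -
  have "sw H c (\<lambda>x y. sw H x (\<lambda>u v. f u v y)) = sw H c (\<lambda>x y. sw H x (\<lambda>u v. f u v (alpha H y)))"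
    using c by (intro sw_cong) simp_all
  also have "\<dots> = sw H c (\<lambda>x y. sw H y (\<lambda>u v. f (alpha H x) u v))"
    using assms by (rule hom_coassoc)
  also have "\<dots> = sw H c (\<lambda>x y. sw H y (\<lambda>u v. f x u v))"
    using c by (intro sw_cong) simp_all
  finally show ?thesis .
qed

lemma counit_left':
  "linear_on H U f \<Longrightarrow> c \<in> vcarrier H \<Longrightarrow> sw H c (\<lambda>x y. vscale U (counit H x) (f y)) = f c"
  using counit_left[of U f c] by simp

lemma counit_right':
  "linear_on H U f \<Longrightarrow> c \<in> vcarrier H \<Longrightarrow> sw H c (\<lambda>x y. vscale U (counit H y) (f x)) = f c"
  using counit_right[of U f c] by simp

lemma antipode_unit [simp]: "antipode H (unit H) = unit H"
proof -
  have "bilinear_on H H H (\<lambda>x y. mult H (antipode H x) y)"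
    by (intro bilinear_onI lin) simp_all
  from sw_unit[OF vs this] antipode_left_id[OF unit_mem] show ?thesis
    by (simp add: vs_scale_one)
qed

lemma mult_scale:
  assumes "a \<in> vcarrier H" "b \<in> vcarrier H"
  shows "mult H (vscale H r a) b = vscale H r (mult H a b)"
    and "mult H a (vscale H r b) = vscale H r (mult H a b)"
  using bilinear_on_scale[OF mult_bilin assms] .

text \<open>Uniqueness of convolution inverses for maps on \<open>H \<otimes> H\<close>:
  \<open>S (a b)\<close> is a left inverse of the product (\<open>left\<close>) and
  \<open>S b S a\<close> a right inverse (\<open>right\<close>). The summand \<open>?G\<close> is
  \<open>S (a1 b1) (a2 b2) (S b3 S a3)\<close>, with legs x, y, z of \<open>a\<close> and u, v, w of
  \<open>b\<close>, and is evaluated in both bracketings.\<close>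

lemma antipode_mult:
  assumes a: "a \<in> vcarrier H" and b: "b \<in> vcarrier H"
  shows "antipode H (mult H a b) = mult H (antipode H b) (antipode H a)"
proof -
  let ?S = "antipode H" and ?m = "mult H"
  let ?G = "\<lambda>x y z u v w. ?m (?S (?m x u)) (?m (?m y v) (?m (?S w) (?S z)))"
  have G2: "?G x y z u v w = ?m (?m (?S (?m x u)) (?m y v)) (?m (?S w) (?S z))"
    if "x \<in> vcarrier H" "y \<in> vcarrier H" "z \<in> vcarrier H"
      "u \<in> vcarrier H" "v \<in> vcarrier H" "w \<in> vcarrier H" for x y z u v w
    using that by (simp add: mult_assoc)
  have right: "sw H r (\<lambda>y z. sw H t (\<lambda>v w. ?m (?m y v) (?m (?S w) (?S z)))) =
    vscale H (counit H r * counit H t) (unit H)"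
    if r: "r \<in> vcarrier H" and t: "t \<in> vcarrier H" for r t
  proof -
    have "sw H t (\<lambda>v w. ?m (?m y v) (?m (?S w) (?S z))) = vscale H (counit H t) (?m y (?S z))"
      if yz: "y \<in> vcarrier H" "z \<in> vcarrier H" for y z
    proof -
      have "sw H t (\<lambda>v w. ?m (?m y v) (?m (?S w) (?S z))) =
        sw H t (\<lambda>v w. ?m y (?m (?m v (?S w)) (?S z)))"
        using t yz by (intro sw_cong) (simp_all add: mult_assoc)
      also have "\<dots> = vscale H (counit H t) (?m y (?m (unit H) (?S z)))"
        using t yz by (intro antipode_right lin) simp_all
      finally show ?thesis using yz by simp
    qed
    then have "sw H r (\<lambda>y z. sw H t (\<lambda>v w. ?m (?m y v) (?m (?S w) (?S z)))) =
      sw H r (\<lambda>y z. vscale H (counit H t) (?m y (?S z)))"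
      using r by (intro sw_cong) simp_all
    also have "\<dots> = vscale H (counit H r) (vscale H (counit H t) (unit H))"
      using r by (intro antipode_right lin) simp_all
    finally show ?thesis by (simp add: vs_scale_scale)
  qed
  have left: "sw H r (\<lambda>x y. sw H t (\<lambda>u v. ?m (?S (?m x u)) (?m y v))) =
    vscale H (counit H r * counit H t) (unit H)"
    if r: "r \<in> vcarrier H" and t: "t \<in> vcarrier H" for r t
    using sw_mult[of H "\<lambda>p q. ?m (?S p) q" r t] r t
    by (simp add: antipode_left_id counit_mult bilinear_onI lin)
  \<comment> \<open>Counits are inserted on second legs of \<open>a\<close> and \<open>b\<close>, to
    be replaced by the expression that \<open>right\<close> collapses.\<close>
  have "?S (?m a b) = sw H a (\<lambda>x r. vscale H (counit H r) (?S (?m x b)))"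
    using a b by (intro counit_right'[symmetric] lin) simp_all
  also have "\<dots> = sw H a (\<lambda>x r. sw H b (\<lambda>u t. vscale H (counit H t) (vscale H (counit H r) (?S (?m x u)))))"
    using a b by (intro sw_cong counit_right'[symmetric] lin) simp_all
  also have "\<dots> = sw H a (\<lambda>x r. sw H b (\<lambda>u t. ?m (?S (?m x u))
     (sw H r (\<lambda>y z. sw H t (\<lambda>v w. ?m (?m y v) (?m (?S w) (?S z)))))))"
    using a b by (intro sw_cong) (simp_all add: right mult_scale vs_scale_scale mult.commute)
  also have "\<dots> = sw H a (\<lambda>x r. sw H b (\<lambda>u t. sw H r (\<lambda>y z. sw H t (\<lambda>v w. ?G x y z u v w))))"
  proof (intro sw_cong a b)
    fix x r u t assume m: "x \<in> vcarrier H" "r \<in> vcarrier H" "u \<in> vcarrier H" "t \<in> vcarrier H"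
    then have l: "linear_on H H (\<lambda>q. ?m (?S (?m x u)) q)" by (intro lin) simp_all
    show "?m (?S (?m x u)) (sw H r (\<lambda>y z. sw H t (\<lambda>v w. ?m (?m y v) (?m (?S w) (?S z))))) =
      sw H r (\<lambda>y z. sw H t (\<lambda>v w. ?G x y z u v w))"
      using m by (simp add: linear_sw[OF l _ vs] cong: sw_cong)
  qed
  also have "\<dots> = sw H a (\<lambda>x r. sw H r (\<lambda>y z. sw H b (\<lambda>u t. sw H t (\<lambda>v w. ?G x y z u v w))))"
    by (subst sw_swap) (rule refl)
  \<comment> \<open>Reassociation, here for \<open>b\<close> and next for \<open>a\<close>, makes
    the first two of the three legs come from a common coproduct, as \<open>left\<close>
    requires.\<close>
  also have "\<dots> = sw H a (\<lambda>x r. sw H r (\<lambda>y z. sw H b (\<lambda>t w. sw H t (\<lambda>u v. ?G x y z u v w))))"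
    by (rule sw_cong[OF a], rule sw_cong, assumption, intro coassoc[where U = H, symmetric] lin)
      (simp_all add: b)
  also have "\<dots> = sw H a (\<lambda>r z. sw H r (\<lambda>x y. sw H b (\<lambda>t w. sw H t (\<lambda>u v. ?G x y z u v w))))"
    using a b by (intro coassoc[where U = H, symmetric] lin) simp_all
  also have "\<dots> = sw H a (\<lambda>r z. sw H b (\<lambda>t w. sw H r (\<lambda>x y. sw H t (\<lambda>u v. ?G x y z u v w))))"
    by (subst sw_swap) (rule refl)
  also have "\<dots> = sw H a (\<lambda>r z. sw H b (\<lambda>t w.
      ?m (sw H r (\<lambda>x y. sw H t (\<lambda>u v. ?m (?S (?m x u)) (?m y v)))) (?m (?S w) (?S z))))"
  proof (intro sw_cong a b)
    fix r z t w assume m: "r \<in> vcarrier H" "z \<in> vcarrier H" "t \<in> vcarrier H" "w \<in> vcarrier H"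
    then have l: "linear_on H H (\<lambda>q. ?m q (?m (?S w) (?S z)))" by (intro lin) simp_all
    show "sw H r (\<lambda>x y. sw H t (\<lambda>u v. ?G x y z u v w)) =
      ?m (sw H r (\<lambda>x y. sw H t (\<lambda>u v. ?m (?S (?m x u)) (?m y v)))) (?m (?S w) (?S z))"
      using m by (simp add: linear_sw[OF l _ vs] G2 cong: sw_cong)
  qed
  also have "\<dots> = sw H a (\<lambda>r z. sw H b (\<lambda>t w.
      vscale H (counit H t) (vscale H (counit H r) (?m (?S w) (?S z)))))"
    using a b by (intro sw_cong) (simp_all add: left mult_scale vs_scale_scale mult.commute)
  also have "\<dots> = sw H a (\<lambda>r z. vscale H (counit H r) (?m (?S b) (?S z)))"
    using a b by (intro sw_cong counit_left' lin) simp_all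
  also have "\<dots> = ?m (?S b) (?S a)"
    using a b by (intro counit_left' lin) simp_all
  finally show ?thesis .
qed

end

section \<open>The inverse antipode\<close>

locale hopf_bij_antipode = ordinary_hopf H + bij_antipode_data H
  for H :: "('k::field, 'a::ab_group_add, 'm) hom_hopf_scheme"
begin

lemma antipode_inv_unit [simp]: "antipode_inv H (unit H) = unit H"
  by (rule antipode_inv_eqI) simp_all

lemma antipode_inv_mult:
  "a \<in> vcarrier H \<Longrightarrow> b \<in> vcarrier H \<Longrightarrow>
   antipode_inv H (mult H a b) = mult H (antipode_inv H b) (antipode_inv H a)"
  by (rule antipode_inv_eqI) (simp_all add: antipode_mult)

text \<open>The inverse antipode is the antipode for the opposite comultiplication: it reverses
  products, so applying it to \<open>S c1 c2\<close> yields \<open>S' c2 c1\<close>.\<close>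

lemma antipode_inv_left_id:
  assumes "c \<in> vcarrier H"
  shows "sw H c (\<lambda>x y. mult H (antipode_inv H y) x) = vscale H (counit H c) (unit H)"
proof -
  have "sw H c (\<lambda>x y. mult H (antipode_inv H y) x) =
    sw H c (\<lambda>x y. antipode_inv H (mult H (antipode H x) y))"
    using assms by (intro sw_cong) (simp_all add: antipode_inv_mult)
  also have "\<dots> = vscale H (counit H c) (antipode_inv H (unit H))"
    using assms by (intro antipode_left antipode_inv_lin)
  finally show ?thesis by simp
qed

lemma antipode_inv_right_id:
  assumes "c \<in> vcarrier H"
  shows "sw H c (\<lambda>x y. mult H y (antipode_inv H x)) = vscale H (counit H c) (unit H)"
proof -
  have "sw H c (\<lambda>x y. mult H y (antipode_inv H x)) =
    sw H c (\<lambda>x y. antipode_inv H (mult H x (antipode H y)))"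
    using assms by (intro sw_cong) (simp_all add: antipode_inv_mult)
  also have "\<dots> = vscale H (counit H c) (antipode_inv H (unit H))"
    using assms by (intro antipode_right antipode_inv_lin)
  finally show ?thesis by simp
qed

lemma antipode_inv_left:
  assumes "linear_on H U f" "c \<in> vcarrier H"
  shows "sw H c (\<lambda>x y. f (mult H (antipode_inv H y) x)) = vscale U (counit H c) (f (unit H))"
  using linear_sw[OF assms, of "\<lambda>x y. mult H (antipode_inv H y) x"] assms
  by (simp add: antipode_inv_left_id linear_on_scale)

lemma antipode_inv_right:
  assumes "linear_on H U f" "c \<in> vcarrier H"
  shows "sw H c (\<lambda>x y. f (mult H y (antipode_inv H x))) = vscale U (counit H c) (f (unit H))"
  using linear_sw[OF assms, of "\<lambda>x y. mult H y (antipode_inv H x)"] assms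
  by (simp add: antipode_inv_right_id linear_on_scale)

end

section \<open>Dual pairs and the associated actions\<close>

locale ordinary_dual_pair = A: hopf_bij_antipode A + B: hopf_bij_antipode B
  for A :: "('k::field, 'a::ab_group_add, 'm) hom_hopf_scheme"
    and B :: "('k, 'b::ab_group_add, 'n) hom_hopf_scheme" +
  fixes p :: "'a \<Rightarrow> 'b \<Rightarrow> 'k"
  assumes pair_bilin: "bilinear_on A B scalars p"
    and nondegenerate: "nondegenerate_on A B p"
    and pair_unit_right: "a \<in> vcarrier A \<Longrightarrow> p a (unit B) = counit A a"
    and pair_unit_left: "b \<in> vcarrier B \<Longrightarrow> p (unit A) b = counit B b"
    and pair_mult_left: "a \<in> vcarrier A \<Longrightarrow> a' \<in> vcarrier A \<Longrightarrow> b \<in> vcarrier B \<Longrightarrow>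
      p (mult A a a') b = sw B b (\<lambda>b1 b2. p a b1 * p a' b2)"
    and pair_mult_right: "a \<in> vcarrier A \<Longrightarrow> b \<in> vcarrier B \<Longrightarrow> b' \<in> vcarrier B \<Longrightarrow>
      p a (mult B b b') = sw A a (\<lambda>a1 a2. p a1 b * p a2 b')"
    and pair_antipode: "a \<in> vcarrier A \<Longrightarrow> b \<in> vcarrier B \<Longrightarrow>
      p (antipode A a) b = p a (antipode_inv B b)"
begin

lemmas pair_linear [lin] = bilinear_on_left[OF pair_bilin] bilinear_on_right[OF pair_bilin]

lemma pair_scale:
  "a \<in> vcarrier A \<Longrightarrow> b \<in> vcarrier B \<Longrightarrow> p (vscale A c a) b = c * p a b"
  "a \<in> vcarrier A \<Longrightarrow> b \<in> vcarrier B \<Longrightarrow> p a (vscale B c b) = c * p a b"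
  using bilinear_on_scale[OF pair_bilin, of a b] by simp_all

text \<open>Non-degeneracy in the form in which it is used: identities in B are tested by pairing
  with all of A, where they become identities about products in A.\<close>

lemma pair_eqI:
  assumes "b \<in> vcarrier B" "b' \<in> vcarrier B" "\<And>a. a \<in> vcarrier A \<Longrightarrow> p a b = p a b'"
  shows "b = b'"
proof -
  have "p a (b - b') = 0" if "a \<in> vcarrier A" for a
  proof -
    have "linear_on B scalars (p a)"
      using pair_bilin that by (simp add: bilinear_on_def)
    from linear_on_diff[OF B.vs this assms(1,2)] assms(3)[OF that] show ?thesis by simp
  qed
  then have "b - b' = 0"
    using nondegenerate vs_diff[OF B.vs assms(1,2)] unfolding nondegenerate_on_def by blast
  then show ?thesis by simp
qed

text \<open>L and R are the coregular actions of A on B. Under the pairing they are the transposes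
  of left and right multiplication by \<open>a\<close>; see \<open>pair_L\<close> and
  \<open>pair_R\<close>.\<close>

definition L :: "'a \<Rightarrow> 'b \<Rightarrow> 'b" where "L a b = sw B b (\<lambda>u v. vscale B (p a u) v)"

definition R :: "'a \<Rightarrow> 'b \<Rightarrow> 'b" where "R a b = sw B b (\<lambda>u v. vscale B (p a v) u)"

lemma L_mem [simp]: "a \<in> vcarrier A \<Longrightarrow> b \<in> vcarrier B \<Longrightarrow> L a b \<in> vcarrier B"
  and R_mem [simp]: "a \<in> vcarrier A \<Longrightarrow> b \<in> vcarrier B \<Longrightarrow> R a b \<in> vcarrier B"
  by (simp_all add: L_def R_def)

lemma L_bilin: "bilinear_on A B B L" and R_bilin: "bilinear_on A B B R"
  unfolding L_def R_def by (intro bilinear_onI lin; simp)+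

lemmas action_linear [lin] =
  bilinear_on_left[OF L_bilin] bilinear_on_right[OF L_bilin]
  bilinear_on_left[OF R_bilin] bilinear_on_right[OF R_bilin]

lemma pair_L:
  assumes "x \<in> vcarrier A" "a \<in> vcarrier A" "b \<in> vcarrier B"
  shows "p x (L a b) = p (mult A a x) b"
proof -
  have "linear_on B scalars (p x)" using pair_bilin assms by (simp add: bilinear_on_def)
  from B.linear_sw[OF this] assms show ?thesis
    unfolding L_def pair_mult_left[OF assms(2,1,3)] by (simp add: pair_scale cong: B.sw_cong)
qed

lemma pair_R:
  assumes "x \<in> vcarrier A" "a \<in> vcarrier A" "b \<in> vcarrier B"
  shows "p x (R a b) = p (mult A x a) b"
proof -
  have "linear_on B scalars (p x)" using pair_bilin assms by (simp add: bilinear_on_def)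
  from B.linear_sw[OF this] assms show ?thesis
    unfolding R_def pair_mult_left[OF assms(1,2,3)]
    by (simp add: pair_scale mult.commute cong: B.sw_cong)
qed

text \<open>Transposition reverses the order of left multiplications. For right multiplications it
  undoes the reversal already present in \<open>x \<mapsto> (x a) a'\<close>, whence the different
  order in \<open>R_R\<close>.\<close>

lemma L_L:
  "a \<in> vcarrier A \<Longrightarrow> a' \<in> vcarrier A \<Longrightarrow> b \<in> vcarrier B \<Longrightarrow> L a (L a' b) = L (mult A a' a) b"
  by (rule pair_eqI) (simp_all add: pair_L A.mult_assoc)

lemma R_R:
  "a \<in> vcarrier A \<Longrightarrow> a' \<in> vcarrier A \<Longrightarrow> b \<in> vcarrier B \<Longrightarrow> R a (R a' b) = R (mult A a a') b"
  by (rule pair_eqI) (simp_all add: pair_R A.mult_assoc)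

lemma L_R:
  "a \<in> vcarrier A \<Longrightarrow> a' \<in> vcarrier A \<Longrightarrow> b \<in> vcarrier B \<Longrightarrow> L a (R a' b) = R a' (L a b)"
  by (rule pair_eqI) (simp_all add: pair_R pair_L A.mult_assoc)

lemma L_unit [simp]: "b \<in> vcarrier B \<Longrightarrow> L (unit A) b = b"
  and R_unit [simp]: "b \<in> vcarrier B \<Longrightarrow> R (unit A) b = b"
  by (rule pair_eqI; simp add: pair_R pair_L)+

lemma L_of_unit: "a \<in> vcarrier A \<Longrightarrow> L a (unit B) = vscale B (counit A a) (unit B)"
  and R_of_unit: "a \<in> vcarrier A \<Longrightarrow> R a (unit B) = vscale B (counit A a) (unit B)"
  by (rule pair_eqI; simp add: pair_R pair_L pair_unit_right pair_scale A.counit_mult)+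

lemma counit_L: "a \<in> vcarrier A \<Longrightarrow> b \<in> vcarrier B \<Longrightarrow> counit B (L a b) = p a b"
  by (simp add: pair_L flip: pair_unit_left)

context
  fixes U :: "('k, 'u::ab_group_add, 'l) vspace_scheme" and f :: "'b \<Rightarrow> 'b \<Rightarrow> 'u" and a b
  assumes U: "vector_space_on U" and f: "bilinear_on B B U f"
    and a: "a \<in> vcarrier A" and b: "b \<in> vcarrier B"
begin

private lemmas f_linear = bilinear_on_left[OF f] bilinear_on_right[OF f]

text \<open>L consumes the leftmost of three legs and leaves the other two, so by coassociativity it
  acts on the first leg of the coproduct alone. Symmetrically, R consumes the rightmost leg.\<close>

lemma sw_L: "sw B (L a b) f = sw B b (\<lambda>u v. f (L a u) v)"
proof -
  have 1: "linear_on B U (\<lambda>y. sw B y f)" by (intro lin U f_linear)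
  have "sw B (L a b) f = sw B b (\<lambda>u v. vscale U (p a u) (sw B v f))"
    unfolding L_def using a b
    by (simp add: B.linear_sw[OF 1 _ B.vs] linear_on_scale[OF 1] cong: B.sw_cong)
  also have "\<dots> = sw B b (\<lambda>u v. sw B v (\<lambda>v w. vscale U (p a u) (f v w)))"
    using a b U bilinear_on_mem[OF f]
    by (intro B.sw_cong B.linear_sw[where U = U and X = U]) (simp_all add: linear_on_vscale_right linear_on_id)
  also have "\<dots> = sw B b (\<lambda>t w. sw B t (\<lambda>u v. vscale U (p a u) (f v w)))"
    using a b U bilinear_on_mem[OF f]
    by (intro B.coassoc[where U = U, symmetric] lin f_linear) simp_all
  also have "\<dots> = sw B b (\<lambda>t w. f (L a t) w)"
  proof (rule B.sw_cong[OF b])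
    fix t w assume t: "t \<in> vcarrier B" "w \<in> vcarrier B"
    then have 2: "linear_on B U (\<lambda>y. f y w)" by (intro f_linear lin)
    show "sw B t (\<lambda>u v. vscale U (p a u) (f v w)) = f (L a t) w"
      unfolding L_def using a t
      by (simp add: B.linear_sw[OF 2 _ B.vs] linear_on_scale[OF 2] cong: B.sw_cong)
  qed
  finally show ?thesis .
qed

lemma sw_R: "sw B (R a b) f = sw B b (\<lambda>u v. f u (R a v))"
proof -
  have 1: "linear_on B U (\<lambda>y. sw B y f)" by (intro lin U f_linear)
  have "sw B (R a b) f = sw B b (\<lambda>v w. vscale U (p a w) (sw B v f))"
    unfolding R_def using a b
    by (simp add: B.linear_sw[OF 1 _ B.vs] linear_on_scale[OF 1] cong: B.sw_cong)
  also have "\<dots> = sw B b (\<lambda>v w. sw B v (\<lambda>u v. vscale U (p a w) (f u v)))"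
    using a b U bilinear_on_mem[OF f]
    by (intro B.sw_cong B.linear_sw[where U = U and X = U]) (simp_all add: linear_on_vscale_right linear_on_id)
  also have "\<dots> = sw B b (\<lambda>u t. sw B t (\<lambda>v w. vscale U (p a w) (f u v)))"
    using a b U bilinear_on_mem[OF f]
    by (intro B.coassoc[where U = U] lin f_linear) simp_all
  also have "\<dots> = sw B b (\<lambda>u t. f u (R a t))"
  proof (rule B.sw_cong[OF b])
    fix u t assume t: "u \<in> vcarrier B" "t \<in> vcarrier B"
    then have 2: "linear_on B U (\<lambda>y. f u y)" by (intro f_linear lin)
    show "sw B t (\<lambda>v w. vscale U (p a w) (f u v)) = f u (R a t)"
      unfolding R_def using a t
      by (simp add: B.linear_sw[OF 2 _ B.vs] linear_on_scale[OF 2] cong: B.sw_cong)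
  qed
  finally show ?thesis .
qed

text \<open>In both expressions the middle one of three legs is paired with \<open>a\<close>; only
  the bracketing of the coproduct differs.\<close>

lemma sw_L_right: "sw B b (\<lambda>u v. f u (L a v)) = sw B b (\<lambda>u v. f (R a u) v)"
proof -
  have "sw B b (\<lambda>u v. f u (L a v)) = sw B b (\<lambda>u t. sw B t (\<lambda>v w. vscale U (p a v) (f u w)))"
  proof (rule B.sw_cong[OF b])
    fix u t assume t: "u \<in> vcarrier B" "t \<in> vcarrier B"
    then have 2: "linear_on B U (\<lambda>y. f u y)" by (intro f_linear lin)
    show "f u (L a t) = sw B t (\<lambda>v w. vscale U (p a v) (f u w))"
      unfolding L_def using a t
      by (simp add: B.linear_sw[OF 2 _ B.vs] linear_on_scale[OF 2] cong: B.sw_cong)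
  qed
  also have "\<dots> = sw B b (\<lambda>t w. sw B t (\<lambda>u v. vscale U (p a v) (f u w)))"
    using a b U bilinear_on_mem[OF f]
    by (intro B.coassoc[where U = U, symmetric] lin f_linear) simp_all
  also have "\<dots> = sw B b (\<lambda>t w. f (R a t) w)"
  proof (rule B.sw_cong[OF b])
    fix t w assume t: "t \<in> vcarrier B" "w \<in> vcarrier B"
    then have 2: "linear_on B U (\<lambda>y. f y w)" by (intro f_linear lin)
    show "sw B t (\<lambda>u v. vscale U (p a v) (f u w)) = f (R a t) w"
      unfolding R_def using a t
      by (simp add: B.linear_sw[OF 2 _ B.vs] linear_on_scale[OF 2] cong: B.sw_cong)
  qed
  finally show ?thesis .
qed

end

text \<open>Tested against \<open>x\<close>, this is multiplicativity of the coproduct of A: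
  \<open>(a x, b b')\<close> is computed from the legs of \<open>a x\<close>, which are products of
  legs of \<open>a\<close> and of \<open>x\<close>.\<close>

lemma L_mult:
  assumes a: "a \<in> vcarrier A" and b: "b \<in> vcarrier B" and b': "b' \<in> vcarrier B"
  shows "L a (mult B b b') = sw A a (\<lambda>a1 a2. mult B (L a1 b) (L a2 b'))"
proof (rule pair_eqI)
  fix x assume x: "x \<in> vcarrier A"
  have l: "linear_on B scalars (p x)" using pair_bilin x by (simp add: bilinear_on_def)
  have "p x (L a (mult B b b')) = sw A (mult A a x) (\<lambda>u v. p u b * p v b')"
    using assms x by (simp add: pair_L pair_mult_right)
  also have "\<dots> = sw A a (\<lambda>a1 a2. sw A x (\<lambda>x1 x2. p (mult A a1 x1) b * p (mult A a2 x2) b'))"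
    using assms x by (intro A.sw_mult[where U = scalars] bilinear_onI lin) simp_all
  also have "\<dots> = sw A a (\<lambda>a1 a2. p x (mult B (L a1 b) (L a2 b')))"
    using assms x by (intro A.sw_cong) (simp_all add: pair_mult_right pair_L cong: A.sw_cong)
  also have "\<dots> = p x (sw A a (\<lambda>a1 a2. mult B (L a1 b) (L a2 b')))"
    using assms by (intro A.linear_sw[OF l, symmetric]) simp_all
  finally show "p x (L a (mult B b b')) = \<dots>" .
qed (use assms in simp_all)

lemma pair_antipode_inv:
  assumes "a \<in> vcarrier A" "b \<in> vcarrier B"
  shows "p (antipode_inv A a) b = p a (antipode B b)"
  using pair_antipode[of "antipode_inv A a" "antipode B b"] assms by simp

text \<open>The antipode is moved to B, where it reverses the product, and back again. This replaces
  the statement that the inverse antipode of A reverses coproducts.\<close>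

lemma pair_antipode_inv_mult_right:
  assumes "a \<in> vcarrier A" "b \<in> vcarrier B" "b' \<in> vcarrier B"
  shows "p (antipode_inv A a) (mult B b b') =
    sw A a (\<lambda>a1 a2. p (antipode_inv A a2) b * p (antipode_inv A a1) b')"
proof -
  have "p (antipode_inv A a) (mult B b b') = p a (antipode B (mult B b b'))"
    using assms by (intro pair_antipode_inv) simp_all
  also have "\<dots> = sw A a (\<lambda>a1 a2. p a1 (antipode B b') * p a2 (antipode B b))"
    using assms by (simp add: B.antipode_mult pair_mult_right)
  also have "\<dots> = sw A a (\<lambda>a1 a2. p (antipode_inv A a2) b * p (antipode_inv A a1) b')"
    using assms by (intro A.sw_cong) (simp_all add: pair_antipode_inv)
  finally show ?thesis .
qed

lemma counit_antipode_inv: "a \<in> vcarrier A \<Longrightarrow> counit A (antipode_inv A a) = counit A a"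
  using pair_antipode_inv[of a "unit B"] by (simp add: pair_unit_right)

text \<open>The argument of \<open>L_mult\<close> would need the coproduct of the inverse antipode
  of \<open>a\<close>. Expanding R instead leaves only a pairing with \<open>S' a\<close> to be
  split, which the preceding rule does.\<close>

lemma R_antipode_inv_mult:
  assumes a: "a \<in> vcarrier A" and b: "b \<in> vcarrier B" and b': "b' \<in> vcarrier B"
  shows "R (antipode_inv A a) (mult B b b') =
    sw A a (\<lambda>a1 a2. mult B (R (antipode_inv A a2) b) (R (antipode_inv A a1) b'))"
proof -
  let ?S = "antipode_inv A"
  have "R (?S a) (mult B b b') =
    sw B b (\<lambda>u v. sw B b' (\<lambda>u' v'. vscale B (p (?S a) (mult B v v')) (mult B u u')))"
    unfolding R_def using assms
    by (intro B.sw_mult[where U = B] bilinear_onI lin) simp_all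
  also have "\<dots> = sw B b (\<lambda>u v. sw B b' (\<lambda>u' v'.
      sw A a (\<lambda>a1 a2. vscale B (p (?S a2) v * p (?S a1) v') (mult B u u'))))"
  proof (intro B.sw_cong b b')
    fix u v u' v'
    assume m: "u \<in> vcarrier B" "v \<in> vcarrier B" "u' \<in> vcarrier B" "v' \<in> vcarrier B"
    then have l: "linear_on scalars B (\<lambda>c. vscale B c (mult B u u'))" by (intro lin) simp_all
    show "vscale B (p (?S a) (mult B v v')) (mult B u u') =
      sw A a (\<lambda>a1 a2. vscale B (p (?S a2) v * p (?S a1) v') (mult B u u'))"
      unfolding pair_antipode_inv_mult_right[OF a m(2,4)]
      using a m by (intro A.linear_sw[OF l]) simp_all
  qed
  also have "\<dots> = sw A a (\<lambda>a1 a2. sw B b (\<lambda>u v. sw B b' (\<lambda>u' v'.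
      vscale B (p (?S a2) v * p (?S a1) v') (mult B u u'))))"
    by (simp only: sw_swap[of B _ A])
  also have "\<dots> = sw A a (\<lambda>a1 a2. mult B (R (?S a2) b) (R (?S a1) b'))"
  proof (rule A.sw_cong[OF a])
    fix x y assume m: "x \<in> vcarrier A" "y \<in> vcarrier A"
    have l1: "linear_on B B (\<lambda>q. mult B q (R (?S x) b'))"
      using m b' by (intro lin) simp_all
    have l2: "linear_on B B (\<lambda>q. mult B u q)" if "u \<in> vcarrier B" for u
      using that by (intro lin) simp_all
    have "mult B (R (?S y) b) (R (?S x) b') =
      sw B b (\<lambda>u v. mult B (vscale B (p (?S y) v) u) (R (?S x) b'))"
      using m b b' unfolding R_def[of "?S y"] by (intro B.linear_sw[OF l1]) simp_all
    also have "\<dots> = sw B b (\<lambda>u v. sw B b' (\<lambda>u' v'.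
        mult B (vscale B (p (?S y) v) u) (vscale B (p (?S x) v') u')))"
      using m b b' unfolding R_def by (intro B.sw_cong B.linear_sw[OF l2]) simp_all
    also have "\<dots> = sw B b (\<lambda>u v. sw B b' (\<lambda>u' v'.
        vscale B (p (?S y) v * p (?S x) v') (mult B u u')))"
      using m b b' by (intro B.sw_cong) (simp_all add: B.mult_scale vs_scale_scale mult.commute)
    finally show "sw B b (\<lambda>u v. sw B b' (\<lambda>u' v'.
        vscale B (p (?S y) v * p (?S x) v') (mult B u u'))) =
      mult B (R (?S y) b) (R (?S x) b')" by simp
  qed
  finally show ?thesis .
qed

section \<open>The two-sided action Q\<close>

definition Q :: "'a \<Rightarrow> 'a \<Rightarrow> 'b \<Rightarrow> 'b" where "Q x z b = L z (R (antipode_inv A x) b)"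

lemma Q_mem [simp]:
  "x \<in> vcarrier A \<Longrightarrow> z \<in> vcarrier A \<Longrightarrow> b \<in> vcarrier B \<Longrightarrow> Q x z b \<in> vcarrier B"
  by (simp add: Q_def)

lemma Q_linear [lin]:
  "linear_on X A g \<Longrightarrow> z \<in> vcarrier A \<Longrightarrow> b \<in> vcarrier B \<Longrightarrow> linear_on X B (\<lambda>x. Q (g x) z b)"
  "linear_on X A g \<Longrightarrow> x \<in> vcarrier A \<Longrightarrow> b \<in> vcarrier B \<Longrightarrow> linear_on X B (\<lambda>z. Q x (g z) b)"
  "linear_on X B h \<Longrightarrow> x \<in> vcarrier A \<Longrightarrow> z \<in> vcarrier A \<Longrightarrow> linear_on X B (\<lambda>b. Q x z (h b))"
  unfolding Q_def by (intro lin; simp)+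

lemma Q_unit [simp]: "b \<in> vcarrier B \<Longrightarrow> Q (unit A) (unit A) b = b"
  by (simp add: Q_def)

lemma Q_of_unit:
  assumes "x \<in> vcarrier A" "z \<in> vcarrier A"
  shows "Q x z (unit B) = vscale B (counit A x * counit A z) (unit B)"
  using assms
  by (simp add: Q_def R_of_unit L_of_unit counit_antipode_inv vs_scale_scale
      bilinear_on_scale(2)[OF L_bilin])

text \<open>Both slots reverse the order: L does so by itself, and R preserves the order but acts
  through the inverse antipode, which reverses it.\<close>

lemma Q_Q:
  assumes "x \<in> vcarrier A" "z \<in> vcarrier A" "x' \<in> vcarrier A" "z' \<in> vcarrier A" "b \<in> vcarrier B"
  shows "Q x z (Q x' z' b) = Q (mult A x' x) (mult A z' z) b"
  unfolding Q_def using assms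
  by (simp add: L_R[symmetric] L_L R_R A.antipode_inv_mult)

text \<open>The inverse antipode exchanges the legs of \<open>x\<close>. Hence the inner legs
  \<open>x2\<close> and \<open>z1\<close> act on \<open>b\<close> and the outer legs
  \<open>x1\<close> and \<open>z2\<close> on \<open>b'\<close>, which is the nesting that
  associativity of the double requires.\<close>

lemma Q_mult:
  assumes x: "x \<in> vcarrier A" and z: "z \<in> vcarrier A" and b: "b \<in> vcarrier B"
    and b': "b' \<in> vcarrier B"
  shows "Q x z (mult B b b') =
    sw A x (\<lambda>x1 x2. sw A z (\<lambda>z1 z2. mult B (Q x2 z1 b) (Q x1 z2 b')))"
proof -
  have l: "linear_on B B (L z)" using L_bilin z by (simp add: bilinear_on_def)
  show ?thesis
    unfolding Q_def R_antipode_inv_mult[OF x b b'] using assms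
    by (subst A.linear_sw[OF l]) (simp_all add: L_mult cong: A.sw_cong)
qed

lemma sw_Q:
  assumes "vector_space_on U" "bilinear_on B B U f"
    and "x \<in> vcarrier A" "z \<in> vcarrier A" "b \<in> vcarrier B"
  shows "sw B (Q x z b) f = sw B b (\<lambda>u v. f (L z u) (R (antipode_inv A x) v))"
  unfolding Q_def using assms
  by (subst sw_L[where U = U], simp_all)
    (intro sw_R[where U = U] bilinear_onI bilinear_on_left[OF assms(2)]
      bilinear_on_right[OF assms(2)] lin; simp)

lemma counit_Q:
  assumes "x \<in> vcarrier A" "z \<in> vcarrier A" "b \<in> vcarrier B"
  shows "counit B (Q x z b) = p (mult A z (antipode_inv A x)) b"
  using assms by (simp add: Q_def counit_L pair_R)

end

lemma linear_on_tscale [lin]: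
  "linear_on X scalars g \<Longrightarrow> t \<in> vcarrier (tensor V W) \<Longrightarrow> linear_on X (tensor V W) (\<lambda>x. tscale (g x) t)"
  "linear_on X (tensor V W) h \<Longrightarrow> linear_on X (tensor V W) (\<lambda>x. tscale c (h x))"
  using linear_on_vscale_left[of "tensor V W"] linear_on_vscale_right[of "tensor V W"] by simp_all

lemma tscale_mem [simp]: "t \<in> vcarrier (tensor V W) \<Longrightarrow> tscale c t \<in> vcarrier (tensor V W)"
  using vs_scale[of "tensor V W"] by simp

lemma pure_scale:
  "v \<in> vcarrier V \<Longrightarrow> w \<in> vcarrier W \<Longrightarrow> vscale V c v \<otimes>\<^bsub>V,W\<^esub> w = tscale c (v \<otimes>\<^bsub>V,W\<^esub> w)"
  "v \<in> vcarrier V \<Longrightarrow> w \<in> vcarrier W \<Longrightarrow> v \<otimes>\<^bsub>V,W\<^esub> vscale W c w = tscale c (v \<otimes>\<^bsub>V,W\<^esub> w)"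
  using bilinear_on_scale[OF bilinear_on_pure, of v V w W] by simp_all

text \<open>Bilinearity is asked of the rewritten integrand \<open>g\<close>. Nested uses turn
  iterated \<open>sweedler\<close> expressions into \<open>sw\<close> sums from the inside.\<close>

lemma (in hom_hopf_data) sweedler_eqI:
  assumes "vector_space_on U"
    and "\<And>x y. x \<in> vcarrier H \<Longrightarrow> y \<in> vcarrier H \<Longrightarrow> f x y = g x y"
    and "bilinear_on H H U g" "c \<in> vcarrier H"
  shows "sweedler H U c f = sw H c g"
proof -
  have "sweedler H U c f = sweedler H U c g"
    unfolding sweedler_def using assms(2) by (subst tlift_cong[where f = g]) simp_all
  then show ?thesis using sweedler_eq_sw assms by metis
qed

lemma (in ordinary_hopf) alpha_inv_id [simp]: "x \<in> vcarrier H \<Longrightarrow> alpha_inv H x = x"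
  by (metis alpha_id f_inv_into_f image_eqI inv_into_into)

section \<open>The double of ordinary Hopf algebras\<close>

context ordinary_dual_pair
begin

abbreviation D where "D \<equiv> drinfeld_double A B p"

abbreviation T where "T \<equiv> tensor A B"

abbreviation bow (infixl "\<bowtie>" 70) where "a \<bowtie> b \<equiv> pure A B a b"

abbreviation tensor_TT (infixl "\<otimes>" 70) where "s \<otimes> t \<equiv> pure T T s t"

lemma D_base: "vcarrier D = vcarrier T" "vscale D = vscale T"
  by (simp_all add: drinfeld_double_def)

lemma linear_on_D_dom: "linear_on D W = linear_on T W"
  by (rule linear_on_base_cong[OF D_base refl refl])

lemma linear_on_D_cod: "linear_on W D = linear_on W T"
  by (rule linear_on_base_cong[OF refl refl D_base])

lemma bilinear_on_D_dom: "bilinear_on D D U = bilinear_on T T U"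
  by (rule bilinear_on_dom_cong[OF D_base D_base])

lemma bilinear_on_D_cod: "bilinear_on V W D = bilinear_on V W T"
  by (simp add: bilinear_on_def linear_on_D_cod fun_eq_iff)

lemma pure_D: "pure D D = pure T T"
  by (rule pure_base_cong[OF D_base D_base])

lemma tensor_D: "tensor D D = tensor T T"
  by (rule tensor_base_cong[OF D_base D_base])

lemma pure_D_tensor: "pure D (tensor T T) = pure T (tensor T T)"
  by (rule pure_base_cong[OF D_base refl refl])

text \<open>The double and the tensor product \<open>T\<close> are different records on the same
  vector space. These equations allow all linear algebra on \<open>D\<close> to be done over
  \<open>T\<close>.\<close>

lemmas D_space = linear_on_D_dom linear_on_D_cod bilinear_on_D_dom bilinear_on_D_cod
  pure_D tensor_D pure_D_tensor D_base

lemma T_eqI: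
  assumes "linear_on T U f" "linear_on T U g" "t \<in> vcarrier T"
    and "\<And>a b. a \<in> vcarrier A \<Longrightarrow> b \<in> vcarrier B \<Longrightarrow> f (a \<bowtie> b) = g (a \<bowtie> b)"
  shows "f t = g t"
  using tensor_linear_eqI[OF assms(1,2) _ assms(3)] assms(4) .

text \<open>The variables x, y, z are the legs of \<open>a'\<close> in this order: the outer two act
  on \<open>b\<close> and the middle one multiplies \<open>a\<close>.\<close>

definition M :: "'a \<Rightarrow> 'b \<Rightarrow> 'a \<Rightarrow> 'b \<Rightarrow> ('a, 'b, 'k) tensor" where
  "M a b a' b' = sw A a' (\<lambda>x r. sw A r (\<lambda>y z. mult A a y \<bowtie> mult B (Q x z b) b'))"

lemma M_mem [simp]:
  "a \<in> vcarrier A \<Longrightarrow> b \<in> vcarrier B \<Longrightarrow> a' \<in> vcarrier A \<Longrightarrow> b' \<in> vcarrier B \<Longrightarrow> M a b a' b' \<in> vcarrier T"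
  by (simp add: M_def)

lemma M_linear:
  "linear_on X A g \<Longrightarrow> b \<in> vcarrier B \<Longrightarrow> a' \<in> vcarrier A \<Longrightarrow> b' \<in> vcarrier B \<Longrightarrow>
    linear_on X T (\<lambda>a. M (g a) b a' b')"
  "linear_on X B h \<Longrightarrow> a \<in> vcarrier A \<Longrightarrow> a' \<in> vcarrier A \<Longrightarrow> b' \<in> vcarrier B \<Longrightarrow>
    linear_on X T (\<lambda>b. M a (h b) a' b')"
  "linear_on X A g \<Longrightarrow> a \<in> vcarrier A \<Longrightarrow> b \<in> vcarrier B \<Longrightarrow> b' \<in> vcarrier B \<Longrightarrow>
    linear_on X T (\<lambda>a'. M a b (g a') b')"
  "linear_on X B h \<Longrightarrow> a \<in> vcarrier A \<Longrightarrow> b \<in> vcarrier B \<Longrightarrow> a' \<in> vcarrier A \<Longrightarrow>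
    linear_on X T (\<lambda>b'. M a b a' (h b'))"
  unfolding M_def by (intro lin; simp)+

text \<open>The coefficient with \<open>y2\<close> assembles R on the outer coproduct of
  \<open>b\<close>, the one with \<open>y11\<close> assembles L on the inner coproduct, and
  \<open>y12\<close> is what remains of \<open>b\<close>.\<close>

lemma M_expand:
  assumes "a \<in> vcarrier A" "b \<in> vcarrier B" "a' \<in> vcarrier A" "b' \<in> vcarrier B"
  shows "sw A a' (\<lambda>x1 x2. sw A x2 (\<lambda>x21 x22. sw B b (\<lambda>y1 y2. sw B y1 (\<lambda>y11 y12.
      tscale (p (antipode_inv A x1) y2 * p x22 y11) (mult A a x21 \<bowtie> mult B y12 b'))))) = M a b a' b'"
  unfolding M_def
proof (intro A.sw_cong assms(3))
  fix x r y z assume m: "x \<in> vcarrier A" "r \<in> vcarrier A" "y \<in> vcarrier A" "z \<in> vcarrier A"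
  let ?S = "antipode_inv A"
  let ?l = "\<lambda>q. mult A a y \<bowtie> mult B q b'"
  have l: "linear_on B T ?l" using assms m by (intro lin) simp_all
  have l': "linear_on B T (\<lambda>q. ?l (L z q))" using assms m by (intro lin) simp_all
  have s: "linear_on T T (tscale c)" for c by (intro lin)
  have "sw B b (\<lambda>y1 y2. sw B y1 (\<lambda>y11 y12. tscale (p (?S x) y2 * p z y11) (?l y12))) =
    sw B b (\<lambda>y1 y2. tscale (p (?S x) y2) (sw B y1 (\<lambda>y11 y12. tscale (p z y11) (?l y12))))"
    using assms m
    by (intro B.sw_cong) (simp_all add: B.linear_sw[OF s] tensor_space.scale_scale)
  also have "\<dots> = sw B b (\<lambda>y1 y2. tscale (p (?S x) y2) (?l (L z y1)))"
    unfolding L_def using assms m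
    by (intro B.sw_cong) (simp_all add: B.linear_sw[OF l _ B.vs] B.mult_scale pure_scale cong: B.sw_cong)
  also have "\<dots> = ?l (Q x z b)"
    unfolding Q_def R_def using assms m linear_on_scale[OF l']
    by (simp add: B.linear_sw[OF l' _ B.vs] cong: B.sw_cong)
  finally show "sw B b (\<lambda>y1 y2. sw B y1 (\<lambda>y11 y12.
      tscale (p (?S x) y2 * p z y11) (mult A a y \<bowtie> mult B y12 b'))) = ?l (Q x z b)" .
qed

lemma M_bilin: 
  "a \<in> vcarrier A \<Longrightarrow> b \<in> vcarrier B \<Longrightarrow> bilinear_on A B T (M a b)"
  by (intro bilinear_onI M_linear lin)

lemma M_tsum_bilin:
  "t \<in> vcarrier T \<Longrightarrow> bilinear_on A B T (\<lambda>a b. tsum A B t (M a b))"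
  by (intro bilinear_onI linear_on_tsum_param M_linear lin) simp_all

lemma mult_D:
  assumes "s \<in> vcarrier T" "t \<in> vcarrier T"
  shows "mult D s t = tsum A B s (\<lambda>a b. tsum A B t (M a b))"
proof -
  let ?S = "\<lambda>a y x b'. sweedler A T x (\<lambda>x1 x2. sweedler A T x2 (\<lambda>x21 x22.
       sweedler B T y (\<lambda>y1 y2. sweedler B T y1 (\<lambda>y11 y12.
         tscale (p (antipode_inv A (alpha A x1)) y2 * p x22 (alpha_inv B y11))
           (mult A a (alpha_inv A (alpha_inv A x21)) \<bowtie> mult B (alpha_inv B (alpha_inv B y12)) b')))))"
  have S: "?S a y x b' = M a y x b'"
    if "a \<in> vcarrier A" "y \<in> vcarrier B" "x \<in> vcarrier A" "b' \<in> vcarrier B" for a y x b'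
    unfolding M_expand[OF that, symmetric] using that
    by (intro A.sweedler_eqI B.sweedler_eqI bilinear_onI lin) simp_all
  have "mult D s t = tlift A B T (\<lambda>a y. tlift A B T (?S a y) t) s"
    by (simp add: drinfeld_double_def double_mult_def)
  also have "\<dots> = tlift A B T (\<lambda>a b. tsum A B t (M a b)) s"
  proof (rule fun_cong[OF tlift_cong])
    fix a y assume m: "a \<in> vcarrier A" "y \<in> vcarrier B"
    have "tlift A B T (?S a y) = tlift A B T (M a y)"
      using m by (intro tlift_cong S refl)
    then show "tlift A B T (?S a y) t = tsum A B t (M a y)"
      using m assms by (simp add: tlift_eq_tsum[OF _ _ M_bilin])
  qed
  also have "\<dots> = tsum A B s (\<lambda>a b. tsum A B t (M a b))"
    using assms by (simp add: tlift_eq_tsum[OF _ _ M_tsum_bilin])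
  finally show ?thesis .
qed

lemma mult_D_pure:
  assumes "a \<in> vcarrier A" "b \<in> vcarrier B" "a' \<in> vcarrier A" "b' \<in> vcarrier B"
  shows "mult D (a \<bowtie> b) (a' \<bowtie> b') = M a b a' b'"
  using assms by (simp add: mult_D tsum_pure[OF _ _ M_tsum_bilin] tsum_pure[OF _ _ M_bilin])

lemma mult_D_bilin: "bilinear_on T T T (mult D)"
proof (rule bilinear_onI)
  fix t assume t: "t \<in> vcarrier T"
  show "linear_on T T (\<lambda>s. mult D s t)"
    by (rule linear_on_cong[OF vector_space_on_tensor linear_on_tsum_tensor[OF A.vs _ M_tsum_bilin[OF t]]])
      (simp_all add: mult_D t)
  have "linear_on T T (\<lambda>s. tsum A B t (\<lambda>a b. tsum A B s (M a b)))"
    using t by (intro linear_on_tsum_param linear_on_tsum_tensor M_bilin) simp_all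
  then show "linear_on T T (mult D t)"
    by (rule linear_on_cong[OF vector_space_on_tensor]) (simp add: mult_D t)
qed

lemmas mult_D_mem [simp] = bilinear_on_mem[OF mult_D_bilin]
lemmas mult_D_linear [lin] = bilinear_on_left[OF mult_D_bilin] bilinear_on_right[OF mult_D_bilin]

text \<open>The coproduct of A tensored with the opposite coproduct of B.\<close>

definition C :: "'a \<Rightarrow> 'b \<Rightarrow> (('a, 'b, 'k) tensor, ('a, 'b, 'k) tensor, 'k) tensor" where
  "C a b = sw A a (\<lambda>a1 a2. sw B b (\<lambda>b1 b2. (a1 \<bowtie> b2) \<otimes> (a2 \<bowtie> b1)))"

lemma C_bilin: "bilinear_on A B (tensor T T) C"
  unfolding C_def by (intro bilinear_onI lin) simp_all

lemma comult_D:
  assumes "t \<in> vcarrier T"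
  shows "comult D t = tsum A B t C"
proof -
  have "comult D t = tlift A B (tensor T T) (\<lambda>a b. sweedler A (tensor T T) a (\<lambda>a1 a2.
      sweedler B (tensor T T) b (\<lambda>b1 b2. (a1 \<bowtie> b2) \<otimes> (a2 \<bowtie> b1)))) t"
    by (simp add: drinfeld_double_def Let_def)
  also have "\<dots> = tlift A B (tensor T T) C t"
    unfolding C_def
    by (rule fun_cong[OF tlift_cong], intro A.sweedler_eqI B.sweedler_eqI bilinear_onI lin)
      simp_all
  finally show ?thesis using assms by (simp add: tlift_eq_tsum[OF _ _ C_bilin])
qed

lemma comult_D_linear: "linear_on T (tensor T T) (comult D)"
  by (rule linear_on_cong[OF vector_space_on_tensor linear_on_tsum_tensor[OF A.vs _ C_bilin]])
    (simp_all add: comult_D)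

lemma comult_D_pure: "a \<in> vcarrier A \<Longrightarrow> b \<in> vcarrier B \<Longrightarrow> comult D (a \<bowtie> b) = C a b"
  by (simp add: comult_D tsum_pure[OF _ _ C_bilin])

lemma counit_D_bilin: "bilinear_on A B scalars (\<lambda>a b. counit A a * counit B b)"
  by (intro bilinear_onI lin A.counit_lin)

lemma counit_D_linear: "linear_on T scalars (counit D)"
  unfolding drinfeld_double_def by simp (intro linear_on_tlift counit_D_bilin; simp)

lemma counit_D_pure:
  "a \<in> vcarrier A \<Longrightarrow> b \<in> vcarrier B \<Longrightarrow> counit D (a \<bowtie> b) = counit A a * counit B b"
  by (simp add: drinfeld_double_def tlift_pure[OF _ counit_D_bilin])

lemma alpha_D:
  assumes "t \<in> vcarrier T"
  shows "alpha D t = t"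
proof -
  have "alpha D = tlift A B T (\<lambda>a b. a \<bowtie> b)"
    unfolding drinfeld_double_def tmap_def by simp (rule tlift_cong; simp)
  then show ?thesis
    using assms by (simp add: tlift_eq_tsum[OF A.vs _ bilinear_on_pure] tsum_pure_self)
qed

section \<open>The antipode of the double\<close>

text \<open>The common form of \<open>R2_map\<close>, where \<open>f\<close> is R, and of its
  inverse, where \<open>f\<close> is R precomposed with the inverse antipode.\<close>

definition rot :: "('a \<Rightarrow> 'b \<Rightarrow> 'b) \<Rightarrow> 'a \<Rightarrow> 'b \<Rightarrow> ('a, 'b, 'k) tensor" where
  "rot f a b = sw A a (\<lambda>x y. y \<bowtie> f x b)"

lemma rot_bilin:
  assumes f: "bilinear_on A B B f"
  shows "bilinear_on A B T (rot f)"
  unfolding rot_def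
  by (intro bilinear_onI lin bilinear_on_left[OF f] bilinear_on_right[OF f])
    (simp_all add: bilinear_on_mem[OF f])

lemma R_inv_bilin: "bilinear_on A B B (\<lambda>a. R (antipode_inv A a))"
  by (intro bilinear_onI lin) simp_all

text \<open>Composition applies \<open>g\<close> with the first leg of \<open>a\<close> and
  \<open>f\<close> with the second. Coassociativity makes these two legs a coproduct of their own,
  on which \<open>cancel\<close> acts, and the third leg survives.\<close>

lemma rot_rot:
  assumes f: "bilinear_on A B B f" and g: "bilinear_on A B B g"
    and cancel: "\<And>c h. c \<in> vcarrier A \<Longrightarrow> linear_on B T h \<Longrightarrow>
      sw A c (\<lambda>x u. h (f u (g x b))) = tscale (counit A c) (h b)"
    and a: "a \<in> vcarrier A" and b: "b \<in> vcarrier B"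
  shows "tsum A B (rot g a b) (rot f) = a \<bowtie> b"
proof -
  have fl: "linear_on X A h \<Longrightarrow> d \<in> vcarrier B \<Longrightarrow> linear_on X B (\<lambda>x. f (h x) d)"
    "linear_on X B k \<Longrightarrow> c \<in> vcarrier A \<Longrightarrow> linear_on X B (\<lambda>x. f c (k x))"
    "linear_on X A h \<Longrightarrow> d \<in> vcarrier B \<Longrightarrow> linear_on X B (\<lambda>x. g (h x) d)"
    for X :: "('k, 'a, 'm) hom_hopf_scheme" and h k c d
    by (fact bilinear_on_left[OF f] bilinear_on_right[OF f] bilinear_on_left[OF g])+
  have [simp]: "x \<in> vcarrier A \<Longrightarrow> y \<in> vcarrier B \<Longrightarrow> g x y \<in> vcarrier B" for x y
    by (rule bilinear_on_mem[OF g])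
  have [simp]: "x \<in> vcarrier A \<Longrightarrow> y \<in> vcarrier B \<Longrightarrow> f x y \<in> vcarrier B" for x y
    by (rule bilinear_on_mem[OF f])
  have "tsum A B (rot g a b) (rot f) = sw A a (\<lambda>x y. tsum A B (y \<bowtie> g x b) (rot f))"
    unfolding rot_def[of g] using a b
    by (intro A.linear_sw[OF linear_on_tsum_tensor[OF _ _ rot_bilin[OF f]]]) simp_all
  also have "\<dots> = sw A a (\<lambda>x y. sw A y (\<lambda>u v. v \<bowtie> f u (g x b)))"
    using a b by (intro A.sw_cong) (simp_all add: tsum_pure[OF _ _ rot_bilin[OF f]] rot_def)
  also have "\<dots> = sw A a (\<lambda>t v. sw A t (\<lambda>x u. v \<bowtie> f u (g x b)))"
    using a b by (intro A.coassoc[where U = T, symmetric] lin fl) simp_all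
  also have "\<dots> = sw A a (\<lambda>t v. tscale (counit A t) (v \<bowtie> b))"
    using a b by (intro A.sw_cong cancel lin) simp_all
  also have "\<dots> = a \<bowtie> b"
    using a b A.counit_left'[of T "\<lambda>v. v \<bowtie> b" a] by (simp add: lin)
  finally show ?thesis .
qed

lemma rot_R_expand:
  assumes a: "a \<in> vcarrier A" and b: "b \<in> vcarrier B"
  shows "sw A a (\<lambda>a1 a2. sw B b (\<lambda>b1 b2. tscale (p a1 b2) (a2 \<bowtie> b1))) = rot R a b"
  unfolding rot_def R_def
proof (rule A.sw_cong[OF a])
  fix x y assume m: "x \<in> vcarrier A" "y \<in> vcarrier A"
  then have l: "linear_on B T (\<lambda>q. y \<bowtie> q)" by (intro lin)
  show "sw B b (\<lambda>b1 b2. tscale (p x b2) (y \<bowtie> b1)) = y \<bowtie> sw B b (\<lambda>u v. vscale B (p x v) u)"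
    using m b by (simp add: B.linear_sw[OF l _ B.vs] pure_scale cong: B.sw_cong)
qed

lemma R2_eq: "R2_map A B p = tlift A B T (rot R)"
  unfolding R2_map_def
proof (rule tlift_cong)
  fix a b assume ab: "a \<in> vcarrier A" "b \<in> vcarrier B"
  then show "sweedler A T a (\<lambda>a1 a2. sweedler B T b (\<lambda>b1 b2.
         tscale (p (alpha A a1) b2) (alpha_inv A a2 \<bowtie> alpha_inv B b1))) = rot R a b"
    unfolding rot_R_expand[OF ab, symmetric]
    by (intro A.sweedler_eqI B.sweedler_eqI bilinear_onI lin) simp_all
qed

definition rot1 :: "'a \<Rightarrow> 'b \<Rightarrow> ('a, 'b, 'k) tensor" where
  "rot1 a b = sw A a (\<lambda>x y. x \<bowtie> L y b)"

lemma rot1_bilin: "bilinear_on A B T rot1"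
  unfolding rot1_def by (intro bilinear_onI lin) simp_all

lemma rot1_expand:
  assumes a: "a \<in> vcarrier A" and b: "b \<in> vcarrier B"
  shows "sw A a (\<lambda>a1 a2. sw B b (\<lambda>b1 b2. tscale (p a2 b1) (a1 \<bowtie> b2))) = rot1 a b"
  unfolding rot1_def L_def
proof (rule A.sw_cong[OF a])
  fix x y assume m: "x \<in> vcarrier A" "y \<in> vcarrier A"
  then have l: "linear_on B T (\<lambda>q. x \<bowtie> q)" by (intro lin)
  show "sw B b (\<lambda>b1 b2. tscale (p y b1) (x \<bowtie> b2)) = x \<bowtie> sw B b (\<lambda>u v. vscale B (p y u) v)"
    using m b by (simp add: B.linear_sw[OF l _ B.vs] pure_scale cong: B.sw_cong)
qed

lemma R1_eq: "R1_map A B p = tlift A B T rot1"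
  unfolding R1_map_def
proof (rule tlift_cong)
  fix a b assume ab: "a \<in> vcarrier A" "b \<in> vcarrier B"
  then show "sweedler A T a (\<lambda>a1 a2. sweedler B T b (\<lambda>b1 b2.
         tscale (p (alpha A a2) b1) (alpha_inv A a1 \<bowtie> alpha_inv B b2))) = rot1 a b"
    unfolding rot1_expand[OF ab, symmetric]
    by (intro A.sweedler_eqI B.sweedler_eqI bilinear_onI lin) simp_all
qed

text \<open>\<open>inv_into\<close> is identified from a two-sided inverse: one composite shows that
  the value is a preimage of \<open>t\<close>, the other that the map is injective. The composites
  rest on the two cancellation laws \<open>u S' x\<close> and \<open>S' u x\<close> for the inverse
  antipode.\<close>

lemma R2_inverse:
  assumes t: "t \<in> vcarrier T"
  shows "inv_into (vcarrier T) (R2_map A B p) t = tsum A B t (rot (\<lambda>a. R (antipode_inv A a)))"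
proof (rule inv_into_f_eq)
  let ?R' = "\<lambda>a. R (antipode_inv A a)"
  note lin_rot = linear_on_tsum_tensor[OF A.vs vector_space_on_tensor rot_bilin]
  have R2: "R2_map A B p s = tsum A B s (rot R)" if "s \<in> vcarrier T" for s
    using that by (simp add: R2_eq tlift_eq_tsum[OF _ _ rot_bilin[OF R_bilin]])
  have inv1: "tsum A B (tsum A B s (rot ?R')) (rot R) = s"
    and inv2: "tsum A B (tsum A B s (rot R)) (rot ?R') = s" if "s \<in> vcarrier T" for s
  proof -
    have "tsum A B (rot ?R' a b) (rot R) = a \<bowtie> b" "tsum A B (rot R a b) (rot ?R') = a \<bowtie> b"
      if m: "a \<in> vcarrier A" "b \<in> vcarrier B" for a b
    proof -
      have l: "linear_on A T (\<lambda>q. h (R q b))" if "linear_on B T h" for h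
        by (intro linear_on_compose[OF that] lin m)
      show "tsum A B (rot ?R' a b) (rot R) = a \<bowtie> b"
      proof (rule rot_rot[OF R_bilin R_inv_bilin _ m])
        fix c h assume c: "c \<in> vcarrier A" "linear_on B T h"
        then show "sw A c (\<lambda>x u. h (R u (R (antipode_inv A x) b))) = tscale (counit A c) (h b)"
          using A.antipode_inv_right[OF l[OF c(2)] c(1)] m by (simp add: R_R cong: A.sw_cong)
      qed
      show "tsum A B (rot R a b) (rot ?R') = a \<bowtie> b"
      proof (rule rot_rot[OF R_inv_bilin R_bilin _ m])
        fix c h assume c: "c \<in> vcarrier A" "linear_on B T h"
        then show "sw A c (\<lambda>x u. h (R (antipode_inv A u) (R x b))) = tscale (counit A c) (h b)"
          using A.antipode_inv_left[OF l[OF c(2)] c(1)] m by (simp add: R_R cong: A.sw_cong)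
      qed
    qed
    note pure = this
    show "tsum A B (tsum A B s (rot ?R')) (rot R) = s"
      by (rule T_eqI[OF linear_on_compose[OF lin_rot lin_rot] linear_on_id that])
        (simp_all add: R_bilin R_inv_bilin tsum_pure[OF _ _ rot_bilin] pure)
    show "tsum A B (tsum A B s (rot R)) (rot ?R') = s"
      by (rule T_eqI[OF linear_on_compose[OF lin_rot lin_rot] linear_on_id that])
        (simp_all add: R_bilin R_inv_bilin tsum_pure[OF _ _ rot_bilin] pure)
  qed
  have mem: "tsum A B s (rot ?R') \<in> vcarrier T" "tsum A B s (rot R) \<in> vcarrier T"
    if "s \<in> vcarrier T" for s
    using linear_on_mem[OF lin_rot that] R_bilin R_inv_bilin by blast+
  show "tsum A B t (rot ?R') \<in> vcarrier T" by (rule mem[OF t])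
  show "R2_map A B p (tsum A B t (rot ?R')) = t" by (simp add: R2 mem t inv1)
  show "inj_on (R2_map A B p) (vcarrier T)"
    by (rule inj_on_inverseI[of _ "\<lambda>s. tsum A B s (rot ?R')"]) (simp add: R2 inv2)
qed

text \<open>The flip in \<open>T_map\<close> cancels the flip in the antipode. What remains sends
  \<open>a \<otimes> b\<close> to \<open>(1 \<bowtie> b)(a \<bowtie> 1)\<close>: the inverse of
  \<open>R2_map\<close> splits off the first leg of \<open>a\<close> and acts by R through
  \<open>S'\<close>, then \<open>R1_map\<close> splits off the last leg and acts by L, and the two
  actions together are Q.\<close>

lemma antipode_D:
  assumes "t \<in> vcarrier T"
  shows "antipode D t = tsum A B t (\<lambda>a b. M (unit A) (antipode_inv B b) (antipode A a) (unit B))"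
proof -
  have l1: "linear_on T T (tmap A B A B (antipode A) (antipode_inv B))"
    unfolding tmap_def by (intro linear_on_tlift bilinear_onI lin) simp_all
  have l2: "linear_on T (tensor B A) (tflip A B)" and l3: "linear_on (tensor B A) T (tflip B A)"
    unfolding tflip_def by (intro linear_on_tlift bilinear_onI lin; simp)+
  have l4: "linear_on T T (inv_into (vcarrier T) (R2_map A B p))"
    by (rule linear_on_cong[OF vector_space_on_tensor
          linear_on_tsum_tensor[OF A.vs vector_space_on_tensor rot_bilin[OF R_inv_bilin]]])
      (simp add: R2_inverse)
  have l5: "linear_on T T (R1_map A B p)"
    unfolding R1_eq by (rule linear_on_tlift[OF _ rot1_bilin]) simp
  have M: "bilinear_on A B T (\<lambda>a b. M (unit A) (antipode_inv B b) (antipode A a) (unit B))"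
    by (intro bilinear_onI M_linear lin) simp_all
  have "R1_map A B p (inv_into (vcarrier T) (R2_map A B p) (tflip B A (tflip A B
      (tmap A B A B (antipode A) (antipode_inv B) t)))) =
    tsum A B t (\<lambda>a b. M (unit A) (antipode_inv B b) (antipode A a) (unit B))"
  proof (rule T_eqI[OF _ linear_on_tsum_tensor[OF A.vs _ M] assms])
    show "linear_on T T (\<lambda>t. R1_map A B p (inv_into (vcarrier T) (R2_map A B p) (tflip B A (tflip A B
      (tmap A B A B (antipode A) (antipode_inv B) t)))))"
      by (intro linear_on_compose[OF l1] linear_on_compose[OF l2] linear_on_compose[OF l3]
          linear_on_compose[OF l4] linear_on_compose[OF l5] lin)
    fix a b assume a: "a \<in> vcarrier A" and b: "b \<in> vcarrier B"
    let ?a = "antipode A a" and ?b = "antipode_inv B b"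
    have 1: "tmap A B A B (antipode A) (antipode_inv B) (a \<bowtie> b) = ?a \<bowtie> ?b"
      unfolding tmap_def using a b by (intro tlift_pure bilinear_onI lin) simp_all
    have 2: "tflip A B (?a \<bowtie> ?b) = ?b \<otimes>\<^bsub>B,A\<^esub> ?a"
      unfolding tflip_def using a b by (intro tlift_pure bilinear_onI lin) simp_all
    have 3: "tflip B A (?b \<otimes>\<^bsub>B,A\<^esub> ?a) = ?a \<bowtie> ?b"
      unfolding tflip_def using a b by (intro tlift_pure bilinear_onI lin) simp_all
    have "R1_map A B p (inv_into (vcarrier T) (R2_map A B p) (?a \<bowtie> ?b)) =
      R1_map A B p (sw A ?a (\<lambda>x r. r \<bowtie> R (antipode_inv A x) ?b))"
      using a b by (simp add: R2_inverse tsum_pure[OF _ _ rot_bilin[OF R_inv_bilin]] rot_def)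
    also have "\<dots> = sw A ?a (\<lambda>x r. R1_map A B p (r \<bowtie> R (antipode_inv A x) ?b))"
      using a b by (intro A.linear_sw[OF l5]) simp_all
    also have "\<dots> = sw A ?a (\<lambda>x r. sw A r (\<lambda>y z. y \<bowtie> Q x z ?b))"
      using a b by (intro A.sw_cong) (simp_all add: R1_eq tlift_pure[OF _ rot1_bilin] rot1_def Q_def)
    also have "\<dots> = M (unit A) ?b ?a (unit B)"
      unfolding M_def using a b by (simp cong: A.sw_cong)
    finally show "R1_map A B p (inv_into (vcarrier T) (R2_map A B p) (tflip B A (tflip A B
      (tmap A B A B (antipode A) (antipode_inv B) (a \<bowtie> b))))) =
      tsum A B (a \<bowtie> b) (\<lambda>a b. M (unit A) (antipode_inv B b) (antipode A a) (unit B))"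
      using a b by (simp add: 1 2 3 tsum_pure[OF _ _ M])
  qed simp
  then show ?thesis by (simp add: drinfeld_double_def T_map_def)
qed

lemma antipode_D_linear: "linear_on T T (antipode D)"
proof -
  have M: "bilinear_on A B T (\<lambda>a b. M (unit A) (antipode_inv B b) (antipode A a) (unit B))"
    by (intro bilinear_onI M_linear lin) simp_all
  show ?thesis
    by (rule linear_on_cong[OF vector_space_on_tensor linear_on_tsum_tensor[OF A.vs _ M]])
      (simp_all add: antipode_D)
qed

lemma antipode_D_pure:
  assumes "a \<in> vcarrier A" "b \<in> vcarrier B"
  shows "antipode D (a \<bowtie> b) = mult D (unit A \<bowtie> antipode_inv B b) (antipode A a \<bowtie> unit B)"
proof -
  have M: "bilinear_on A B T (\<lambda>a b. M (unit A) (antipode_inv B b) (antipode A a) (unit B))"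
    by (intro bilinear_onI M_linear lin) simp_all
  show ?thesis using assms by (simp add: antipode_D tsum_pure[OF _ _ M] mult_D_pure)
qed

lemma D_data: "hom_hopf_data D"
proof (rule hom_hopf_data.intro, unfold D_space)
  show "vector_space_on D"
    using vector_space_on_tensor[of A B] by (simp add: vector_space_on_def D_base)
  show "linear_on T T (alpha D)"
    by (rule linear_on_cong[OF vector_space_on_tensor linear_on_id]) (simp add: alpha_D)
  show "unit D \<in> vcarrier T" by (simp add: drinfeld_double_def)
qed (rule mult_D_bilin comult_D_linear counit_D_linear antipode_D_linear)+

end

section \<open>Rearranging iterated coproducts\<close>

lemma sw_ext: "(\<And>x y. f x y = g x y) \<Longrightarrow> sw H c f = sw H c g"
  by (rule arg_cong[where f = "sw H c"]) (intro ext)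

lemma sw_swap2:
  "sw H c (\<lambda>x y. sw G d (\<lambda>u v. sw G v (\<lambda>w z. f x y u v w z))) =
   sw G d (\<lambda>u v. sw G v (\<lambda>w z. sw H c (\<lambda>x y. f x y u v w z)))"
  unfolding sw_swap[of H c G] by (rule refl)

context ordinary_hopf
begin

text \<open>Two bracketings of the coproduct with five legs, \<open>(t u)(v (w x))\<close> and
  \<open>t ((u (v w)) x)\<close>. They are the ones produced by the two sides of associativity in
  the double.\<close>

lemma coassoc5:
  assumes U: "vector_space_on U"
    and f: "\<And>w x y z. w \<in> vcarrier H \<Longrightarrow> x \<in> vcarrier H \<Longrightarrow> y \<in> vcarrier H \<Longrightarrow> z \<in> vcarrier H \<Longrightarrow>
      linear_on H U (\<lambda>v. f v w x y z) \<and> linear_on H U (\<lambda>v. f w v x y z) \<and>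
      linear_on H U (\<lambda>v. f w x v y z) \<and> linear_on H U (\<lambda>v. f w x y v z) \<and>
      linear_on H U (\<lambda>v. f w x y z v)"
    and c: "c \<in> vcarrier H"
  shows "sw H c (\<lambda>q r. sw H r (\<lambda>v s. sw H q (\<lambda>t u. sw H s (\<lambda>w x. f t u v w x)))) =
    sw H c (\<lambda>t r. sw H r (\<lambda>q x. sw H q (\<lambda>u s. sw H s (\<lambda>v w. f t u v w x))))"
proof -
  note fl = f[THEN conjunct1] f[THEN conjunct2, THEN conjunct1]
    f[THEN conjunct2, THEN conjunct2, THEN conjunct1]
    f[THEN conjunct2, THEN conjunct2, THEN conjunct2, THEN conjunct1]
    f[THEN conjunct2, THEN conjunct2, THEN conjunct2, THEN conjunct2]
  have "sw H c (\<lambda>q r. sw H r (\<lambda>v s. sw H q (\<lambda>t u. sw H s (\<lambda>w x. f t u v w x)))) =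
    sw H c (\<lambda>q r. sw H q (\<lambda>t u. sw H r (\<lambda>v s. sw H s (\<lambda>w x. f t u v w x))))"
    by (subst sw_swap) (rule refl)
  also have "\<dots> = sw H c (\<lambda>t q. sw H q (\<lambda>u r. sw H r (\<lambda>v s. sw H s (\<lambda>w x. f t u v w x))))"
    using c U by (intro coassoc[where U = U] lin fl) simp_all
  also have "\<dots> = sw H c (\<lambda>t r. sw H r (\<lambda>q x. sw H q (\<lambda>u s. sw H s (\<lambda>v w. f t u v w x))))"
  proof (rule sw_cong[OF c])
    fix t r assume m: "t \<in> vcarrier H" "r \<in> vcarrier H"
    have "sw H r (\<lambda>u q. sw H q (\<lambda>v s. sw H s (\<lambda>w x. f t u v w x))) =
      sw H r (\<lambda>u q. sw H q (\<lambda>s x. sw H s (\<lambda>v w. f t u v w x)))"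
      by (rule sw_cong[OF m(2)], rule coassoc[where U = U, symmetric]; (intro fl U)?)
        (simp_all add: m)
    also have "\<dots> = sw H r (\<lambda>q x. sw H q (\<lambda>u s. sw H s (\<lambda>v w. f t u v w x)))"
      using m U by (intro coassoc[where U = U, symmetric] lin fl) simp_all
    finally show "sw H r (\<lambda>u q. sw H q (\<lambda>v s. sw H s (\<lambda>w x. f t u v w x))) =
      sw H r (\<lambda>q x. sw H q (\<lambda>u s. sw H s (\<lambda>v w. f t u v w x)))" .
  qed
  finally show ?thesis .
qed

end

text \<open>Of the six legs u, v, z, x, v', z' the third and fourth meet as \<open>S' x z\<close>
  and cancel. It is applied from right to left: a unit is expanded into such a product, and three
  legs become available for each half of a coproduct.\<close>

lemma (in hopf_bij_antipode) coassoc_cancel: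
  assumes U: "vector_space_on U"
    and f: "\<And>w x y z. w \<in> vcarrier H \<Longrightarrow> x \<in> vcarrier H \<Longrightarrow> y \<in> vcarrier H \<Longrightarrow> z \<in> vcarrier H \<Longrightarrow>
      linear_on H U (\<lambda>v. f v w x y z) \<and> linear_on H U (\<lambda>v. f w v x y z) \<and>
      linear_on H U (\<lambda>v. f w x v y z) \<and> linear_on H U (\<lambda>v. f w x y v z) \<and>
      linear_on H U (\<lambda>v. f w x y z v)"
    and c: "c \<in> vcarrier H"
  shows "sw H c (\<lambda>c1 c2. sw H c1 (\<lambda>u r. sw H r (\<lambda>v z. sw H c2 (\<lambda>x r'. sw H r' (\<lambda>v' z'.
      f u v (mult H (antipode_inv H x) z) v' z'))))) =
    sw H c (\<lambda>u r. sw H r (\<lambda>q z'. sw H q (\<lambda>v v'. f u v (unit H) v' z')))"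
proof -
  note fl = f[THEN conjunct1] f[THEN conjunct2, THEN conjunct1]
    f[THEN conjunct2, THEN conjunct2, THEN conjunct1]
    f[THEN conjunct2, THEN conjunct2, THEN conjunct2, THEN conjunct1]
    f[THEN conjunct2, THEN conjunct2, THEN conjunct2, THEN conjunct2]
  note fl' = linear_on_compose[OF fl(1)] linear_on_compose[OF fl(2)] linear_on_compose[OF fl(3)]
    linear_on_compose[OF fl(4)] linear_on_compose[OF fl(5)]
  let ?m = "\<lambda>x z. mult H (antipode_inv H x) z"
  have "sw H c (\<lambda>c1 c2. sw H c1 (\<lambda>u r. sw H r (\<lambda>v z. sw H c2 (\<lambda>x r'. sw H r' (\<lambda>v' z'.
      f u v (?m x z) v' z'))))) =
    sw H c (\<lambda>u q. sw H q (\<lambda>r c2. sw H r (\<lambda>v z. sw H c2 (\<lambda>x r'. sw H r' (\<lambda>v' z'.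
      f u v (?m x z) v' z')))))"
    using c U by (intro coassoc[where U = U] lin fl fl'(3)) simp_all
  also have "\<dots> = sw H c (\<lambda>u q. sw H q (\<lambda>v s. sw H s (\<lambda>v' z'. f u v (unit H) v' z')))"
  proof (rule sw_cong[OF c])
    fix u q assume u: "u \<in> vcarrier H" and q: "q \<in> vcarrier H"
    have "sw H q (\<lambda>r c2. sw H r (\<lambda>v z. sw H c2 (\<lambda>x r'. sw H r' (\<lambda>v' z'.
        f u v (?m x z) v' z')))) =
      sw H q (\<lambda>v s. sw H s (\<lambda>z c2. sw H c2 (\<lambda>x r'. sw H r' (\<lambda>v' z'. f u v (?m x z) v' z'))))"
      using u q U by (intro coassoc[where U = U] lin fl fl'(3)) simp_all
    also have "\<dots> = sw H q (\<lambda>v s. sw H s (\<lambda>v' z'. f u v (unit H) v' z'))"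
    proof (rule sw_cong[OF q])
      fix v s assume v: "v \<in> vcarrier H" and s: "s \<in> vcarrier H"
      have l: "linear_on H U (\<lambda>w. sw H r' (\<lambda>v' z'. f u v w v' z'))" if "r' \<in> vcarrier H" for r'
        using u v U that by (intro lin fl) simp_all
      have "sw H s (\<lambda>z c2. sw H c2 (\<lambda>x r'. sw H r' (\<lambda>v' z'. f u v (?m x z) v' z'))) =
        sw H s (\<lambda>t r'. sw H t (\<lambda>z x. sw H r' (\<lambda>v' z'. f u v (?m x z) v' z')))"
        using u v s U by (intro coassoc[where U = U, symmetric] lin fl fl'(3)) simp_all
      also have "\<dots> = sw H s (\<lambda>t r'. vscale U (counit H t) (sw H r' (\<lambda>v' z'. f u v (unit H) v' z')))"
        by (rule sw_cong[OF s], rule antipode_inv_left[OF l])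
      also have "\<dots> = sw H s (\<lambda>v' z'. f u v (unit H) v' z')"
        using u v s U by (intro counit_left' lin fl) simp_all
      finally show "sw H s (\<lambda>z c2. sw H c2 (\<lambda>x r'. sw H r' (\<lambda>v' z'. f u v (?m x z) v' z'))) =
        sw H s (\<lambda>v' z'. f u v (unit H) v' z')" .
    qed
    finally show "sw H q (\<lambda>r c2. sw H r (\<lambda>v z. sw H c2 (\<lambda>x r'. sw H r' (\<lambda>v' z'.
        f u v (?m x z) v' z')))) = sw H q (\<lambda>v s. sw H s (\<lambda>v' z'. f u v (unit H) v' z'))" .
  qed
  also have "\<dots> = sw H c (\<lambda>u r. sw H r (\<lambda>q z'. sw H q (\<lambda>v v'. f u v (unit H) v' z')))"
    by (rule sw_cong[OF c], rule coassoc[where U = U, symmetric]; (intro fl U)?) simp_all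
  finally show ?thesis .
qed

section \<open>The product of the double\<close>

context ordinary_dual_pair
begin

lemmas sw_D_linear [lin] =
  hom_hopf_data.sw_linear_arg[OF D_data, unfolded D_space]
  hom_hopf_data.sw_linear_param[OF D_data, unfolded D_space]
lemmas sw_D_cong = hom_hopf_data.sw_cong[OF D_data, unfolded D_space]

lemma sw_D_pure:
  assumes U: "vector_space_on U" and f: "bilinear_on T T U f"
    and a: "a \<in> vcarrier A" and b: "b \<in> vcarrier B"
  shows "sw D (a \<bowtie> b) f = sw A a (\<lambda>a1 a2. sw B b (\<lambda>b1 b2. f (a1 \<bowtie> b2) (a2 \<bowtie> b1)))"
proof -
  note l = linear_on_tsum_tensor[OF vector_space_on_tensor U f]
  have "sw D (a \<bowtie> b) f = tsum T T (C a b) f"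
    using a b by (simp add: sw_def tsum_base_cong[OF D_base D_base] comult_D_pure)
  also have "\<dots> = sw A a (\<lambda>a1 a2. tsum T T (sw B b (\<lambda>b1 b2. (a1 \<bowtie> b2) \<otimes> (a2 \<bowtie> b1))) f)"
    unfolding C_def using a b by (intro A.linear_sw[OF l]) simp_all
  also have "\<dots> = sw A a (\<lambda>a1 a2. sw B b (\<lambda>b1 b2. tsum T T ((a1 \<bowtie> b2) \<otimes> (a2 \<bowtie> b1)) f))"
    using a b by (intro A.sw_cong B.linear_sw[OF l]) simp_all
  also have "\<dots> = sw A a (\<lambda>a1 a2. sw B b (\<lambda>b1 b2. f (a1 \<bowtie> b2) (a2 \<bowtie> b1)))"
    using a b U f by (intro A.sw_cong B.sw_cong) (simp_all add: tsum_pure)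
  finally show ?thesis .
qed

lemma sw_scale_counits:
  assumes "vector_space_on U" "linear_on A U f" "c \<in> vcarrier A"
  shows "sw A c (\<lambda>x r. sw A r (\<lambda>y z. vscale U (counit A x * counit A z) (f y))) = f c"
proof -
  have mem: "f x \<in> vcarrier U" if "x \<in> vcarrier A" for x
    by (rule linear_on_mem[OF assms(2) that])
  have "sw A c (\<lambda>x r. sw A r (\<lambda>y z. vscale U (counit A x * counit A z) (f y))) =
    sw A c (\<lambda>x r. vscale U (counit A x) (f r))"
  proof (rule A.sw_cong[OF assms(3)])
    fix x r assume m: "x \<in> vcarrier A" "r \<in> vcarrier A"
    have "linear_on A U (\<lambda>y. vscale U (counit A x) (f y))"
      by (rule linear_on_vscale_right[OF assms(1,2)])
    from A.counit_right'[OF this m(2)]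
    show "sw A r (\<lambda>y z. vscale U (counit A x * counit A z) (f y)) = vscale U (counit A x) (f r)"
      by (simp add: vs_scale_scale[OF assms(1)] mult.commute)
  qed
  also have "\<dots> = f c" by (rule A.counit_left'[OF assms(2,3)])
  finally show ?thesis .
qed

text \<open>On the unit of B the action Q reduces to counits, which absorb the outer legs of
  \<open>a'\<close>. Together with \<open>mult_D_right_B\<close> and associativity, this is all that
  the unit laws and the antipode axiom need to know of the product.\<close>

lemma mult_D_left_A:
  assumes "a \<in> vcarrier A" "a' \<in> vcarrier A" "b \<in> vcarrier B"
  shows "mult D (a \<bowtie> unit B) (a' \<bowtie> b) = mult A a a' \<bowtie> b"
proof -
  have "mult D (a \<bowtie> unit B) (a' \<bowtie> b) =
    sw A a' (\<lambda>x r. sw A r (\<lambda>y z. vscale T (counit A x * counit A z) (mult A a y \<bowtie> b)))"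
    using assms
    by (simp add: mult_D_pure M_def Q_of_unit B.mult_scale pure_scale cong: A.sw_cong)
  also have "\<dots> = mult A a a' \<bowtie> b"
    using assms by (intro sw_scale_counits lin) simp_all
  finally show ?thesis .
qed

lemma mult_D_right_B:
  assumes "a \<in> vcarrier A" "b \<in> vcarrier B" "b' \<in> vcarrier B"
  shows "mult D (a \<bowtie> b) (unit A \<bowtie> b') = a \<bowtie> mult B b b'"
proof -
  have "bilinear_on A A T (\<lambda>x r. sw A r (\<lambda>y z. mult A a y \<bowtie> mult B (Q x z b) b'))"
    "bilinear_on A A T (\<lambda>y z. mult A a y \<bowtie> mult B (Q (unit A) z b) b')"
    using assms by (intro bilinear_onI lin; simp)+
  with assms show ?thesis
    by (simp add: mult_D_pure M_def A.sw_unit[where U = T])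
qed

lemma unit_D: "unit D = unit A \<bowtie> unit B"
  by (simp add: drinfeld_double_def)

text \<open>Both sides become sums of \<open>?F\<close> over three legs x, y, z of \<open>a'\<close>
  and five legs of \<open>a''\<close>. They differ only in the bracketing of the five legs and in
  the order of summation.\<close>

lemma mult_D_assoc_pure:
  assumes a: "a \<in> vcarrier A" and b: "b \<in> vcarrier B" and a': "a' \<in> vcarrier A"
    and b': "b' \<in> vcarrier B" and a'': "a'' \<in> vcarrier A" and b'': "b'' \<in> vcarrier B"
  shows "mult D (a \<bowtie> b) (mult D (a' \<bowtie> b') (a'' \<bowtie> b'')) =
    mult D (mult D (a \<bowtie> b) (a' \<bowtie> b')) (a'' \<bowtie> b'')"
proof -
  let ?mA = "mult A" and ?mB = "mult B"
  let ?F = "\<lambda>x y z t u v w s. ?mA a (?mA y v) \<bowtie>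
    ?mB (Q (?mA x u) (?mA z w) b) (?mB (Q t s b') b'')"
  have "mult D (mult D (a \<bowtie> b) (a' \<bowtie> b')) (a'' \<bowtie> b'') =
    sw A a' (\<lambda>x r. sw A r (\<lambda>y z. mult D (?mA a y \<bowtie> ?mB (Q x z b) b') (a'' \<bowtie> b'')))"
  proof -
    have l: "linear_on T T (\<lambda>t. mult D t (a'' \<bowtie> b''))" using a'' b'' by (intro lin) simp
    show ?thesis
      using assms
      by (simp add: mult_D_pure[of a b] M_def A.linear_sw[OF l] cong: A.sw_cong)
  qed
  \<comment> \<open>\<open>Q_mult\<close> splits the outer legs of \<open>a''\<close> between the
    two factors in B, and \<open>Q_Q\<close> merges the inner parts with the action of
    \<open>a'\<close> on \<open>b\<close>.\<close>
  also have "\<dots> = sw A a' (\<lambda>x r. sw A r (\<lambda>y z. sw A a'' (\<lambda>q r. sw A r (\<lambda>v s. sw A q (\<lambda>t u.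
      sw A s (\<lambda>w x'. ?F x y z t u v w x'))))))"
  proof (intro A.sw_cong a')
    fix x r y z assume m: "x \<in> vcarrier A" "r \<in> vcarrier A" "y \<in> vcarrier A" "z \<in> vcarrier A"
    have "mult D (?mA a y \<bowtie> ?mB (Q x z b) b') (a'' \<bowtie> b'') =
      sw A a'' (\<lambda>q r. sw A r (\<lambda>v s.
        ?mA (?mA a y) v \<bowtie> ?mB (Q q s (?mB (Q x z b) b')) b''))"
      using assms m by (simp add: mult_D_pure M_def)
    also have "\<dots> = sw A a'' (\<lambda>q r. sw A r (\<lambda>v s. sw A q (\<lambda>t u. sw A s (\<lambda>w x'. ?F x y z t u v w x'))))"
    proof (intro A.sw_cong a'')
      fix q r' v s
      assume m': "q \<in> vcarrier A" "r' \<in> vcarrier A" "v \<in> vcarrier A" "s \<in> vcarrier A"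
      have l: "linear_on B T (\<lambda>c. ?mA (?mA a y) v \<bowtie> ?mB c b'')"
        using assms m m' by (intro lin) simp_all
      show "?mA (?mA a y) v \<bowtie> ?mB (Q q s (?mB (Q x z b) b')) b'' =
        sw A q (\<lambda>t u. sw A s (\<lambda>w x'. ?F x y z t u v w x'))"
        using assms m m'
        by (simp add: Q_mult A.linear_sw[OF l _ B.vs] Q_Q A.mult_assoc B.mult_assoc cong: A.sw_cong)
    qed
    finally show "mult D (?mA a y \<bowtie> ?mB (Q x z b) b') (a'' \<bowtie> b'') =
      sw A a'' (\<lambda>q r. sw A r (\<lambda>v s. sw A q (\<lambda>t u. sw A s (\<lambda>w x'. ?F x y z t u v w x'))))" .
  qed
  also have "\<dots> = sw A a' (\<lambda>x r. sw A r (\<lambda>y z. sw A a'' (\<lambda>t r. sw A r (\<lambda>q x'. sw A q (\<lambda>u s.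
      sw A s (\<lambda>v w. ?F x y z t u v w x'))))))"
  proof (rule A.sw_cong[OF a'], rule A.sw_cong, assumption)
    fix x r y z assume m: "x \<in> vcarrier A" "r \<in> vcarrier A" "y \<in> vcarrier A" "z \<in> vcarrier A"
    show "sw A a'' (\<lambda>q r. sw A r (\<lambda>v s. sw A q (\<lambda>t u. sw A s (\<lambda>w x'. ?F x y z t u v w x')))) =
      sw A a'' (\<lambda>t r. sw A r (\<lambda>q x'. sw A q (\<lambda>u s. sw A s (\<lambda>v w. ?F x y z t u v w x'))))"
      using assms m by (intro A.coassoc5[where U = T] conjI lin) simp_all
  qed
  \<comment> \<open>The sums over \<open>a'\<close> and \<open>a''\<close> are independent. They are
    interleaved in the order in which the coproduct of a product of the two will produce
    them.\<close>
  also have "\<dots> = sw A a'' (\<lambda>t r0. sw A a' (\<lambda>x r. sw A r (\<lambda>y z. sw A r0 (\<lambda>q x'. sw A q (\<lambda>u s.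
      sw A s (\<lambda>v w. ?F x y z t u v w x'))))))"
    by (rule sw_swap2[symmetric])
  also have "\<dots> = sw A a'' (\<lambda>t r0. sw A r0 (\<lambda>q x'. sw A a' (\<lambda>x r. sw A r (\<lambda>y z. sw A q (\<lambda>u s.
      sw A s (\<lambda>v w. ?F x y z t u v w x'))))))"
    by (rule sw_ext, rule sw_swap2[symmetric])
  also have "\<dots> = sw A a'' (\<lambda>t r0. sw A r0 (\<lambda>q x'. sw A a' (\<lambda>x r. sw A q (\<lambda>u s. sw A r (\<lambda>y z.
      sw A s (\<lambda>v w. ?F x y z t u v w x'))))))"
    by (rule sw_ext, rule sw_ext, rule sw_ext, rule sw_swap)
  also have "\<dots> = sw A a'' (\<lambda>t r0. sw A r0 (\<lambda>q x'.
      mult D (a \<bowtie> b) (?mA a' q \<bowtie> ?mB (Q t x' b') b'')))"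
  proof (intro A.sw_cong a'')
    fix t r0 q x' assume m: "t \<in> vcarrier A" "r0 \<in> vcarrier A" "q \<in> vcarrier A" "x' \<in> vcarrier A"
    let ?W = "?mB (Q t x' b') b''"
    have "mult D (a \<bowtie> b) (?mA a' q \<bowtie> ?W) =
      sw A (?mA a' q) (\<lambda>x r. sw A r (\<lambda>y z. ?mA a y \<bowtie> ?mB (Q x z b) ?W))"
      using assms m by (simp add: mult_D_pure M_def)
    \<comment> \<open>Multiplicativity of the coproduct of A is used twice, once for each of the two
      splittings of \<open>a' q\<close> into three legs.\<close>
    also have "\<dots> = sw A a' (\<lambda>x r. sw A q (\<lambda>u s. sw A (?mA r s) (\<lambda>y z.
        ?mA a y \<bowtie> ?mB (Q (?mA x u) z b) ?W)))"
      using assms m by (intro A.sw_mult[where U = T] bilinear_onI lin) simp_all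
    also have "\<dots> = sw A a' (\<lambda>x r. sw A q (\<lambda>u s. sw A r (\<lambda>y z. sw A s (\<lambda>v w. ?F x y z t u v w x'))))"
      by (rule A.sw_cong[OF a'], rule A.sw_cong[OF m(3)], rule A.sw_mult[where U = T];
          (intro bilinear_onI lin)?) (use assms m in simp_all)
    finally show "sw A a' (\<lambda>x r. sw A q (\<lambda>u s. sw A r (\<lambda>y z. sw A s (\<lambda>v w. ?F x y z t u v w x')))) =
      mult D (a \<bowtie> b) (?mA a' q \<bowtie> ?W)" by simp
  qed
  also have "\<dots> = mult D (a \<bowtie> b) (mult D (a' \<bowtie> b') (a'' \<bowtie> b''))"
  proof -
    have l: "linear_on T T (\<lambda>t. mult D (a \<bowtie> b) t)" using a b by (intro lin) simp
    show ?thesis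
      using assms by (simp add: mult_D_pure[of a' b'] M_def A.linear_sw[OF l] cong: A.sw_cong)
  qed
  finally show ?thesis by simp
qed

end

section \<open>Unit, counit and comultiplication of the double\<close>

context ordinary_dual_pair
begin

declare A.hom_hopf_data_axioms [simp] B.hom_hopf_data_axioms [simp]

lemma mult_D_assoc:
  assumes r: "r \<in> vcarrier T" and s: "s \<in> vcarrier T" and t: "t \<in> vcarrier T"
  shows "mult D r (mult D s t) = mult D (mult D r s) t"
proof (rule T_eqI[OF _ _ r])
  show "linear_on T T (\<lambda>r. mult D r (mult D s t))" "linear_on T T (\<lambda>r. mult D (mult D r s) t)"
    using s t by (intro lin; simp)+
  fix a b assume ab: "a \<in> vcarrier A" "b \<in> vcarrier B"
  show "mult D (a \<bowtie> b) (mult D s t) = mult D (mult D (a \<bowtie> b) s) t"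
  proof (rule T_eqI[OF _ _ s])
    show "linear_on T T (\<lambda>s. mult D (a \<bowtie> b) (mult D s t))"
      "linear_on T T (\<lambda>s. mult D (mult D (a \<bowtie> b) s) t)"
      using ab t by (intro lin; simp)+
    fix a' b' assume ab': "a' \<in> vcarrier A" "b' \<in> vcarrier B"
    show "mult D (a \<bowtie> b) (mult D (a' \<bowtie> b') t) = mult D (mult D (a \<bowtie> b) (a' \<bowtie> b')) t"
    proof (rule T_eqI[OF _ _ t])
      show "linear_on T T (\<lambda>t. mult D (a \<bowtie> b) (mult D (a' \<bowtie> b') t))"
        "linear_on T T (\<lambda>t. mult D (mult D (a \<bowtie> b) (a' \<bowtie> b')) t)"
        using ab ab' by (intro lin; simp)+
    qed (use ab ab' in \<open>simp add: mult_D_assoc_pure\<close>)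
  qed
qed

lemma unit_D_mult: "t \<in> vcarrier T \<Longrightarrow> mult D (unit D) t = t"
  and mult_D_unit: "t \<in> vcarrier T \<Longrightarrow> mult D t (unit D) = t"
proof -
  assume t: "t \<in> vcarrier T"
  show "mult D (unit D) t = t"
    unfolding unit_D by (rule T_eqI[where U = T, OF _ _ t]; (intro lin)?)
      (simp_all add: mult_D_left_A)
  show "mult D t (unit D) = t"
    unfolding unit_D by (rule T_eqI[where U = T, OF _ _ t]; (intro lin)?)
      (simp_all add: mult_D_right_B)
qed

text \<open>The counit turns Q into \<open>(z S' x, b)\<close>. The middle leg of \<open>a'\<close>
  is removed by the counit of A, after which \<open>z\<close> and \<open>x\<close> are adjacent legs
  and \<open>z S' x\<close> collapses.\<close>

lemma counit_D_mult_pure: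
  assumes "a \<in> vcarrier A" "b \<in> vcarrier B" "a' \<in> vcarrier A" "b' \<in> vcarrier B"
  shows "counit D (mult D (a \<bowtie> b) (a' \<bowtie> b')) =
    counit D (a \<bowtie> b) * counit D (a' \<bowtie> b')"
proof -
  let ?e = "counit A a * counit B b'"
  have "counit D (mult D (a \<bowtie> b) (a' \<bowtie> b')) =
    sw A a' (\<lambda>x r. sw A r (\<lambda>y z. counit D (mult A a y \<bowtie> mult B (Q x z b) b')))"
    using assms by (simp add: mult_D_pure M_def A.linear_sw[OF counit_D_linear] cong: A.sw_cong)
  also have "\<dots> = sw A a' (\<lambda>x r. ?e * p (mult A r (antipode_inv A x)) b)"
  proof (rule A.sw_cong[OF assms(3)])
    fix x r assume m: "x \<in> vcarrier A" "r \<in> vcarrier A"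
    have l: "linear_on A scalars (\<lambda>z. ?e * p (mult A z (antipode_inv A x)) b)"
      using assms m by (intro lin) simp_all
    show "sw A r (\<lambda>y z. counit D (mult A a y \<bowtie> mult B (Q x z b) b')) =
      ?e * p (mult A r (antipode_inv A x)) b"
      using A.counit_left'[OF l m(2)] assms m
      by (simp add: counit_D_pure A.counit_mult B.counit_mult counit_Q mult_ac cong: A.sw_cong)
  qed
  also have "\<dots> = counit A a' * (?e * p (unit A) b)"
    using A.antipode_inv_right[of scalars "\<lambda>q. ?e * p q b" a'] assms by (simp add: lin)
  finally show ?thesis using assms by (simp add: counit_D_pure pair_unit_left mult_ac)
qed

text \<open>The right-hand side has six legs of \<open>a'\<close>, three for each factor. The action
  L of \<open>z\<close> on the second leg of \<open>b\<close> can be traded for R on the first,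
  where it meets R of \<open>S' x'\<close> and cancels as \<open>S' x' z\<close>. What is left, R of
  \<open>S' x\<close> on the second leg and L of \<open>z'\<close> on the first, is the coproduct of
  \<open>Q x z' b\<close>. The calculation runs from the left-hand side, so the cancelling pair is
  inserted.\<close>

lemma comult_D_mult_pure:
  assumes a: "a \<in> vcarrier A" and b: "b \<in> vcarrier B" and a': "a' \<in> vcarrier A"
    and b': "b' \<in> vcarrier B"
  shows "comult D (mult D (a \<bowtie> b) (a' \<bowtie> b')) =
    sw D (a \<bowtie> b) (\<lambda>x y. sw D (a' \<bowtie> b') (\<lambda>u v. mult D x u \<otimes> mult D y v))"
proof -
  let ?mA = "mult A" and ?mB = "mult B" and ?S = "antipode_inv A"
  let ?G = "\<lambda>a1 a2 d1 d2 x y y' z'. \<lambda>u v.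
    (?mA a1 y \<bowtie> ?mB (R (?S x) v) d2) \<otimes> (?mA a2 y' \<bowtie> ?mB (L z' u) d1)"
  \<comment> \<open>The slot \<open>w\<close> holds the element acting by R on the first leg of
    \<open>b\<close>: the unit before the insertion and \<open>S' x' z\<close> after it.\<close>
  let ?K = "\<lambda>a1 a2 d1 d2 x y w y' z'. sw B b (\<lambda>u v. ?G a1 a2 d1 d2 x y y' z' (R w u) v)"
  have "comult D (mult D (a \<bowtie> b) (a' \<bowtie> b')) =
    sw A a' (\<lambda>x r. sw A r (\<lambda>y z. C (?mA a y) (?mB (Q x z b) b')))"
    using assms
    by (simp add: mult_D_pure M_def A.linear_sw[OF comult_D_linear] comult_D_pure cong: A.sw_cong)
  also have "\<dots> = sw A a' (\<lambda>x r. sw A r (\<lambda>y z. sw A a (\<lambda>a1 a2. sw A y (\<lambda>y1 y2.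
      sw B b' (\<lambda>d1 d2. ?K a1 a2 d1 d2 x y1 (unit A) y2 z)))))"
  proof (intro A.sw_cong a')
    fix x r y z assume m: "x \<in> vcarrier A" "r \<in> vcarrier A" "y \<in> vcarrier A" "z \<in> vcarrier A"
    have "C (?mA a y) (?mB (Q x z b) b') = sw A a (\<lambda>a1 a2. sw A y (\<lambda>y1 y2.
      sw B (?mB (Q x z b) b') (\<lambda>f1 f2. (?mA a1 y1 \<bowtie> f2) \<otimes> (?mA a2 y2 \<bowtie> f1))))"
      unfolding C_def using assms m
      by (intro A.sw_mult[where U = "tensor T T"] bilinear_onI lin) simp_all
    also have "\<dots> = sw A a (\<lambda>a1 a2. sw A y (\<lambda>y1 y2.
      sw B b' (\<lambda>d1 d2. ?K a1 a2 d1 d2 x y1 (unit A) y2 z)))"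
    proof (rule A.sw_cong[OF a], rule A.sw_cong[OF m(3)])
      fix a1 a2 y1 y2
      assume m': "a1 \<in> vcarrier A" "a2 \<in> vcarrier A" "y1 \<in> vcarrier A" "y2 \<in> vcarrier A"
      have "sw B (?mB (Q x z b) b') (\<lambda>f1 f2. (?mA a1 y1 \<bowtie> f2) \<otimes> (?mA a2 y2 \<bowtie> f1)) =
        sw B (Q x z b) (\<lambda>g1 g2. sw B b' (\<lambda>d1 d2.
          (?mA a1 y1 \<bowtie> ?mB g2 d2) \<otimes> (?mA a2 y2 \<bowtie> ?mB g1 d1)))"
        using assms m m' by (intro B.sw_mult[where U = "tensor T T"] bilinear_onI lin) simp_all
      also have "\<dots> = sw B b (\<lambda>u v. sw B b' (\<lambda>d1 d2. ?G a1 a2 d1 d2 x y1 y2 z u v))"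
        using assms m m' by (intro sw_Q[where U = "tensor T T"] bilinear_onI lin) simp_all
      \<comment> \<open>A trivial action of the unit is inserted, to be expanded by
        \<open>coassoc_cancel\<close>.\<close>
      also have "\<dots> = sw B b (\<lambda>u v. sw B b' (\<lambda>d1 d2. ?G a1 a2 d1 d2 x y1 y2 z (R (unit A) u) v))"
        by (rule B.sw_cong[OF b]) simp
      also have "\<dots> = sw B b' (\<lambda>d1 d2. ?K a1 a2 d1 d2 x y1 (unit A) y2 z)"
        by (rule sw_swap)
      finally show "sw B (?mB (Q x z b) b')
          (\<lambda>f1 f2. (?mA a1 y1 \<bowtie> f2) \<otimes> (?mA a2 y2 \<bowtie> f1)) =
        sw B b' (\<lambda>d1 d2. ?K a1 a2 d1 d2 x y1 (unit A) y2 z)" .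
    qed
    finally show "C (?mA a y) (?mB (Q x z b) b') = sw A a (\<lambda>a1 a2. sw A y (\<lambda>y1 y2.
      sw B b' (\<lambda>d1 d2. ?K a1 a2 d1 d2 x y1 (unit A) y2 z)))" .
  qed
  also have "\<dots> = sw A a (\<lambda>a1 a2. sw A a' (\<lambda>x r. sw A r (\<lambda>y z. sw A y (\<lambda>y1 y2.
      sw B b' (\<lambda>d1 d2. ?K a1 a2 d1 d2 x y1 (unit A) y2 z)))))"
    by (rule sw_swap2[symmetric])
  also have "\<dots> = sw A a (\<lambda>a1 a2. sw A a' (\<lambda>x r. sw A r (\<lambda>y z. sw B b' (\<lambda>d1 d2. sw A y (\<lambda>y1 y2.
      ?K a1 a2 d1 d2 x y1 (unit A) y2 z)))))"
    by (rule sw_ext, rule sw_ext, rule sw_ext, rule sw_swap)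
  also have "\<dots> = sw A a (\<lambda>a1 a2. sw B b' (\<lambda>d1 d2. sw A a' (\<lambda>x r. sw A r (\<lambda>y z. sw A y (\<lambda>y1 y2.
      ?K a1 a2 d1 d2 x y1 (unit A) y2 z)))))"
    by (rule sw_ext, rule sw_swap2[symmetric])
  \<comment> \<open>\<open>coassoc_cancel\<close> backwards: the unit becomes
    \<open>S' x' z\<close>, and the legs of \<open>a'\<close> group into x, y, z below
    \<open>c1\<close> and x', y', z' below \<open>c2\<close>.\<close>
  also have "\<dots> = sw A a (\<lambda>a1 a2. sw B b' (\<lambda>d1 d2. sw A a' (\<lambda>c1 c2. sw A c1 (\<lambda>x r. sw A r (\<lambda>y z.
      sw A c2 (\<lambda>x' r'. sw A r' (\<lambda>y' z'. ?K a1 a2 d1 d2 x y (?mA (?S x') z) y' z')))))))"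
  proof (rule A.sw_cong[OF a], rule B.sw_cong[OF b'])
    fix a1 a2 d1 d2
    assume m: "a1 \<in> vcarrier A" "a2 \<in> vcarrier A" "d1 \<in> vcarrier B" "d2 \<in> vcarrier B"
    show "sw A a' (\<lambda>x r. sw A r (\<lambda>y z. sw A y (\<lambda>y1 y2. ?K a1 a2 d1 d2 x y1 (unit A) y2 z))) =
      sw A a' (\<lambda>c1 c2. sw A c1 (\<lambda>x r. sw A r (\<lambda>y z.
        sw A c2 (\<lambda>x' r'. sw A r' (\<lambda>y' z'. ?K a1 a2 d1 d2 x y (?mA (?S x') z) y' z')))))"
      using m a' b
      by (intro A.coassoc_cancel[where U = "tensor T T" and f = "?K a1 a2 d1 d2", symmetric]
          conjI lin) simp_all
  qed
  also have "\<dots> = sw A a (\<lambda>a1 a2. sw B b' (\<lambda>d1 d2. sw A a' (\<lambda>c1 c2. sw B b (\<lambda>b1 b2.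
      mult D (a1 \<bowtie> b2) (c1 \<bowtie> d2) \<otimes> mult D (a2 \<bowtie> b1) (c2 \<bowtie> d1)))))"
  proof (rule A.sw_cong[OF a], rule B.sw_cong[OF b'], rule A.sw_cong[OF a'])
    fix a1 a2 d1 d2 c1 c2
    assume m: "a1 \<in> vcarrier A" "a2 \<in> vcarrier A" "d1 \<in> vcarrier B" "d2 \<in> vcarrier B"
      "c1 \<in> vcarrier A" "c2 \<in> vcarrier A"
    let ?g = "\<lambda>b1 b2 x y z x' y' z'.
      (?mA a1 y \<bowtie> ?mB (Q x z b2) d2) \<otimes> (?mA a2 y' \<bowtie> ?mB (Q x' z' b1) d1)"
    have "sw A c1 (\<lambda>x r. sw A r (\<lambda>y z. sw A c2 (\<lambda>x' r'. sw A r' (\<lambda>y' z'.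
        ?K a1 a2 d1 d2 x y (?mA (?S x') z) y' z')))) =
      sw A c1 (\<lambda>x r. sw A r (\<lambda>y z. sw A c2 (\<lambda>x' r'. sw A r' (\<lambda>y' z'.
        sw B b (\<lambda>b1 b2. ?g b1 b2 x y z x' y' z')))))"
    proof (intro A.sw_cong m(5,6))
      fix x r y z x' r' y' z'
      assume n: "x \<in> vcarrier A" "r \<in> vcarrier A" "y \<in> vcarrier A" "z \<in> vcarrier A"
        "x' \<in> vcarrier A" "r' \<in> vcarrier A" "y' \<in> vcarrier A" "z' \<in> vcarrier A"
      let ?h = "\<lambda>u v. (?mA a1 y \<bowtie> ?mB (R (?S x) v) d2) \<otimes> (?mA a2 y' \<bowtie> ?mB (Q x' z' u) d1)"
      have "?K a1 a2 d1 d2 x y (?mA (?S x') z) y' z' = sw B b (\<lambda>u v. ?h (R z u) v)"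
        using n by (intro B.sw_cong b) (simp add: Q_def R_R)
      \<comment> \<open>The trade of R on the first leg for L on the second. Since L and R commute,
        L of \<open>z\<close> and R of \<open>S' x\<close> on the second leg combine to
        \<open>Q x z\<close>.\<close>
      also have "\<dots> = sw B b (\<lambda>u v. ?h u (L z v))"
        using m n b by (intro sw_L_right[where U = "tensor T T", symmetric] bilinear_onI lin) simp_all
      also have "\<dots> = sw B b (\<lambda>b1 b2. ?g b1 b2 x y z x' y' z')"
        using n by (intro B.sw_cong b) (simp add: Q_def L_R)
      finally show "?K a1 a2 d1 d2 x y (?mA (?S x') z) y' z' =
        sw B b (\<lambda>b1 b2. ?g b1 b2 x y z x' y' z')" .
    qed
    also have "\<dots> = sw A c1 (\<lambda>x r. sw A r (\<lambda>y z. sw B b (\<lambda>b1 b2. sw A c2 (\<lambda>x' r'. sw A r' (\<lambda>y' z'.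
        ?g b1 b2 x y z x' y' z')))))"
      by (rule sw_ext, rule sw_ext, rule sw_swap2[symmetric])
    also have "\<dots> = sw B b (\<lambda>b1 b2. sw A c1 (\<lambda>x r. sw A r (\<lambda>y z. sw A c2 (\<lambda>x' r'. sw A r' (\<lambda>y' z'.
        ?g b1 b2 x y z x' y' z')))))"
      by (rule sw_swap2[symmetric])
    also have "\<dots> = sw B b (\<lambda>b1 b2.
        mult D (a1 \<bowtie> b2) (c1 \<bowtie> d2) \<otimes> mult D (a2 \<bowtie> b1) (c2 \<bowtie> d1))"
    proof (rule B.sw_cong[OF b])
      fix b1 b2 assume n: "b1 \<in> vcarrier B" "b2 \<in> vcarrier B"
      have l1: "linear_on T (tensor T T) (\<lambda>t. t \<otimes> M a2 b1 c2 d1)"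
        using m n by (intro lin) simp
      have l2: "linear_on T (tensor T T) (\<lambda>t. s \<otimes> t)" if "s \<in> vcarrier T" for s
        using that by (intro lin)
      have "M a1 b2 c1 d2 \<otimes> M a2 b1 c2 d1 = sw A c1 (\<lambda>x r. sw A r (\<lambda>y z.
          (?mA a1 y \<bowtie> ?mB (Q x z b2) d2) \<otimes> M a2 b1 c2 d1))"
        unfolding M_def[of a1] using m n by (simp add: A.linear_sw[OF l1] cong: A.sw_cong)
      also have "\<dots> = sw A c1 (\<lambda>x r. sw A r (\<lambda>y z. sw A c2 (\<lambda>x' r'. sw A r' (\<lambda>y' z'.
          ?g b1 b2 x y z x' y' z'))))"
        unfolding M_def using m n by (simp add: A.linear_sw[OF l2] cong: A.sw_cong)
      finally show "sw A c1 (\<lambda>x r. sw A r (\<lambda>y z. sw A c2 (\<lambda>x' r'. sw A r' (\<lambda>y' z'.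
          ?g b1 b2 x y z x' y' z')))) =
        mult D (a1 \<bowtie> b2) (c1 \<bowtie> d2) \<otimes> mult D (a2 \<bowtie> b1) (c2 \<bowtie> d1)"
        using m n by (simp add: mult_D_pure)
    qed
    finally show "sw A c1 (\<lambda>x r. sw A r (\<lambda>y z. sw A c2 (\<lambda>x' r'. sw A r' (\<lambda>y' z'.
        ?K a1 a2 d1 d2 x y (?mA (?S x') z) y' z')))) =
      sw B b (\<lambda>b1 b2. mult D (a1 \<bowtie> b2) (c1 \<bowtie> d2) \<otimes> mult D (a2 \<bowtie> b1) (c2 \<bowtie> d1))" .
  qed
  also have "\<dots> = sw A a (\<lambda>a1 a2. sw B b (\<lambda>b1 b2. sw A a' (\<lambda>c1 c2. sw B b' (\<lambda>d1 d2.
      mult D (a1 \<bowtie> b2) (c1 \<bowtie> d2) \<otimes> mult D (a2 \<bowtie> b1) (c2 \<bowtie> d1)))))"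
    by (rule sw_ext, subst sw_swap, subst (2) sw_swap, subst sw_swap) (rule refl)
  also have "\<dots> = sw D (a \<bowtie> b) (\<lambda>x y. sw D (a' \<bowtie> b') (\<lambda>u v. mult D x u \<otimes> mult D y v))"
  proof -
    have "sw D (a' \<bowtie> b') (\<lambda>u v. mult D x u \<otimes> mult D y v) =
      sw A a' (\<lambda>c1 c2. sw B b' (\<lambda>d1 d2.
        mult D x (c1 \<bowtie> d2) \<otimes> mult D y (c2 \<bowtie> d1)))"
      if "x \<in> vcarrier T" "y \<in> vcarrier T" for x y
      using a' b' that by (intro sw_D_pure[where U = "tensor T T"] bilinear_onI lin) simp_all
    moreover have "bilinear_on T T (tensor T T)
      (\<lambda>x y. sw D (a' \<bowtie> b') (\<lambda>u v. mult D x u \<otimes> mult D y v))"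
      using a' b' by (intro bilinear_onI lin) simp_all
    ultimately show ?thesis
      using a b by (simp add: sw_D_pure[where U = "tensor T T"] cong: hom_hopf_data.sw_cong)
  qed
  finally show ?thesis .
qed

text \<open>The legs of \<open>b\<close> occur in reverse order, so A and B are reassociated in
  opposite directions.\<close>

lemma coassoc_D_pure:
  assumes a: "a \<in> vcarrier A" and b: "b \<in> vcarrier B"
  shows "sw D (a \<bowtie> b) (\<lambda>x y. sw D x (\<lambda>u v. u \<otimes>\<^bsub>T,tensor T T\<^esub> (v \<otimes> y))) =
    sw D (a \<bowtie> b) (\<lambda>x y. sw D y (\<lambda>u v. x \<otimes>\<^bsub>T,tensor T T\<^esub> (u \<otimes> v)))"
proof -
  let ?F = "\<lambda>x y z u v w. (x \<bowtie> w) \<otimes>\<^bsub>T,tensor T T\<^esub> ((y \<bowtie> v) \<otimes> (z \<bowtie> u))"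
  have 1: "sw D (a \<bowtie> b) (\<lambda>x y. sw D x (\<lambda>u v. u \<otimes>\<^bsub>T,tensor T T\<^esub> (v \<otimes> y))) =
    sw A a (\<lambda>q z. sw B b (\<lambda>u r. sw A q (\<lambda>x y. sw B r (\<lambda>v w. ?F x y z u v w))))"
  proof -
    have "sw D (q \<bowtie> r) (\<lambda>u v. u \<otimes>\<^bsub>T,tensor T T\<^esub> (v \<otimes> t)) =
      sw A q (\<lambda>x y. sw B r (\<lambda>v w. (x \<bowtie> w) \<otimes>\<^bsub>T,tensor T T\<^esub> ((y \<bowtie> v) \<otimes> t)))"
      if "q \<in> vcarrier A" "r \<in> vcarrier B" "t \<in> vcarrier T" for q r t
      using that by (intro sw_D_pure[where U = "tensor T (tensor T T)"] bilinear_onI lin) simp_all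
    moreover have "bilinear_on T T (tensor T (tensor T T))
      (\<lambda>x y. sw D x (\<lambda>u v. u \<otimes>\<^bsub>T,tensor T T\<^esub> (v \<otimes> y)))"
      by (intro bilinear_onI lin) simp_all
    ultimately show ?thesis
      using a b by (simp add: sw_D_pure[where U = "tensor T (tensor T T)"] cong: hom_hopf_data.sw_cong)
  qed
  have 2: "sw D (a \<bowtie> b) (\<lambda>x y. sw D y (\<lambda>u v. x \<otimes>\<^bsub>T,tensor T T\<^esub> (u \<otimes> v))) =
    sw A a (\<lambda>x q. sw B b (\<lambda>r w. sw A q (\<lambda>y z. sw B r (\<lambda>u v. ?F x y z u v w))))"
  proof -
    have "sw D (q \<bowtie> r) (\<lambda>u v. t \<otimes>\<^bsub>T,tensor T T\<^esub> (u \<otimes> v)) =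
      sw A q (\<lambda>y z. sw B r (\<lambda>u v. t \<otimes>\<^bsub>T,tensor T T\<^esub> ((y \<bowtie> v) \<otimes> (z \<bowtie> u))))"
      if "q \<in> vcarrier A" "r \<in> vcarrier B" "t \<in> vcarrier T" for q r t
      using that by (intro sw_D_pure[where U = "tensor T (tensor T T)"] bilinear_onI lin) simp_all
    moreover have "bilinear_on T T (tensor T (tensor T T))
      (\<lambda>x y. sw D y (\<lambda>u v. x \<otimes>\<^bsub>T,tensor T T\<^esub> (u \<otimes> v)))"
      by (intro bilinear_onI lin) simp_all
    ultimately show ?thesis
      using a b by (simp add: sw_D_pure[where U = "tensor T (tensor T T)"] cong: hom_hopf_data.sw_cong)
  qed
  have "sw A a (\<lambda>q z. sw B b (\<lambda>u r. sw A q (\<lambda>x y. sw B r (\<lambda>v w. ?F x y z u v w)))) =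
    sw A a (\<lambda>q z. sw A q (\<lambda>x y. sw B b (\<lambda>u r. sw B r (\<lambda>v w. ?F x y z u v w))))"
    by (rule sw_ext, rule sw_swap)
  also have "\<dots> = sw A a (\<lambda>x q. sw A q (\<lambda>y z. sw B b (\<lambda>u r. sw B r (\<lambda>v w. ?F x y z u v w))))"
    using a b by (intro A.coassoc[where U = "tensor T (tensor T T)"] lin) simp_all
  also have "\<dots> = sw A a (\<lambda>x q. sw A q (\<lambda>y z. sw B b (\<lambda>r w. sw B r (\<lambda>u v. ?F x y z u v w))))"
    by (rule A.sw_cong[OF a], rule A.sw_cong, assumption,
        rule B.coassoc[where U = "tensor T (tensor T T)", symmetric]; (intro lin)?)
      (simp_all add: b)
  also have "\<dots> = sw A a (\<lambda>x q. sw B b (\<lambda>r w. sw A q (\<lambda>y z. sw B r (\<lambda>u v. ?F x y z u v w))))"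
    by (rule sw_ext, rule sw_swap)
  finally show ?thesis unfolding 1 2 .
qed

lemma counit_D_left_pure:
  assumes "a \<in> vcarrier A" "b \<in> vcarrier B"
  shows "sw D (a \<bowtie> b) (\<lambda>x y. tscale (counit D x) y) = a \<bowtie> b"
proof -
  have "bilinear_on T T T (\<lambda>x y. tscale (counit D x) y)"
    by (intro bilinear_onI lin linear_on_compose[OF counit_D_linear]) simp_all
  then have "sw D (a \<bowtie> b) (\<lambda>x y. tscale (counit D x) y) =
    sw A a (\<lambda>a1 a2. sw B b (\<lambda>b1 b2. tscale (counit B b2) (tscale (counit A a1) (a2 \<bowtie> b1))))"
    using assms
    by (simp add: sw_D_pure[where U = T] counit_D_pure tensor_space.scale_scale mult.commute
        cong: hom_hopf_data.sw_cong)
  also have "\<dots> = sw A a (\<lambda>a1 a2. tscale (counit A a1) (a2 \<bowtie> b))"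
    using assms B.counit_right'[of T "\<lambda>q. tscale _ (_ \<bowtie> q)" b]
    by (intro A.sw_cong) (simp_all add: lin)
  also have "\<dots> = a \<bowtie> b"
    using assms A.counit_left'[of T "\<lambda>q. q \<bowtie> b" a] by (simp add: lin)
  finally show ?thesis .
qed

lemma counit_D_right_pure:
  assumes "a \<in> vcarrier A" "b \<in> vcarrier B"
  shows "sw D (a \<bowtie> b) (\<lambda>x y. tscale (counit D y) x) = a \<bowtie> b"
proof -
  have "bilinear_on T T T (\<lambda>x y. tscale (counit D y) x)"
    by (intro bilinear_onI lin linear_on_compose[OF counit_D_linear]) simp_all
  then have "sw D (a \<bowtie> b) (\<lambda>x y. tscale (counit D y) x) =
    sw A a (\<lambda>a1 a2. sw B b (\<lambda>b1 b2. tscale (counit B b1) (tscale (counit A a2) (a1 \<bowtie> b2))))"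
    using assms
    by (simp add: sw_D_pure[where U = T] counit_D_pure tensor_space.scale_scale mult.commute
        cong: hom_hopf_data.sw_cong)
  also have "\<dots> = sw A a (\<lambda>a1 a2. tscale (counit A a2) (a1 \<bowtie> b))"
    using assms B.counit_left'[of T "\<lambda>q. tscale _ (_ \<bowtie> q)" b]
    by (intro A.sw_cong) (simp_all add: lin)
  also have "\<dots> = a \<bowtie> b"
    using assms A.counit_right'[of T "\<lambda>q. q \<bowtie> b" a] by (simp add: lin)
  finally show ?thesis .
qed

section \<open>The antipode axiom and the ordinary double\<close>

lemma antipode_D_mem [simp]: "t \<in> vcarrier T \<Longrightarrow> antipode D t \<in> vcarrier T"
  by (rule linear_on_mem[OF antipode_D_linear])

text \<open>In \<open>(1 \<bowtie> S' b2)(S a1 \<bowtie> 1)(a2 \<bowtie> b1)\<close> the last two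
  factors multiply inside A first. Once \<open>S a1 a2\<close> is a scalar, \<open>S' b2\<close> and
  \<open>b1\<close> become neighbours in B.\<close>

lemma antipode_D_left_pure:
  assumes a: "a \<in> vcarrier A" and b: "b \<in> vcarrier B"
  shows "sw D (a \<bowtie> b) (\<lambda>x y. mult D (antipode D x) y) =
    tscale (counit A a * counit B b) (unit A \<bowtie> unit B)"
proof -
  have "bilinear_on T T T (\<lambda>x y. mult D (antipode D x) y)"
    by (intro bilinear_onI lin linear_on_compose[OF antipode_D_linear]) simp_all
  then have "sw D (a \<bowtie> b) (\<lambda>x y. mult D (antipode D x) y) =
    sw A a (\<lambda>a1 a2. sw B b (\<lambda>b1 b2. mult D (unit A \<bowtie> antipode_inv B b2)
      (mult A (antipode A a1) a2 \<bowtie> b1)))"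
    using assms
    by (simp add: sw_D_pure[where U = T] antipode_D_pure mult_D_assoc[symmetric] mult_D_left_A
        cong: hom_hopf_data.sw_cong)
  also have "\<dots> = tscale (counit A a) (sw B b (\<lambda>b1 b2. mult D (unit A \<bowtie> antipode_inv B b2)
      (unit A \<bowtie> b1)))"
  proof -
    have "linear_on A T (\<lambda>q. sw B b (\<lambda>b1 b2. mult D (unit A \<bowtie> antipode_inv B b2) (q \<bowtie> b1)))"
      using b by (intro lin) simp_all
    from A.antipode_left[OF this a] show ?thesis by simp
  qed
  also have "\<dots> = tscale (counit A a) (sw B b (\<lambda>b1 b2. unit A \<bowtie> mult B (antipode_inv B b2) b1))"
    using b by (simp add: mult_D_right_B cong: B.sw_cong)
  also have "\<dots> = tscale (counit A a * counit B b) (unit A \<bowtie> unit B)"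
  proof -
    have "linear_on B T (\<lambda>q. unit A \<bowtie> q)" by (intro lin) simp
    from B.antipode_inv_left[OF this b] show ?thesis by (simp add: tensor_space.scale_scale)
  qed
  finally show ?thesis .
qed

text \<open>Here the cancellation starts in B: the neighbours in
  \<open>(a1 \<bowtie> b2)(1 \<bowtie> S' b1)(S a2 \<bowtie> 1)\<close> are \<open>b2\<close> and
  \<open>S' b1\<close>, and \<open>a1 S a2\<close> follows.\<close>

lemma antipode_D_right_pure:
  assumes a: "a \<in> vcarrier A" and b: "b \<in> vcarrier B"
  shows "sw D (a \<bowtie> b) (\<lambda>x y. mult D x (antipode D y)) =
    tscale (counit A a * counit B b) (unit A \<bowtie> unit B)"
proof -
  have "bilinear_on T T T (\<lambda>x y. mult D x (antipode D y))"
    by (intro bilinear_onI lin linear_on_compose[OF antipode_D_linear]) simp_all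
  then have "sw D (a \<bowtie> b) (\<lambda>x y. mult D x (antipode D y)) =
    sw A a (\<lambda>a1 a2. sw B b (\<lambda>b1 b2. mult D (a1 \<bowtie> mult B b2 (antipode_inv B b1))
      (antipode A a2 \<bowtie> unit B)))"
    using assms
    by (simp add: sw_D_pure[where U = T] antipode_D_pure mult_D_assoc mult_D_right_B
        cong: hom_hopf_data.sw_cong)
  also have "\<dots> = sw A a (\<lambda>a1 a2. tscale (counit B b) (mult D (a1 \<bowtie> unit B)
      (antipode A a2 \<bowtie> unit B)))"
  proof (rule A.sw_cong[OF a])
    fix a1 a2 assume m: "a1 \<in> vcarrier A" "a2 \<in> vcarrier A"
    then have "linear_on B T (\<lambda>q. mult D (a1 \<bowtie> q) (antipode A a2 \<bowtie> unit B))"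
      by (intro lin) simp_all
    from B.antipode_inv_right[OF this b]
    show "sw B b (\<lambda>b1 b2. mult D (a1 \<bowtie> mult B b2 (antipode_inv B b1)) (antipode A a2 \<bowtie> unit B)) =
      tscale (counit B b) (mult D (a1 \<bowtie> unit B) (antipode A a2 \<bowtie> unit B))" by simp
  qed
  also have "\<dots> = sw A a (\<lambda>a1 a2. tscale (counit B b) (mult A a1 (antipode A a2) \<bowtie> unit B))"
    using a by (simp add: mult_D_left_A cong: A.sw_cong)
  also have "\<dots> = tscale (counit A a * counit B b) (unit A \<bowtie> unit B)"
  proof -
    have "linear_on A T (\<lambda>q. tscale (counit B b) (q \<bowtie> unit B))" by (intro lin) simp
    from A.antipode_right[OF this a] show ?thesis by (simp add: tensor_space.scale_scale)
  qed
  finally show ?thesis .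
qed

text \<open>The structure map is the identity on the carrier, so the Hom axioms are the ordinary
  ones. Each is multilinear and is therefore tested on pure tensors.\<close>

lemma D_hom_hopf: "hom_hopf D"
proof (intro hom_hopf.intro hom_hopf_axioms.intro D_data, unfold D_space vscale_tensor)
  note D_lin = lin linear_on_compose[OF counit_D_linear] linear_on_compose[OF antipode_D_linear]
  have unit_mem: "unit D \<in> vcarrier T" by (simp add: unit_D)
  show "alpha D (unit D) = unit D" by (simp add: alpha_D unit_mem)
  show "comult D (unit D) = unit D \<otimes> unit D"
  proof -
    have "bilinear_on A A (tensor T T) (\<lambda>a1 a2. sw B (unit B) (\<lambda>b1 b2. (a1 \<bowtie> b2) \<otimes> (a2 \<bowtie> b1)))"
      "bilinear_on B B (tensor T T) (\<lambda>b1 b2. (unit A \<bowtie> b2) \<otimes> (unit A \<bowtie> b1))"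
      by (intro bilinear_onI lin; simp)+
    then show ?thesis
      by (simp add: unit_D comult_D_pure C_def A.sw_unit[where U = "tensor T T"]
          B.sw_unit[where U = "tensor T T"])
  qed
  show "counit D (unit D) = 1" by (simp add: unit_D counit_D_pure)
  fix c assume c: "c \<in> vcarrier T"
  show "mult D (unit D) c = alpha D c" "mult D c (unit D) = alpha D c"
    using c by (simp_all add: unit_D_mult mult_D_unit alpha_D)
  show "counit D (alpha D c) = counit D c" "antipode D (alpha D c) = alpha D (antipode D c)"
    using c by (simp_all add: alpha_D)
  have "sw D c (\<lambda>x y. alpha D x \<otimes> alpha D y) = sw D c (\<lambda>x y. x \<otimes> y)"
    using c by (intro sw_D_cong) (simp_all add: alpha_D)
  then show "sw D c (\<lambda>x y. alpha D x \<otimes> alpha D y) = comult D (alpha D c)"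
    using hom_hopf_data.sw_pure_self[OF D_data, unfolded D_space, OF c] c by (simp add: alpha_D)
  show "sw D c (\<lambda>x y. tscale (counit D x) y) = alpha D c"
    unfolding alpha_D[OF c]
    by (rule T_eqI[where U = T, OF _ _ c]; (intro D_lin)?) (simp_all add: counit_D_left_pure)
  show "sw D c (\<lambda>x y. tscale (counit D y) x) = alpha D c"
    unfolding alpha_D[OF c]
    by (rule T_eqI[where U = T, OF _ _ c]; (intro D_lin)?) (simp_all add: counit_D_right_pure)
  have "sw D c (\<lambda>x y. sw D x (\<lambda>u v. u \<otimes>\<^bsub>T,tensor T T\<^esub> (v \<otimes> y))) =
    sw D c (\<lambda>x y. sw D y (\<lambda>u v. x \<otimes>\<^bsub>T,tensor T T\<^esub> (u \<otimes> v)))"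
    by (rule T_eqI[where U = "tensor T (tensor T T)", OF _ _ c]; (intro lin)?)
      (simp_all add: coassoc_D_pure)
  then show "sw D c (\<lambda>x y. sw D x (\<lambda>u v. u \<otimes>\<^bsub>T,tensor T T\<^esub> (v \<otimes> alpha D y))) =
    sw D c (\<lambda>x y. sw D y (\<lambda>u v. alpha D x \<otimes>\<^bsub>T,tensor T T\<^esub> (u \<otimes> v)))"
    using c by (simp add: alpha_D cong: sw_D_cong)
  have *: "linear_on T T (\<lambda>c. tscale (counit D c) (unit D))"
    by (intro D_lin) (simp add: unit_D)
  show "sw D c (\<lambda>x y. mult D (antipode D x) y) = tscale (counit D c) (unit D)"
    by (rule T_eqI[where U = T, OF _ * c]; (intro D_lin)?)
      (simp_all add: antipode_D_left_pure counit_D_pure unit_D)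
  show "sw D c (\<lambda>x y. mult D x (antipode D y)) = tscale (counit D c) (unit D)"
    by (rule T_eqI[where U = T, OF _ * c]; (intro D_lin)?)
      (simp_all add: antipode_D_right_pure counit_D_pure unit_D)
next
  fix a b assume a: "a \<in> vcarrier T" and b: "b \<in> vcarrier T"
  show "alpha D (mult D a b) = mult D (alpha D a) (alpha D b)"
    using a b by (simp add: alpha_D)
  show "comult D (mult D a b) = sw D a (\<lambda>x y. sw D b (\<lambda>u v. mult D x u \<otimes> mult D y v))"
    by (rule tensor_bilinear_eqI[where U = "tensor T T", OF _ _ _ _ a b];
        (intro conjI lin linear_on_compose[OF comult_D_linear])?)
      (simp_all add: a b comult_D_mult_pure)
  show "counit D (mult D a b) = counit D a * counit D b"
    by (rule tensor_bilinear_eqI[where U = scalars, OF _ _ _ _ a b];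
        (intro conjI lin linear_on_compose[OF counit_D_linear] counit_D_linear)?)
      (simp_all add: a b counit_D_mult_pure)
next
  fix a b c assume "a \<in> vcarrier T" "b \<in> vcarrier T" "c \<in> vcarrier T"
  then show "mult D (alpha D a) (mult D b c) = mult D (mult D a b) (alpha D c)"
    by (simp add: alpha_D mult_D_assoc)
qed

end

text \<open>The double is natural in the data of a pairing. Invariance of \<open>p\<close> makes L,
  R and hence Q equivariant, and compatibility with the product follows leg by leg.\<close>

lemma (in ordinary_dual_pair) double_endo:
  assumes phi: "hopf_endo A \<phi>" and psi: "hopf_endo B \<psi>"
    and pair: "\<And>a b. a \<in> vcarrier A \<Longrightarrow> b \<in> vcarrier B \<Longrightarrow> p (\<phi> a) (\<psi> b) = p a b"
  shows "hopf_endo D (tmap A B A B \<phi> \<psi>)"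
proof -
  let ?\<beta> = "tmap A B A B \<phi> \<psi>"
  note \<phi> = hopf_endoD[OF phi] and \<psi> = hopf_endoD[OF psi]
  note [simp] = linear_on_mem[OF \<phi>(1)] linear_on_mem[OF \<psi>(1)]
  note elin = linear_on_compose[OF \<phi>(1)] linear_on_compose[OF \<psi>(1)]
  have bilin: "bilinear_on A B T (\<lambda>a b. \<phi> a \<bowtie> \<psi> b)"
    by (intro bilinear_onI lin elin) simp_all
  have \<beta>: "linear_on T T ?\<beta>"
    unfolding tmap_def by (intro linear_on_tlift bilin) simp
  note \<beta>lin = linear_on_compose[OF \<beta>]
  have [simp]: "?\<beta> t \<in> vcarrier T" if "t \<in> vcarrier T" for t
    by (rule linear_on_mem[OF \<beta> that])
  have \<beta>_pure [simp]: "?\<beta> (a \<bowtie> b) = \<phi> a \<bowtie> \<psi> b" if "a \<in> vcarrier A" "b \<in> vcarrier B" for a b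
    unfolding tmap_def using that by (intro tlift_pure bilin) simp_all
  have S: "antipode_inv A (\<phi> a) = \<phi> (antipode_inv A a)" if "a \<in> vcarrier A" for a
    using that by (intro A.antipode_inv_eqI) (simp_all flip: \<phi>(7))
  have S': "antipode_inv B (\<psi> b) = \<psi> (antipode_inv B b)" if "b \<in> vcarrier B" for b
    using that by (intro B.antipode_inv_eqI) (simp_all flip: \<psi>(7))
  have L: "L (\<phi> a) (\<psi> b) = \<psi> (L a b)" and R: "R (\<phi> a) (\<psi> b) = \<psi> (R a b)"
    if a: "a \<in> vcarrier A" and b: "b \<in> vcarrier B" for a b
  proof -
    have "L (\<phi> a) (\<psi> b) = sw B b (\<lambda>u v. vscale B (p (\<phi> a) (\<psi> u)) (\<psi> v))"
      unfolding L_def using a b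
      by (intro B.sw_hopf_endo[OF psi, where U = B] bilinear_onI lin) simp_all
    then show "L (\<phi> a) (\<psi> b) = \<psi> (L a b)"
      unfolding L_def using a b
      by (simp add: pair B.linear_sw[OF \<psi>(1) _ B.vs] linear_on_scale[OF \<psi>(1)] cong: B.sw_cong)
    have "R (\<phi> a) (\<psi> b) = sw B b (\<lambda>u v. vscale B (p (\<phi> a) (\<psi> v)) (\<psi> u))"
      unfolding R_def using a b
      by (intro B.sw_hopf_endo[OF psi, where U = B] bilinear_onI lin) simp_all
    then show "R (\<phi> a) (\<psi> b) = \<psi> (R a b)"
      unfolding R_def using a b
      by (simp add: pair B.linear_sw[OF \<psi>(1) _ B.vs] linear_on_scale[OF \<psi>(1)] cong: B.sw_cong)
  qed
  have Q: "Q (\<phi> x) (\<phi> z) (\<psi> b) = \<psi> (Q x z b)"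
    if "x \<in> vcarrier A" "z \<in> vcarrier A" "b \<in> vcarrier B" for x z b
    using that by (simp add: Q_def S L R)
  have mult_pure: "?\<beta> (mult D (a \<bowtie> b) (a' \<bowtie> b')) = mult D (?\<beta> (a \<bowtie> b)) (?\<beta> (a' \<bowtie> b'))"
    if m: "a \<in> vcarrier A" "b \<in> vcarrier B" "a' \<in> vcarrier A" "b' \<in> vcarrier B" for a b a' b'
  proof -
    have "M (\<phi> a) (\<psi> b) (\<phi> a') (\<psi> b') =
      sw A a' (\<lambda>x r. sw A (\<phi> r) (\<lambda>y z. mult A (\<phi> a) y \<bowtie> mult B (Q (\<phi> x) z (\<psi> b)) (\<psi> b')))"
      unfolding M_def using m
      by (intro A.sw_hopf_endo[OF phi, where U = T] bilinear_onI lin) simp_all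
    also have "\<dots> = sw A a' (\<lambda>x r. sw A r (\<lambda>y z.
        mult A (\<phi> a) (\<phi> y) \<bowtie> mult B (Q (\<phi> x) (\<phi> z) (\<psi> b)) (\<psi> b')))"
      by (rule A.sw_cong[OF m(3)], rule A.sw_hopf_endo[OF phi, where U = T];
          (intro bilinear_onI lin)?) (use m in simp_all)
    also have "\<dots> = ?\<beta> (M a b a' b')"
      unfolding M_def using m
      by (simp add: A.linear_sw[OF \<beta>] Q \<phi>(2) \<psi>(2) cong: A.sw_cong)
    finally show ?thesis using m by (simp add: mult_D_pure)
  qed
  have mult: "?\<beta> (mult D s t) = mult D (?\<beta> s) (?\<beta> t)" if "s \<in> vcarrier T" "t \<in> vcarrier T" for s t
    by (rule tensor_bilinear_eqI[where U = T, OF _ _ _ _ that]; (intro conjI lin \<beta>lin)?)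
      (use that mult_pure in simp_all)
  show ?thesis
    unfolding hopf_endo_def D_space
  proof (intro conjI ballI \<beta> mult)
    show "?\<beta> (unit D) = unit D" by (simp add: unit_D \<phi> \<psi>)
    fix c assume c: "c \<in> vcarrier T"
    show "?\<beta> (alpha D c) = alpha D (?\<beta> c)" using c by (simp add: alpha_D)
    show "counit D (?\<beta> c) = counit D c"
      by (rule T_eqI[OF linear_on_compose[OF counit_D_linear \<beta>] counit_D_linear c])
        (simp add: counit_D_pure \<phi> \<psi>)
    \<comment> \<open>On pure tensors the antipode is a product in the double, so multiplicativity
      reduces this to the antipode of A and the inverse antipode of B.\<close>
    show "?\<beta> (antipode D c) = antipode D (?\<beta> c)"
      by (rule T_eqI[OF linear_on_compose[OF \<beta> antipode_D_linear]
            linear_on_compose[OF antipode_D_linear \<beta>] c])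
        (simp add: antipode_D_pure mult S' \<phi> \<psi>)
    show "sw D c (\<lambda>x y. ?\<beta> x \<otimes> ?\<beta> y) = comult D (?\<beta> c)"
    proof (rule T_eqI[OF _ linear_on_compose[OF comult_D_linear \<beta>] c])
      show "linear_on T (tensor T T) (\<lambda>c. sw D c (\<lambda>x y. ?\<beta> x \<otimes> ?\<beta> y))"
        by (intro lin \<beta>lin) simp_all
      fix a b assume m: "a \<in> vcarrier A" "b \<in> vcarrier B"
      have "sw D (a \<bowtie> b) (\<lambda>x y. ?\<beta> x \<otimes> ?\<beta> y) =
        sw A a (\<lambda>a1 a2. sw B b (\<lambda>b1 b2. ?\<beta> (a1 \<bowtie> b2) \<otimes> ?\<beta> (a2 \<bowtie> b1)))"
        using m by (intro sw_D_pure[where U = "tensor T T"] bilinear_onI lin \<beta>lin) simp_all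
      also have "\<dots> = sw A a (\<lambda>a1 a2. sw B b (\<lambda>b1 b2. (\<phi> a1 \<bowtie> \<psi> b2) \<otimes> (\<phi> a2 \<bowtie> \<psi> b1)))"
        using m by (simp cong: hom_hopf_data.sw_cong)
      also have "\<dots> = sw A a (\<lambda>a1 a2. sw B (\<psi> b) (\<lambda>b1 b2. (\<phi> a1 \<bowtie> b2) \<otimes> (\<phi> a2 \<bowtie> b1)))"
        by (rule A.sw_cong[OF m(1)], rule B.sw_hopf_endo[OF psi, where U = "tensor T T", symmetric];
            (intro bilinear_onI lin)?) (use m in simp_all)
      also have "\<dots> = C (\<phi> a) (\<psi> b)"
        unfolding C_def using m
        by (intro A.sw_hopf_endo[OF phi, where U = "tensor T T", symmetric] bilinear_onI lin)
          simp_all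
      finally show "sw D (a \<bowtie> b) (\<lambda>x y. ?\<beta> x \<otimes> ?\<beta> y) = comult D (?\<beta> (a \<bowtie> b))"
        using m by (simp add: comult_D_pure)
    qed
  qed
qed

section \<open>Removing the twist\<close>

definition untwist ::
  "('k::field, 'a::ab_group_add, 'm) hom_hopf_scheme \<Rightarrow> ('k, 'a, 'm) hom_hopf_scheme" where
  "untwist H = H\<lparr>alpha := \<lambda>x. x, mult := \<lambda>a b. alpha_inv H (mult H a b),
     comult := \<lambda>c. comult H (alpha_inv H c)\<rparr>"

lemma untwist_simps [simp]:
  "vcarrier (untwist H) = vcarrier H" "vscale (untwist H) = vscale H"
  "alpha (untwist H) = (\<lambda>x. x)" "mult (untwist H) a b = alpha_inv H (mult H a b)"
  "unit (untwist H) = unit H" "comult (untwist H) c = comult H (alpha_inv H c)"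
  "counit (untwist H) = counit H" "antipode (untwist H) = antipode H"
  by (simp_all add: untwist_def)

locale hom_hopf_bij = hom_hopf H + bij_antipode_data H
  for H :: "('k::field, 'a::ab_group_add, 'm) hom_hopf_scheme" +
  assumes bij_alpha: "bij_betw (alpha H) (vcarrier H) (vcarrier H)"
begin

lemma alpha_inv_mem [simp]: "x \<in> vcarrier H \<Longrightarrow> alpha_inv H x \<in> vcarrier H"
  using bij_alpha by (metis bij_betw_def inv_into_into)

lemma alpha_inv [simp]:
  "x \<in> vcarrier H \<Longrightarrow> alpha H (alpha_inv H x) = x"
  "x \<in> vcarrier H \<Longrightarrow> alpha_inv H (alpha H x) = x"
  using bij_alpha by (simp_all add: bij_betw_inv_into_left bij_betw_inv_into_right)

lemma alpha_inv_eqI: "x \<in> vcarrier H \<Longrightarrow> alpha H x = y \<Longrightarrow> alpha_inv H y = x"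
  by auto

lemma antipode_inv_alpha:
  "x \<in> vcarrier H \<Longrightarrow> antipode_inv H (alpha H x) = alpha H (antipode_inv H x)"
  by (rule antipode_inv_eqI) (simp_all add: antipode_alpha)

lemma alpha_inv_lin: "linear_on H H (alpha_inv H)"
  by (rule linear_onI)
    (auto intro!: alpha_inv_eqI
      simp: vs_add[OF vs] linear_on_add[OF alpha_lin] linear_on_scale[OF alpha_lin])

lemmas alpha_inv_linear [lin] = linear_on_compose[OF alpha_inv_lin]

lemma hopf_endo_alpha_inv: "hopf_endo H (alpha_inv H)"
  unfolding hopf_endo_def
proof (intro conjI ballI alpha_inv_lin)
  show "alpha_inv H (mult H a b) = mult H (alpha_inv H a) (alpha_inv H b)"
    if "a \<in> vcarrier H" "b \<in> vcarrier H" for a b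
    using that by (intro alpha_inv_eqI) (simp_all add: alpha_mult)
  show "alpha_inv H (unit H) = unit H" by (rule alpha_inv_eqI) simp_all
  fix c assume c: "c \<in> vcarrier H"
  have "sw H (alpha H (alpha_inv H c)) (\<lambda>x y. alpha_inv H x \<otimes>\<^bsub>H,H\<^esub> alpha_inv H y) =
    sw H (alpha_inv H c) (\<lambda>x y. alpha_inv H (alpha H x) \<otimes>\<^bsub>H,H\<^esub> alpha_inv H (alpha H y))"
    using c by (intro sw_alpha[where U = "tensor H H"] bilinear_onI lin) simp_all
  also have "\<dots> = comult H (alpha_inv H c)"
    using c sw_pure_self[of "alpha_inv H c"] by (simp cong: sw_cong)
  finally show "sw H c (\<lambda>x y. alpha_inv H x \<otimes>\<^bsub>H,H\<^esub> alpha_inv H y) = comult H (alpha_inv H c)"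
    using c by simp
  show "counit H (alpha_inv H c) = counit H c"
    using c counit_alpha[of "alpha_inv H c"] by simp
  show "alpha_inv H (alpha H c) = alpha H (alpha_inv H c)" using c by simp
  show "alpha_inv H (antipode H c) = antipode H (alpha_inv H c)"
    using c by (intro alpha_inv_eqI) (simp_all flip: antipode_alpha)
qed

text \<open>Removing a twist is itself a Yau twist, by the inverse structure map.\<close>

lemma hom_hopf_untwist: "hom_hopf (untwist H)"
  by (rule yau_twist[OF hopf_endo_alpha_inv]) simp_all

lemma hopf_bij_antipode_untwist: "hopf_bij_antipode (untwist H)"
proof -
  interpret U: hom_hopf "untwist H" by (rule hom_hopf_untwist)
  show ?thesis by unfold_locales (simp_all add: bij_antipode)
qed

lemma tsum_untwist: "tsum (untwist H) (untwist H) = tsum H H"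
  by (rule tsum_base_cong) simp_all

lemma pure_untwist: "pure (untwist H) (untwist H) = pure H H"
  by (rule pure_base_cong) simp_all

lemma linear_on_untwist:
  "linear_on (untwist H) V = linear_on H V" "linear_on V (untwist H) = linear_on V H"
  by (rule linear_on_base_cong; simp)+

lemma sw_untwist: "sw (untwist H) c f = sw H (alpha_inv H c) f"
  by (simp add: sw_def tsum_untwist)

text \<open>The given coproduct is the untwisted one after \<alpha>, and \<alpha> distributes over
  the legs: each leg gains one \<alpha>.\<close>

lemma sw_to_untwist:
  assumes "vector_space_on U" "bilinear_on H H U f" "c \<in> vcarrier H"
  shows "sw H c f = sw (untwist H) c (\<lambda>x y. f (alpha H x) (alpha H y))"
  using sw_alpha[OF assms(1,2), of "alpha_inv H c"] assms(3) by (simp add: sw_untwist)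

lemma hopf_endo_untwist_alpha: "hopf_endo (untwist H) (alpha H)"
  unfolding hopf_endo_def
proof (intro conjI ballI, unfold untwist_simps linear_on_untwist)
  show "linear_on H H (alpha H)" by (rule alpha_lin)
  show "alpha H (alpha_inv H (mult H a b)) = alpha_inv H (mult H (alpha H a) (alpha H b))"
    if "a \<in> vcarrier H" "b \<in> vcarrier H" for a b
    using that by (simp flip: alpha_mult)
  show "alpha H (unit H) = unit H" by simp
  fix c assume c: "c \<in> vcarrier H"
  show "sw (untwist H) c (\<lambda>x y. alpha H x \<otimes>\<^bsub>untwist H,untwist H\<^esub> alpha H y) =
    comult H (alpha_inv H (alpha H c))"
    using c comult_alpha_tensor[of "alpha_inv H c"]
    by (simp add: sw_untwist pure_untwist)
  show "counit H (alpha H c) = counit H c" by (rule counit_alpha[OF c])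
  show "alpha H (antipode H c) = antipode H (alpha H c)" by (simp add: antipode_alpha c)
qed simp

end

text \<open>For iterated coproducts: a leg that has already gained an \<alpha> passes it on when it
  is split again, so the new legs carry two.\<close>

lemma (in hom_hopf_bij) sw_alpha_to_untwist:
  assumes "vector_space_on U" "bilinear_on H H U f" "c \<in> vcarrier H"
  shows "sw H (alpha H c) f =
    sw (untwist H) c (\<lambda>x y. f (alpha H (alpha H x)) (alpha H (alpha H y)))"
proof -
  have "bilinear_on H H U (\<lambda>x y. f (alpha H x) (alpha H y))"
    by (intro bilinear_onI bilinear_on_left[OF assms(2)] bilinear_on_right[OF assms(2)] lin) simp_all
  from sw_to_untwist[OF assms(1) this assms(3)] sw_alpha[OF assms] show ?thesis by simp
qed

section \<open>Comparison of the given double with the untwisted one\<close>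

locale hom_dual_pair = A: hom_hopf_bij A + B: hom_hopf_bij B
  for A :: "('k::field, 'a::ab_group_add, 'm) hom_hopf_scheme"
    and B :: "('k, 'b::ab_group_add, 'n) hom_hopf_scheme" +
  fixes p :: "'a \<Rightarrow> 'b \<Rightarrow> 'k"
  assumes dual: "dual_pair A B p"
begin

lemma pair_bilin: "bilinear_on A B scalars p"
  using dual by (simp add: dual_pair_def)

lemmas pair_linear [lin] = bilinear_on_left[OF pair_bilin] bilinear_on_right[OF pair_bilin]

lemma pair_alpha [simp]:
  "a \<in> vcarrier A \<Longrightarrow> b \<in> vcarrier B \<Longrightarrow> p (alpha A a) (alpha B b) = p a b"
  using dual by (simp add: dual_pair_def)

lemma pair_alpha_inv [simp]:
  "a \<in> vcarrier A \<Longrightarrow> b \<in> vcarrier B \<Longrightarrow> p a (alpha_inv B b) = p (alpha A a) b"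
  using pair_alpha[of a "alpha_inv B b"] by simp

abbreviation p' where "p' \<equiv> \<lambda>a b. p (alpha A a) b"

text \<open>Each multiplicativity axiom of \<open>dual_pair\<close> carries two structure maps on
  the fixed arguments. Passing to untwisted legs brings powers on the opposite side, and invariance
  of the pairing cancels them down to the single \<alpha> in \<open>p'\<close>.\<close>

lemma ordinary_dual_pair_untwist: "ordinary_dual_pair (untwist A) (untwist B) p'"
proof (intro ordinary_dual_pair.intro ordinary_dual_pair_axioms.intro
    A.hopf_bij_antipode_untwist B.hopf_bij_antipode_untwist; (unfold untwist_simps)?)
  show "bilinear_on (untwist A) (untwist B) scalars p'"
    unfolding bilinear_on_def untwist_simps A.linear_on_untwist B.linear_on_untwist
    by (intro conjI ballI lin) simp_all
  show "nondegenerate_on (untwist A) (untwist B) p'"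
    unfolding nondegenerate_on_def untwist_simps
  proof (intro conjI ballI impI)
    fix a assume a: "a \<in> vcarrier A" "\<forall>b\<in>vcarrier B. p (alpha A a) b = 0"
    then have "alpha A a = 0"
      using dual unfolding dual_pair_def nondegenerate_on_def by (meson A.alpha_mem)
    then have "a = alpha_inv A 0" using a(1) by (metis A.alpha_inv(2))
    then show "a = 0" using linear_on_zero[OF A.vs A.alpha_inv_lin] by simp
  next
    fix b assume b: "b \<in> vcarrier B" "\<forall>a\<in>vcarrier A. p (alpha A a) b = 0"
    then have "\<forall>a\<in>vcarrier A. p a b = 0"
      using A.alpha_inv(1) A.alpha_inv_mem by metis
    moreover have "(\<forall>a\<in>vcarrier A. p a b = 0) \<longrightarrow> b = 0"
      using dual b(1) by (simp add: dual_pair_def nondegenerate_on_def)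
    ultimately show "b = 0" by blast
  qed
next
  fix a assume "a \<in> vcarrier A"
  then show "p (alpha A a) (unit B) = counit A a"
    using dual by (simp add: dual_pair_def A.counit_alpha)
next
  fix b assume "b \<in> vcarrier B"
  then show "p (alpha A (unit A)) b = counit B b"
    using dual by (simp add: dual_pair_def)
next
  fix a a' b assume m: "a \<in> vcarrier A" "a' \<in> vcarrier A" "b \<in> vcarrier B"
  let ?f = "\<lambda>b1 b2. p (alpha A (alpha A a)) b1 * p (alpha A (alpha A a')) b2"
  have f: "bilinear_on B B scalars ?f" using m by (intro bilinear_onI lin) simp_all
  have "p (alpha A (alpha_inv A (mult A a a'))) b = sweedler B scalars b ?f"
    using m dual by (simp add: dual_pair_def)
  \<comment> \<open>The structure map gained by each leg of \<open>b\<close> cancels one of the two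
    on \<open>a\<close> and \<open>a'\<close>.\<close>
  also have "\<dots> = sw (untwist B) b (\<lambda>b1 b2. ?f (alpha B b1) (alpha B b2))"
    using m f by (simp add: B.sweedler_eq_sw B.sw_to_untwist[where U = scalars])
  also have "\<dots> = sw (untwist B) b (\<lambda>b1 b2. p (alpha A a) b1 * p (alpha A a') b2)"
    unfolding B.sw_untwist using m by (intro B.sw_cong) simp_all
  finally show "p (alpha A (alpha_inv A (mult A a a'))) b =
    sw (untwist B) b (\<lambda>b1 b2. p (alpha A a) b1 * p (alpha A a') b2)" .
next
  fix a b b' assume m: "a \<in> vcarrier A" "b \<in> vcarrier B" "b' \<in> vcarrier B"
  let ?\<alpha> = "alpha A" and ?\<beta> = "alpha B"
  let ?f = "\<lambda>a1 a2. p a1 (?\<beta> (?\<beta> b)) * p a2 (?\<beta> (?\<beta> b'))"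
  \<comment> \<open>By invariance, the inverse structure map of the untwisted product in B becomes
    an additional \<alpha> on \<open>a\<close>, which is then distributed over the legs.\<close>
  have "p (?\<alpha> a) (alpha_inv B (mult B b b')) = p (?\<alpha> (?\<alpha> a)) (mult B b b')"
    using m by simp
  also have "\<dots> = sweedler A scalars (?\<alpha> (?\<alpha> a)) ?f"
    using m dual by (simp add: dual_pair_def)
  also have "\<dots> = sw A (?\<alpha> (?\<alpha> a)) ?f"
    using m by (intro A.sweedler_eq_sw bilinear_onI lin) simp_all
  also have "\<dots> = sw A (?\<alpha> a) (\<lambda>x y. ?f (?\<alpha> x) (?\<alpha> y))"
    using m by (intro A.sw_alpha[where U = scalars] bilinear_onI lin) simp_all
  also have "\<dots> = sw A (?\<alpha> a) (\<lambda>x y. p x (?\<beta> b) * p y (?\<beta> b'))"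
    using m by (intro A.sw_cong) simp_all
  also have "\<dots> = sw (untwist A) a (\<lambda>x y. p (?\<alpha> (?\<alpha> x)) (?\<beta> b) * p (?\<alpha> (?\<alpha> y)) (?\<beta> b'))"
    using m by (intro A.sw_alpha_to_untwist[where U = scalars] bilinear_onI lin) simp_all
  also have "\<dots> = sw (untwist A) a (\<lambda>x y. p (?\<alpha> x) b * p (?\<alpha> y) b')"
    unfolding A.sw_untwist using m by (intro A.sw_cong) simp_all
  finally show "p (?\<alpha> a) (alpha_inv B (mult B b b')) =
    sw (untwist A) a (\<lambda>a1 a2. p (?\<alpha> a1) b * p (?\<alpha> a2) b')" .
next
  fix a b assume "a \<in> vcarrier A" "b \<in> vcarrier B"
  then show "p (alpha A (antipode A a)) b = p (alpha A a) (antipode_inv B b)"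
    using dual by (simp add: dual_pair_def flip: A.antipode_alpha)
qed

interpretation O: ordinary_dual_pair "untwist A" "untwist B" p'
  by (rule ordinary_dual_pair_untwist)

abbreviation T where "T \<equiv> tensor A B"

abbreviation D' where "D' \<equiv> drinfeld_double (untwist A) (untwist B) p'"

abbreviation bow (infixl "\<bowtie>" 70) where "a \<bowtie> b \<equiv> pure A B a b"

abbreviation tensor_TT (infixl "\<otimes>" 70) where "s \<otimes> t \<equiv> pure T T s t"

lemma tensor_untwist: "tensor (untwist A) (untwist B) = T"
  by (rule tensor_base_cong) simp_all

lemma pure_untwist: "pure (untwist A) (untwist B) = pure A B"
  by (rule pure_base_cong) simp_all

lemma tsum_untwist: "tsum (untwist A) (untwist B) = tsum A B"
  by (rule tsum_base_cong) simp_all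

lemma tlift_untwist: "tlift (untwist A) (untwist B) U f = tlift A B U f"
  by (rule tlift_base_cong) simp_all

lemma tmap_untwist:
  "tmap (untwist A) (untwist B) (untwist A) (untwist B) f g = tmap A B A B f g"
  by (simp add: tmap_def tlift_untwist tensor_untwist pure_untwist)

lemma bilinear_on_untwist: "bilinear_on (untwist A) (untwist B) U = bilinear_on A B U"
  by (rule bilinear_on_dom_cong) simp_all

lemmas untwist_spaces =
  tensor_untwist pure_untwist tsum_untwist tlift_untwist tmap_untwist bilinear_on_untwist
  untwist_simps(1)

definition \<beta> where "\<beta> = tmap A B A B (alpha A) (alpha B)"

lemma beta_bilin: "bilinear_on A B T (\<lambda>a b. alpha A a \<bowtie> alpha B b)"
  by (intro bilinear_onI lin) simp_all

lemma beta_lin: "linear_on T T \<beta>"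
  unfolding \<beta>_def tmap_def by (intro linear_on_tlift beta_bilin) simp

lemma beta_pure [simp]:
  "a \<in> vcarrier A \<Longrightarrow> b \<in> vcarrier B \<Longrightarrow> \<beta> (a \<bowtie> b) = alpha A a \<bowtie> alpha B b"
  unfolding \<beta>_def tmap_def by (intro tlift_pure beta_bilin) simp

lemma beta_endo: "hopf_endo D' \<beta>"
  using O.double_endo[OF A.hopf_endo_untwist_alpha B.hopf_endo_untwist_alpha]
  by (simp add: \<beta>_def tmap_untwist)

text \<open>One coproduct in A and one in B is the shape common to \<open>R1_map\<close>,
  \<open>R2_map\<close> and the comultiplication of the double.\<close>

lemma sweedler2_eq:
  assumes U: "vector_space_on U" and f: "\<And>x y z. x \<in> vcarrier A \<Longrightarrow> y \<in> vcarrier B \<Longrightarrow> z \<in> vcarrier B \<Longrightarrow>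
      linear_on A U (\<lambda>w. f w x y z) \<and> linear_on A U (\<lambda>w. f x w y z)"
    and g: "\<And>x y z. x \<in> vcarrier A \<Longrightarrow> y \<in> vcarrier A \<Longrightarrow> z \<in> vcarrier B \<Longrightarrow>
      linear_on B U (\<lambda>w. f x y w z) \<and> linear_on B U (\<lambda>w. f x y z w)"
    and a: "a \<in> vcarrier A" and b: "b \<in> vcarrier B"
  shows "sweedler A U a (\<lambda>a1 a2. sweedler B U b (\<lambda>b1 b2. f a1 a2 b1 b2)) =
    sw (untwist A) a (\<lambda>a1 a2. sw (untwist B) b (\<lambda>b1 b2.
      f (alpha A a1) (alpha A a2) (alpha B b1) (alpha B b2)))"
proof -
  note l = f[THEN conjunct1] f[THEN conjunct2] g[THEN conjunct1] g[THEN conjunct2]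
  have "sweedler A U a (\<lambda>a1 a2. sweedler B U b (\<lambda>b1 b2. f a1 a2 b1 b2)) =
    sw A a (\<lambda>a1 a2. sw B b (\<lambda>b1 b2. f a1 a2 b1 b2))"
    by (intro A.sweedler_eqI B.sweedler_eqI bilinear_onI lin l refl U a b)
  also have "\<dots> = sw (untwist A) a (\<lambda>a1 a2. sw B b (\<lambda>b1 b2. f (alpha A a1) (alpha A a2) b1 b2))"
    by (intro A.sw_to_untwist[where U = U] bilinear_onI lin l U a b)
  also have "\<dots> = sw (untwist A) a (\<lambda>a1 a2. sw (untwist B) b (\<lambda>b1 b2.
      f (alpha A a1) (alpha A a2) (alpha B b1) (alpha B b2)))"
    unfolding A.sw_untwist using a
    by (intro A.sw_cong B.sw_to_untwist[where U = U] bilinear_onI l U b) simp_all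
  finally show ?thesis .
qed

text \<open>The structure maps gained by the surviving legs cancel against the inverses in the
  definition, and those in the coefficient leave exactly \<open>p'\<close>. The same happens for
  \<open>R2_map\<close>.\<close>

lemma R1_untwist: "R1_map A B p = R1_map (untwist A) (untwist B) p'"
  unfolding O.R1_eq tlift_untwist tensor_untwist
  unfolding R1_map_def
proof (rule tlift_cong)
  fix a b assume ab: "a \<in> vcarrier A" "b \<in> vcarrier B"
  have "sweedler A T a (\<lambda>a1 a2. sweedler B T b (\<lambda>b1 b2.
      tscale (p (alpha A a2) b1) (alpha_inv A a1 \<bowtie> alpha_inv B b2))) =
    sw (untwist A) a (\<lambda>a1 a2. sw (untwist B) b (\<lambda>b1 b2.
      tscale (p (alpha A (alpha A a2)) (alpha B b1))
        (alpha_inv A (alpha A a1) \<bowtie> alpha_inv B (alpha B b2))))"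
    using ab by (intro sweedler2_eq conjI lin) simp_all
  also have "\<dots> = O.rot1 a b"
    unfolding O.rot1_expand[unfolded untwist_spaces, OF ab, symmetric] A.sw_untwist B.sw_untwist
    using ab by (intro A.sw_cong B.sw_cong) simp_all
  finally show "sweedler A T a (\<lambda>a1 a2. sweedler B T b (\<lambda>b1 b2.
      tscale (p (alpha A a2) b1) (alpha_inv A a1 \<bowtie> alpha_inv B b2))) = O.rot1 a b" .
qed

lemma R2_untwist: "R2_map A B p = R2_map (untwist A) (untwist B) p'"
  unfolding O.R2_eq tlift_untwist tensor_untwist
  unfolding R2_map_def
proof (rule tlift_cong)
  fix a b assume ab: "a \<in> vcarrier A" "b \<in> vcarrier B"
  have "sweedler A T a (\<lambda>a1 a2. sweedler B T b (\<lambda>b1 b2.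
      tscale (p (alpha A a1) b2) (alpha_inv A a2 \<bowtie> alpha_inv B b1))) =
    sw (untwist A) a (\<lambda>a1 a2. sw (untwist B) b (\<lambda>b1 b2.
      tscale (p (alpha A (alpha A a1)) (alpha B b2))
        (alpha_inv A (alpha A a2) \<bowtie> alpha_inv B (alpha B b1))))"
    using ab by (intro sweedler2_eq conjI lin) simp_all
  also have "\<dots> = O.rot O.R a b"
    unfolding O.rot_R_expand[unfolded untwist_spaces, OF ab, symmetric] A.sw_untwist B.sw_untwist
    using ab by (intro A.sw_cong B.sw_cong) simp_all
  finally show "sweedler A T a (\<lambda>a1 a2. sweedler B T b (\<lambda>b1 b2.
      tscale (p (alpha A a1) b2) (alpha_inv A a2 \<bowtie> alpha_inv B b1))) = O.rot O.R a b" .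
qed

text \<open>The antipode is composed of \<open>R1_map\<close>, \<open>R2_map\<close>, flips and the
  given antipodes, none of which changes under untwisting. It therefore needs no correction by
  \<beta>, as a Yau twist demands.\<close>

lemma antipode_untwist: "antipode (drinfeld_double A B p) = antipode D'"
proof -
  have "tflip (untwist A) (untwist B) = tflip A B" "tflip (untwist B) (untwist A) = tflip B A"
    unfolding tflip_def
    by (rule tlift_base_cong;
        simp add: tensor_base_cong[of "untwist A" A "untwist B" B]
          tensor_base_cong[of "untwist B" B "untwist A" A]
          pure_base_cong[of "untwist A" A "untwist B" B]
          pure_base_cong[of "untwist B" B "untwist A" A])+
  then show ?thesis
    by (simp add: drinfeld_double_def T_map_def R1_untwist R2_untwist untwist_spaces)
qed

lemma comult_untwist:
  assumes "t \<in> vcarrier T"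
  shows "comult (drinfeld_double A B p) t = comult D' (\<beta> t)"
proof -
  let ?f = "\<lambda>a b. sweedler A (tensor T T) a (\<lambda>a1 a2. sweedler B (tensor T T) b (\<lambda>b1 b2.
    (a1 \<bowtie> b2) \<otimes> (a2 \<bowtie> b1)))"
  have C: "bilinear_on A B (tensor T T) O.C"
    using O.C_bilin by (simp add: untwist_spaces)
  have f: "?f a b = O.C (alpha A a) (alpha B b)" if ab: "a \<in> vcarrier A" "b \<in> vcarrier B" for a b
  proof -
    have "?f a b = sw (untwist A) a (\<lambda>a1 a2. sw (untwist B) b (\<lambda>b1 b2.
      (alpha A a1 \<bowtie> alpha B b2) \<otimes> (alpha A a2 \<bowtie> alpha B b1)))"
      using ab by (intro sweedler2_eq[where U = "tensor T T"] conjI lin) simp_all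
    also have "\<dots> = sw A a (\<lambda>a1 a2. sw B b (\<lambda>b1 b2. (a1 \<bowtie> b2) \<otimes> (a2 \<bowtie> b1)))"
      using ab
      by (subst sweedler2_eq[where U = "tensor T T", symmetric];
          (intro conjI lin A.sweedler_eqI B.sweedler_eqI bilinear_onI)?) simp_all
    \<comment> \<open>A sum over the given coproduct at \<open>a\<close> is a sum over the untwisted
      coproduct at \<open>\<alpha> a\<close>.\<close>
    also have "\<dots> = O.C (alpha A a) (alpha B b)"
      using ab by (simp add: O.C_def untwist_spaces A.sw_untwist B.sw_untwist)
    finally show ?thesis .
  qed
  have bil: "bilinear_on A B (tensor T T) (\<lambda>a b. O.C (alpha A a) (alpha B b))"
    by (intro bilinear_onI bilinear_on_left[OF C] bilinear_on_right[OF C] lin) simp_all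
  have "comult (drinfeld_double A B p) t = tlift A B (tensor T T) ?f t"
    by (simp add: drinfeld_double_def Let_def)
  also have "\<dots> = tlift A B (tensor T T) (\<lambda>a b. O.C (alpha A a) (alpha B b)) t"
    by (rule fun_cong[OF tlift_cong]) (rule f)
  also have "\<dots> = comult D' (\<beta> t)"
  proof (rule tensor_linear_eqI[OF linear_on_tlift[OF _ bil] _ _ assms])
    show "linear_on T (tensor T T) (\<lambda>t. comult D' (\<beta> t))"
      by (rule linear_on_compose[OF O.comult_D_linear[unfolded untwist_spaces] beta_lin])
    fix a b assume "a \<in> vcarrier A" "b \<in> vcarrier B"
    then show "tlift A B (tensor T T) (\<lambda>a b. O.C (alpha A a) (alpha B b)) (a \<bowtie> b) = comult D' (\<beta> (a \<bowtie> b))"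
      by (simp add: tlift_pure[OF _ bil] O.comult_D_pure[unfolded untwist_spaces])
  qed simp
  finally show ?thesis .
qed

text \<open>The powers of \<alpha> in the product formula are those that cancel the ones gained by
  the legs: x1 and y2 gain one structure map, while x21, x22, y11 and y12, which are split twice,
  gain two. The only remainder is one \<beta> around the untwisted products.\<close>

lemma mult_untwist:
  assumes s: "s \<in> vcarrier T" and t: "t \<in> vcarrier T"
  shows "mult (drinfeld_double A B p) s t = \<beta> (mult D' s t)"
proof -
  let ?S = "\<lambda>a y x b'. sweedler A T x (\<lambda>x1 x2. sweedler A T x2 (\<lambda>x21 x22.
       sweedler B T y (\<lambda>y1 y2. sweedler B T y1 (\<lambda>y11 y12.
         tscale (p (antipode_inv A (alpha A x1)) y2 * p x22 (alpha_inv B y11))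
           (mult A a (alpha_inv A (alpha_inv A x21)) \<bowtie> mult B (alpha_inv B (alpha_inv B y12)) b')))))"
  have S: "?S a y x b' = \<beta> (O.M a y x b')"
    if m: "a \<in> vcarrier A" "y \<in> vcarrier B" "x \<in> vcarrier A" "b' \<in> vcarrier B" for a y x b'
  proof -
    let ?\<alpha> = "alpha A" and ?\<gamma> = "alpha B"
    let ?F = "\<lambda>x1 x21 x22 y11 y12 y2.
      tscale (p (antipode_inv A (?\<alpha> x1)) y2 * p x22 (alpha_inv B y11))
        (mult A a (alpha_inv A (alpha_inv A x21)) \<bowtie> mult B (alpha_inv B (alpha_inv B y12)) b')"
    have "?S a y x b' = sw A x (\<lambda>x1 x2. sw A x2 (\<lambda>x21 x22. sw B y (\<lambda>y1 y2. sw B y1 (\<lambda>y11 y12.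
        ?F x1 x21 x22 y11 y12 y2))))"
      using m by (intro A.sweedler_eqI B.sweedler_eqI bilinear_onI lin) simp_all
    also have "\<dots> = sw (untwist A) x (\<lambda>x1 x2. sw A (?\<alpha> x2) (\<lambda>x21 x22. sw B y (\<lambda>y1 y2.
        sw B y1 (\<lambda>y11 y12. ?F (?\<alpha> x1) x21 x22 y11 y12 y2))))"
      using m by (intro A.sw_to_untwist[where U = T] bilinear_onI lin) simp_all
    also have "\<dots> = sw (untwist A) x (\<lambda>x1 x2. sw (untwist A) x2 (\<lambda>x21 x22. sw B y (\<lambda>y1 y2.
        sw B y1 (\<lambda>y11 y12. ?F (?\<alpha> x1) (?\<alpha> (?\<alpha> x21)) (?\<alpha> (?\<alpha> x22)) y11 y12 y2))))"
      by (rule O.A.sw_cong, use m in simp, rule A.sw_alpha_to_untwist[where U = T];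
          (intro bilinear_onI lin)?) (use m in simp_all)
    also have "\<dots> = sw (untwist A) x (\<lambda>x1 x2. sw (untwist A) x2 (\<lambda>x21 x22. sw (untwist B) y (\<lambda>y1 y2.
        sw B (?\<gamma> y1) (\<lambda>y11 y12. ?F (?\<alpha> x1) (?\<alpha> (?\<alpha> x21)) (?\<alpha> (?\<alpha> x22)) y11 y12 (?\<gamma> y2)))))"
      by (rule O.A.sw_cong, use m in simp, rule O.A.sw_cong, assumption,
          rule B.sw_to_untwist[where U = T]; (intro bilinear_onI lin)?) (use m in simp_all)
    also have "\<dots> = sw (untwist A) x (\<lambda>x1 x2. sw (untwist A) x2 (\<lambda>x21 x22. sw (untwist B) y (\<lambda>y1 y2.
        sw (untwist B) y1 (\<lambda>y11 y12. ?F (?\<alpha> x1) (?\<alpha> (?\<alpha> x21)) (?\<alpha> (?\<alpha> x22))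
          (?\<gamma> (?\<gamma> y11)) (?\<gamma> (?\<gamma> y12)) (?\<gamma> y2)))))"
      by (rule O.A.sw_cong, use m in simp, rule O.A.sw_cong, assumption, rule O.B.sw_cong,
          use m in simp, rule B.sw_alpha_to_untwist[where U = T]; (intro bilinear_onI lin)?)
        (use m in simp_all)
    \<comment> \<open>In the coefficients invariance cancels one structure map on each side and
      leaves \<open>p'\<close>. In the tensor the outer \<beta> undoes the inverse structure maps
      contained in the untwisted products.\<close>
    also have "\<dots> = sw (untwist A) x (\<lambda>x1 x2. sw (untwist A) x2 (\<lambda>x21 x22. sw (untwist B) y (\<lambda>y1 y2.
        sw (untwist B) y1 (\<lambda>y11 y12. \<beta> (tscale (p' (antipode_inv A x1) y2 * p' x22 y11)
          (mult (untwist A) a x21 \<bowtie> mult (untwist B) y12 b'))))))"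
      using m linear_on_scale[OF beta_lin]
      by (intro O.A.sw_cong O.B.sw_cong) (simp_all add: A.antipode_inv_alpha)
    also have "\<dots> = \<beta> (sw (untwist A) x (\<lambda>x1 x2. sw (untwist A) x2 (\<lambda>x21 x22. sw (untwist B) y
        (\<lambda>y1 y2. sw (untwist B) y1 (\<lambda>y11 y12. tscale (p' (antipode_inv A x1) y2 * p' x22 y11)
          (mult (untwist A) a x21 \<bowtie> mult (untwist B) y12 b'))))))"
    proof -
      let ?G = "\<lambda>x1 x21 x22 y11 y12 y2. tscale (p' (antipode_inv A x1) y2 * p' x22 y11)
        (mult (untwist A) a x21 \<bowtie> mult (untwist B) y12 b')"
      have G: "?G x1 x21 x22 y11 y12 y2 \<in> vcarrier T"
        if "x1 \<in> vcarrier A" "x21 \<in> vcarrier A" "x22 \<in> vcarrier A"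
          "y11 \<in> vcarrier B" "y12 \<in> vcarrier B" "y2 \<in> vcarrier B" for x1 x21 x22 y11 y12 y2
        using m that by simp
      have G1: "sw (untwist B) y1 (\<lambda>y11 y12. ?G x1 x21 x22 y11 y12 y2) \<in> vcarrier T"
        if "x1 \<in> vcarrier A" "x21 \<in> vcarrier A" "x22 \<in> vcarrier A"
          "y1 \<in> vcarrier B" "y2 \<in> vcarrier B" for x1 x21 x22 y1 y2
        using that by (intro O.B.sw_mem G) simp_all
      have G2: "sw (untwist B) y (\<lambda>y1 y2. sw (untwist B) y1 (\<lambda>y11 y12. ?G x1 x21 x22 y11 y12 y2))
        \<in> vcarrier T"
        if "x1 \<in> vcarrier A" "x21 \<in> vcarrier A" "x22 \<in> vcarrier A" for x1 x21 x22
        using m that by (intro O.B.sw_mem G1) simp_all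
      have G3: "sw (untwist A) x2 (\<lambda>x21 x22. sw (untwist B) y (\<lambda>y1 y2. sw (untwist B) y1
          (\<lambda>y11 y12. ?G x1 x21 x22 y11 y12 y2))) \<in> vcarrier T"
        if "x1 \<in> vcarrier A" "x2 \<in> vcarrier A" for x1 x2
        using that by (intro O.A.sw_mem G2) simp_all
      have "\<beta> (sw (untwist A) x (\<lambda>x1 x2. sw (untwist A) x2 (\<lambda>x21 x22. sw (untwist B) y
          (\<lambda>y1 y2. sw (untwist B) y1 (\<lambda>y11 y12. ?G x1 x21 x22 y11 y12 y2))))) =
        sw (untwist A) x (\<lambda>x1 x2. \<beta> (sw (untwist A) x2 (\<lambda>x21 x22. sw (untwist B) y
          (\<lambda>y1 y2. sw (untwist B) y1 (\<lambda>y11 y12. ?G x1 x21 x22 y11 y12 y2)))))"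
        using m by (intro O.A.linear_sw[OF beta_lin] G3) simp_all
      also have "\<dots> = sw (untwist A) x (\<lambda>x1 x2. sw (untwist A) x2 (\<lambda>x21 x22. \<beta> (sw (untwist B) y
          (\<lambda>y1 y2. sw (untwist B) y1 (\<lambda>y11 y12. ?G x1 x21 x22 y11 y12 y2)))))"
        using m by (intro O.A.sw_cong O.A.linear_sw[OF beta_lin] G2) simp_all
      also have "\<dots> = sw (untwist A) x (\<lambda>x1 x2. sw (untwist A) x2 (\<lambda>x21 x22. sw (untwist B) y
          (\<lambda>y1 y2. \<beta> (sw (untwist B) y1 (\<lambda>y11 y12. ?G x1 x21 x22 y11 y12 y2)))))"
        using m by (intro O.A.sw_cong O.B.linear_sw[OF beta_lin] G1) simp_all
      also have "\<dots> = sw (untwist A) x (\<lambda>x1 x2. sw (untwist A) x2 (\<lambda>x21 x22. sw (untwist B) y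
          (\<lambda>y1 y2. sw (untwist B) y1 (\<lambda>y11 y12. \<beta> (?G x1 x21 x22 y11 y12 y2)))))"
        using m by (intro O.A.sw_cong O.B.sw_cong O.B.linear_sw[OF beta_lin] G) simp_all
      finally show ?thesis by simp
    qed
    also have "\<dots> = \<beta> (O.M a y x b')"
      using O.M_expand[unfolded untwist_spaces, OF m] by simp
    finally show ?thesis .
  qed
  note M_mem = bilinear_on_mem[OF O.M_bilin[unfolded untwist_spaces]]
  have M: "bilinear_on A B T (\<lambda>a b. \<beta> (O.M a' b' a b))" if "a' \<in> vcarrier A" "b' \<in> vcarrier B" for a' b'
    using O.M_bilin[of a' b'] that
    by (auto simp: untwist_spaces bilinear_on_def intro: linear_on_compose[OF beta_lin])
  have M2: "bilinear_on A B T (\<lambda>a b. \<beta> (tsum A B t (O.M a b)))"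
    using O.M_tsum_bilin[of t] t
    by (auto simp: untwist_spaces bilinear_on_def intro: linear_on_compose[OF beta_lin])
  have inner: "tlift A B T (?S a y) t = \<beta> (tsum A B t (O.M a y))"
    if m: "a \<in> vcarrier A" "y \<in> vcarrier B" for a y
  proof -
    have "tlift A B T (?S a y) t = tlift A B T (\<lambda>x b'. \<beta> (O.M a y x b')) t"
      by (rule fun_cong[OF tlift_cong]) (use S m in blast)
    also have "\<dots> = tsum A B t (\<lambda>x b'. \<beta> (O.M a y x b'))"
      using t m by (simp add: tlift_eq_tsum[OF _ _ M])
    also have "\<dots> = \<beta> (tsum A B t (O.M a y))"
      using t m M_mem by (intro linear_on_tsum[OF _ _ _ beta_lin, symmetric]) simp_all
    finally show ?thesis .
  qed
  have "mult (drinfeld_double A B p) s t = tlift A B T (\<lambda>a y. tlift A B T (?S a y) t) s"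
    by (simp add: drinfeld_double_def double_mult_def)
  also have "\<dots> = tlift A B T (\<lambda>a y. \<beta> (tsum A B t (O.M a y))) s"
    by (rule fun_cong[OF tlift_cong]) (rule inner)
  also have "\<dots> = tsum A B s (\<lambda>a y. \<beta> (tsum A B t (O.M a y)))"
    using s by (simp add: tlift_eq_tsum[OF _ _ M2])
  also have "\<dots> = \<beta> (tsum A B s (\<lambda>a y. tsum A B t (O.M a y)))"
    using s t M_mem
    by (intro linear_on_tsum[OF _ _ _ beta_lin, symmetric] tsum_mem) simp_all
  also have "\<dots> = \<beta> (mult D' s t)"
    using O.mult_D[unfolded untwist_spaces, OF s t] by simp
  finally show ?thesis .
qed

lemma hom_hopf_double: "hom_hopf (drinfeld_double A B p)"
proof (rule hom_hopf.yau_twist[OF O.D_hom_hopf beta_endo])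
  show "vcarrier (drinfeld_double A B p) = vcarrier D'"
    "vscale (drinfeld_double A B p) = vscale D'"
    "unit (drinfeld_double A B p) = unit D'"
    by (simp_all add: drinfeld_double_def untwist_spaces)
  have carrier: "vcarrier D' = vcarrier T" by (simp add: drinfeld_double_def untwist_spaces)
  fix c assume "c \<in> vcarrier D'"
  then have c: "c \<in> vcarrier T" by (simp add: carrier)
  have "alpha (drinfeld_double A B p) c = \<beta> c" by (simp add: drinfeld_double_def \<beta>_def)
  then show "alpha (drinfeld_double A B p) c = \<beta> (alpha D' c)"
    using c by (simp add: O.alpha_D[unfolded untwist_spaces])
  show "comult (drinfeld_double A B p) c = comult D' (\<beta> c)" by (rule comult_untwist[OF c])
  show "counit (drinfeld_double A B p) c = counit D' c"
    by (simp add: drinfeld_double_def untwist_spaces)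
  show "antipode (drinfeld_double A B p) c = antipode D' c" by (simp add: antipode_untwist)
  fix d assume "d \<in> vcarrier D'"
  then show "mult (drinfeld_double A B p) c d = \<beta> (mult D' c d)"
    using c by (simp add: carrier mult_untwist)
qed

end

theorem theorem3p4:
  fixes A :: "('k::field, 'a::ab_group_add) hom_hopf"
    and B :: "('k, 'b::ab_group_add) hom_hopf"
    and p :: "'a \<Rightarrow> 'b \<Rightarrow> 'k"
  assumes "hom_hopf_algebra A" and "hom_hopf_algebra B"
    and "bij_betw (alpha A) (vcarrier A) (vcarrier A)"
    and "bij_betw (alpha B) (vcarrier B) (vcarrier B)"
    and "bij_betw (antipode A) (vcarrier A) (vcarrier A)"
    and "bij_betw (antipode B) (vcarrier B) (vcarrier B)"
    and "dual_pair A B p"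
  shows "hom_hopf_algebra (drinfeld_double A B p)"
proof -
  interpret hom_dual_pair A B p
    using assms
    by (simp add: hom_dual_pair_def hom_dual_pair_axioms_def hom_hopf_bij_def
        hom_hopf_bij_axioms_def bij_antipode_data_def bij_antipode_data_axioms_def
        hom_hopf_algebra_iff hom_hopf_def)
  show ?thesis
    unfolding hom_hopf_algebra_iff by (rule hom_hopf_double)
qed

end
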